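(* No non-trivial De Morgan formal space $S$ can be proved to be compact in $\mathrm{CZF}^*$, $\mathrm{CTT}^*$.
   Context: Systems. CZF is Aczel's constructive set theory; CTT is Martin-Löf's constructive type theory. $\mathrm{CZF}^*$ denotes an arbitrary fixed extension of CZF consistent with the scheme GUP-CZF: for every set $I$, $(\forall x)(\exists y\in I)A(x,y)\to(\exists y\in I)(\forall x)A(x,y)$ ($x$ ranging over all sets). $\mathrm{CTT}^*$ denotes an arbitrary fixed extension of CTT consistent with GUP-CTT: for every set $I$, every $R$ mapping a proposition and an element of $I$ to a proposition, and every $F$ from propositions to $I$ with $R(P,F(P))$ for all $P$, there is $\bar i\in I$ with $R(P,\bar i)$ for all $P$. "No $S$ of a given type can be proved to have property $Q$ in $T$" is a metamathematical statement: for no $S$ (given by a definition in $T$) that is of the given type in $T$ does $T$ prove that $S$ has property $Q$. Formal spaces. A formal space is a pair $(S,\vartriangleleft)$ with $S$ a set and $\vartriangleleft$ a relation (a class in CZF) between elements and subsets of $S$ such that: $a\in U$ implies $a\vartriangleleft U$; $a\vartriangleleft U$ and $U\vartriangleleft V$ imply $a\vartriangleleft V$; $a\vartriangleleft U$ and $a\vartriangleleft V$ imply $a\vartriangleleft U\downarrow V$; and (in CZF) $\{a\in S:a\vartriangleleft U\}$ is a set for every $U\subseteq S$. Here $U\vartriangleleft V$ means $(\forall u\in U)\,u\vartriangleleft V$, $U\downarrow V\equiv\{d\in S:(\exists u\in U)\,d\vartriangleleft\{u\}\ \&\ (\exists v\in V)\,d\vartriangleleft\{v\}\}$, and $a\downarrow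 U$ means $\{a\}\downarrow U$. The pseudocomplement of $U\subseteq S$ is $U^*\equiv\{a\in S:a\downarrow U\vartriangleleft\emptyset\}$. $S$ is non-trivial if $\neg(S\vartriangleleft\emptyset)$; De Morgan if $S\vartriangleleft U^{**}\cup U^*$ for all $U\subseteq S$; compact if $S\vartriangleleft U$ implies $S\vartriangleleft u_0$ for some finite (i.e. finitely listed, $u_0=\{x_1,\dots,x_n\}$, $n\ge 0$) $u_0\subseteq U$. (One may always assume that $S$ has a top element $1_S$, i.e. $S\vartriangleleft\{1_S\}$; then $S$ may be replaced by $1_S$ on the left of these conditions.) *)

theory Defs
  imports Main
begin

section \<open>First-order intuitionistic set theory\<close>

text \<open>Formulas of the language of set theory in de Bruijn notation; the only terms are variables.\<close>

datatype fm = Bot | Mem nat nat | Eq nat nat | And fm fm | Or fm fm | Imp fm fm | All fm | Ex fm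

fun up :: "(nat \<Rightarrow> nat) \<Rightarrow> nat \<Rightarrow> nat" where
  "up f 0 = 0"
| "up f (Suc i) = Suc (f i)"

fun fren :: "(nat \<Rightarrow> nat) \<Rightarrow> fm \<Rightarrow> fm" where
  "fren f Bot = Bot"
| "fren f (Mem x y) = Mem (f x) (f y)"
| "fren f (Eq x y) = Eq (f x) (f y)"
| "fren f (And p q) = And (fren f p) (fren f q)"
| "fren f (Or p q) = Or (fren f p) (fren f q)"
| "fren f (Imp p q) = Imp (fren f p) (fren f q)"
| "fren f (All p) = All (fren (up f) p)"
| "fren f (Ex p) = Ex (fren (up f) p)"

fun fv :: "fm \<Rightarrow> nat set" where
  "fv Bot = {}"
| "fv (Mem x y) = {x, y}"
| "fv (Eq x y) = {x, y}"
| "fv (And p q) = fv p \<union> fv q"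
| "fv (Or p q) = fv p \<union> fv q"
| "fv (Imp p q) = fv p \<union> fv q"
| "fv (All p) = {i. Suc i \<in> fv p}"
| "fv (Ex p) = {i. Suc i \<in> fv p}"

fun inst :: "nat \<Rightarrow> nat \<Rightarrow> nat" where
  "inst x 0 = x"
| "inst x (Suc i) = i"

text \<open>Natural deduction for intuitionistic first-order logic with equality.\<close>

inductive nd :: "fm set \<Rightarrow> fm \<Rightarrow> bool" (infix "\<turnstile>" 40) where
  Hyp: "p \<in> G \<Longrightarrow> G \<turnstile> p"
| BotE: "G \<turnstile> Bot \<Longrightarrow> G \<turnstile> p"
| AndI: "G \<turnstile> p \<Longrightarrow> G \<turnstile> q \<Longrightarrow> G \<turnstile> And p q"
| AndE1: "G \<turnstile> And p q \<Longrightarrow> G \<turnstile> p"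
| AndE2: "G \<turnstile> And p q \<Longrightarrow> G \<turnstile> q"
| OrI1: "G \<turnstile> p \<Longrightarrow> G \<turnstile> Or p q"
| OrI2: "G \<turnstile> q \<Longrightarrow> G \<turnstile> Or p q"
| OrE: "G \<turnstile> Or p q \<Longrightarrow> insert p G \<turnstile> r \<Longrightarrow> insert q G \<turnstile> r \<Longrightarrow> G \<turnstile> r"
| ImpI: "insert p G \<turnstile> q \<Longrightarrow> G \<turnstile> Imp p q"
| ImpE: "G \<turnstile> Imp p q \<Longrightarrow> G \<turnstile> p \<Longrightarrow> G \<turnstile> q"
| AllI: "fren Suc ` G \<turnstile> p \<Longrightarrow> G \<turnstile> All p"
| AllE: "G \<turnstile> All p \<Longrightarrow> G \<turnstile> fren (inst x) p"
| ExI: "G \<turnstile> fren (inst x) p \<Longrightarrow> G \<turnstile> Ex p"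
| ExE: "G \<turnstile> Ex p \<Longrightarrow> insert p (fren Suc ` G) \<turnstile> fren Suc q \<Longrightarrow> G \<turnstile> q"
| EqI: "G \<turnstile> Eq x x"
| EqE: "G \<turnstile> Eq x y \<Longrightarrow> G \<turnstile> fren (inst x) p \<Longrightarrow> G \<turnstile> fren (inst y) p"

text \<open>Bounded formulas, i.e. those with quantifiers of the forms
  \<open>\<forall>x. x \<in> y \<longrightarrow> p\<close> and \<open>\<exists>x. x \<in> y \<and> p\<close> only, where \<open>y\<close> is not \<open>x\<close>.\<close>

inductive bounded :: "fm \<Rightarrow> bool" where
  "bounded Bot"
| "bounded (Mem x y)"
| "bounded (Eq x y)"
| "bounded p \<Longrightarrow> bounded q \<Longrightarrow> bounded (And p q)"
| "bounded p \<Longrightarrow> bounded q \<Longrightarrow> bounded (Or p q)"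
| "bounded p \<Longrightarrow> bounded q \<Longrightarrow> bounded (Imp p q)"
| "bounded p \<Longrightarrow> bounded (All (Imp (Mem 0 (Suc y)) p))"
| "bounded p \<Longrightarrow> bounded (Ex (And (Mem 0 (Suc y)) p))"

subsection \<open>Named variables on top of de Bruijn indices\<close>

text \<open>To write concrete formulas legibly, formulas and variables are made functions of the number
  \<open>d\<close> of binders above them. A variable bound by the binder at depth \<open>d\<close> has the de Bruijn index
  \<open>d' - d - 1\<close> at every depth \<open>d' > d\<close>. The formula denoted by such an \<open>A\<close> is \<open>A 0\<close>.\<close>

type_synonym hvar = "nat \<Rightarrow> nat"
type_synonym hfm = "nat \<Rightarrow> fm"

definition hBot :: hfm ("\<^bold>\<bottom>") where "\<^bold>\<bottom> = (\<lambda>d. Bot)"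
definition hMem :: "hvar \<Rightarrow> hvar \<Rightarrow> hfm" (infix "\<^bold>\<in>" 70) where
  "(x \<^bold>\<in> y) = (\<lambda>d. Mem (x d) (y d))"
definition hEq :: "hvar \<Rightarrow> hvar \<Rightarrow> hfm" (infix "\<^bold>=" 70) where
  "(x \<^bold>= y) = (\<lambda>d. Eq (x d) (y d))"
definition hAnd :: "hfm \<Rightarrow> hfm \<Rightarrow> hfm" (infixr "\<^bold>\<and>" 55) where
  "(A \<^bold>\<and> B) = (\<lambda>d. And (A d) (B d))"
definition hOr :: "hfm \<Rightarrow> hfm \<Rightarrow> hfm" (infixr "\<^bold>\<or>" 50) where
  "(A \<^bold>\<or> B) = (\<lambda>d. Or (A d) (B d))"
definition hImp :: "hfm \<Rightarrow> hfm \<Rightarrow> hfm" (infixr "\<^bold>\<longrightarrow>" 45) where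
  "(A \<^bold>\<longrightarrow> B) = (\<lambda>d. Imp (A d) (B d))"
definition hIff :: "hfm \<Rightarrow> hfm \<Rightarrow> hfm" (infixr "\<^bold>\<longleftrightarrow>" 45) where
  "(A \<^bold>\<longleftrightarrow> B) = ((A \<^bold>\<longrightarrow> B) \<^bold>\<and> (B \<^bold>\<longrightarrow> A))"
definition hAll :: "(hvar \<Rightarrow> hfm) \<Rightarrow> hfm" (binder "\<^bold>\<forall>" 40) where
  "(\<^bold>\<forall>x. A x) = (\<lambda>d. All (A (\<lambda>d'. d' - d - 1) (Suc d)))"
definition hEx :: "(hvar \<Rightarrow> hfm) \<Rightarrow> hfm" (binder "\<^bold>\<exists>" 40) where
  "(\<^bold>\<exists>x. A x) = (\<lambda>d. Ex (A (\<lambda>d'. d' - d - 1) (Suc d)))"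

text \<open>\<open>p\<^bold>[x\<^sub>0, \<dots>, x\<^sub>k\<^sub>-\<^sub>1\<^bold>]\<close> is the formula \<open>p\<close> with its free variables \<open>0, \<dots>, k - 1\<close> replaced
  by \<open>x\<^sub>0, \<dots>, x\<^sub>k\<^sub>-\<^sub>1\<close>; its free variable \<open>k + i\<close>, a parameter, becomes the \<open>i\<close>-th variable free
  in the whole expression.\<close>

definition happ :: "fm \<Rightarrow> hvar list \<Rightarrow> hfm" ("_\<^bold>[_\<^bold>]" [100, 0] 100) where
  "p\<^bold>[xs\<^bold>] = (\<lambda>d. fren (\<lambda>i. if i < length xs then (xs ! i) d else d + (i - length xs)) p)"

text \<open>All universal closures of the instances of an axiom scheme.\<close>

definition closures :: "hfm set \<Rightarrow> fm set" where
  "closures X = {q. fv q = {} \<and> (\<exists>A\<in>X. \<exists>n. q = (All ^^ n) (A 0))}"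

subsection \<open>CZF\<close>

definition hsub :: "hvar \<Rightarrow> hvar \<Rightarrow> hfm" (infix "\<^bold>\<subseteq>" 70) where
  "(x \<^bold>\<subseteq> y) = (\<^bold>\<forall>z. z \<^bold>\<in> x \<^bold>\<longrightarrow> z \<^bold>\<in> y)"

definition is_empty :: "hvar \<Rightarrow> hfm" where
  "is_empty z = (\<^bold>\<forall>x. x \<^bold>\<in> z \<^bold>\<longrightarrow> \<^bold>\<bottom>)"

definition is_pair :: "hvar \<Rightarrow> hvar \<Rightarrow> hvar \<Rightarrow> hfm" where
  "is_pair c a b = (\<^bold>\<forall>x. x \<^bold>\<in> c \<^bold>\<longleftrightarrow> x \<^bold>= a \<^bold>\<or> x \<^bold>= b)"

definition is_sing :: "hvar \<Rightarrow> hvar \<Rightarrow> hfm" where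
  "is_sing c a = (\<^bold>\<forall>x. x \<^bold>\<in> c \<^bold>\<longleftrightarrow> x \<^bold>= a)"

definition is_opair :: "hvar \<Rightarrow> hvar \<Rightarrow> hvar \<Rightarrow> hfm" where
  "is_opair p a b = (\<^bold>\<exists>q. \<^bold>\<exists>r. is_sing q a \<^bold>\<and> is_pair r a b \<^bold>\<and> is_pair p q r)"

definition is_union :: "hvar \<Rightarrow> hvar \<Rightarrow> hvar \<Rightarrow> hfm" where
  "is_union c a b = (\<^bold>\<forall>x. x \<^bold>\<in> c \<^bold>\<longleftrightarrow> x \<^bold>\<in> a \<^bold>\<or> x \<^bold>\<in> b)"

definition is_succ :: "hvar \<Rightarrow> hvar \<Rightarrow> hfm" where
  "is_succ y x = (\<^bold>\<forall>z. z \<^bold>\<in> y \<^bold>\<longleftrightarrow> z \<^bold>\<in> x \<^bold>\<or> z \<^bold>= x)"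

definition is_inductive :: "hvar \<Rightarrow> hfm" where
  "is_inductive a = ((\<^bold>\<exists>z. z \<^bold>\<in> a \<^bold>\<and> is_empty z) \<^bold>\<and>
     (\<^bold>\<forall>x. x \<^bold>\<in> a \<^bold>\<longrightarrow> (\<^bold>\<exists>y. y \<^bold>\<in> a \<^bold>\<and> is_succ y x)))"

definition is_omega :: "hvar \<Rightarrow> hfm" where
  "is_omega w = (is_inductive w \<^bold>\<and> (\<^bold>\<forall>b. is_inductive b \<^bold>\<longrightarrow> w \<^bold>\<subseteq> b))"

definition extensionality :: hfm where
  "extensionality = (\<^bold>\<forall>a. \<^bold>\<forall>b. (\<^bold>\<forall>x. x \<^bold>\<in> a \<^bold>\<longleftrightarrow> x \<^bold>\<in> b) \<^bold>\<longrightarrow> a \<^bold>= b)"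

definition pairing :: hfm where
  "pairing = (\<^bold>\<forall>a. \<^bold>\<forall>b. \<^bold>\<exists>c. is_pair c a b)"

definition union_set :: hfm where
  "union_set = (\<^bold>\<forall>a. \<^bold>\<exists>c. \<^bold>\<forall>x. x \<^bold>\<in> c \<^bold>\<longleftrightarrow> (\<^bold>\<exists>y. y \<^bold>\<in> a \<^bold>\<and> x \<^bold>\<in> y))"

definition strong_infinity :: hfm where
  "strong_infinity = (\<^bold>\<exists>w. is_omega w)"

definition set_induction :: "fm \<Rightarrow> hfm" where
  "set_induction p = ((\<^bold>\<forall>x. (\<^bold>\<forall>y. y \<^bold>\<in> x \<^bold>\<longrightarrow> p\<^bold>[[y]\<^bold>]) \<^bold>\<longrightarrow> p\<^bold>[[x]\<^bold>]) \<^bold>\<longrightarrow> (\<^bold>\<forall>x. p\<^bold>[[x]\<^bold>]))"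

definition separation :: "fm \<Rightarrow> hfm" where
  "separation p = (\<^bold>\<forall>a. \<^bold>\<exists>b. \<^bold>\<forall>x. x \<^bold>\<in> b \<^bold>\<longleftrightarrow> x \<^bold>\<in> a \<^bold>\<and> p\<^bold>[[x]\<^bold>])"

definition strong_collection :: "fm \<Rightarrow> hfm" where
  "strong_collection p = (\<^bold>\<forall>a. (\<^bold>\<forall>x. x \<^bold>\<in> a \<^bold>\<longrightarrow> (\<^bold>\<exists>y. p\<^bold>[[x, y]\<^bold>])) \<^bold>\<longrightarrow>
     (\<^bold>\<exists>b. (\<^bold>\<forall>x. x \<^bold>\<in> a \<^bold>\<longrightarrow> (\<^bold>\<exists>y. y \<^bold>\<in> b \<^bold>\<and> p\<^bold>[[x, y]\<^bold>])) \<^bold>\<and>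
           (\<^bold>\<forall>y. y \<^bold>\<in> b \<^bold>\<longrightarrow> (\<^bold>\<exists>x. x \<^bold>\<in> a \<^bold>\<and> p\<^bold>[[x, y]\<^bold>]))))"

definition subset_collection :: "fm \<Rightarrow> hfm" where
  "subset_collection p = (\<^bold>\<forall>a. \<^bold>\<forall>b. \<^bold>\<exists>c. \<^bold>\<forall>u.
     (\<^bold>\<forall>x. x \<^bold>\<in> a \<^bold>\<longrightarrow> (\<^bold>\<exists>y. y \<^bold>\<in> b \<^bold>\<and> p\<^bold>[[x, y, u]\<^bold>])) \<^bold>\<longrightarrow>
     (\<^bold>\<exists>e. e \<^bold>\<in> c \<^bold>\<and>
        (\<^bold>\<forall>x. x \<^bold>\<in> a \<^bold>\<longrightarrow> (\<^bold>\<exists>y. y \<^bold>\<in> e \<^bold>\<and> p\<^bold>[[x, y, u]\<^bold>])) \<^bold>\<and>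
        (\<^bold>\<forall>y. y \<^bold>\<in> e \<^bold>\<longrightarrow> (\<^bold>\<exists>x. x \<^bold>\<in> a \<^bold>\<and> p\<^bold>[[x, y, u]\<^bold>]))))"

definition CZF :: "fm set" where
  "CZF = closures ({extensionality, pairing, union_set, strong_infinity}
     \<union> {set_induction p | p. True} \<union> {separation p | p. bounded p}
     \<union> {strong_collection p | p. True} \<union> {subset_collection p | p. True})"

definition gup_czf :: "fm \<Rightarrow> hfm" where
  "gup_czf p = (\<^bold>\<forall>i. (\<^bold>\<forall>x. \<^bold>\<exists>y. y \<^bold>\<in> i \<^bold>\<and> p\<^bold>[[x, y]\<^bold>]) \<^bold>\<longrightarrow> (\<^bold>\<exists>y. y \<^bold>\<in> i \<^bold>\<and> (\<^bold>\<forall>x. p\<^bold>[[x, y]\<^bold>])))"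

definition GUP_CZF :: "fm set" where
  "GUP_CZF = closures {gup_czf p | p. True}"

definition CZF_star :: "fm set \<Rightarrow> bool" where
  "CZF_star T \<longleftrightarrow> CZF \<subseteq> T \<and> (\<forall>p\<in>T. fv p = {}) \<and> \<not> (T \<union> GUP_CZF \<turnstile> Bot)"

subsection \<open>Formal spaces in set theory\<close>

text \<open>The cover is a class relation, given by a formula \<open>c\<close> with \<open>a \<lhd> U\<close> standing for \<open>c\<^bold>[[a, U]\<^bold>]\<close>.
  A set term occurring as an argument of the cover is eliminated in the usual way: \<open>a \<lhd> t\<close> means
  that \<open>a \<lhd> z\<close> for some set \<open>z\<close> with \<open>z = t\<close>. All the terms concerned denote sets when
  the axioms of a formal space hold.\<close>

definition cov :: "fm \<Rightarrow> hvar \<Rightarrow> hvar \<Rightarrow> hfm" where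
  "cov c a U = c\<^bold>[[a, U]\<^bold>]"

definition covs :: "fm \<Rightarrow> hvar \<Rightarrow> hvar \<Rightarrow> hfm" where
  "covs c U V = (\<^bold>\<forall>u. u \<^bold>\<in> U \<^bold>\<longrightarrow> cov c u V)"

definition cov_sing :: "fm \<Rightarrow> hvar \<Rightarrow> hvar \<Rightarrow> hfm" where
  "cov_sing c d u = (\<^bold>\<exists>z. is_sing z u \<^bold>\<and> cov c d z)"

definition covs_empty :: "fm \<Rightarrow> hvar \<Rightarrow> hfm" where
  "covs_empty c U = (\<^bold>\<exists>z. is_empty z \<^bold>\<and> covs c U z)"

text \<open>\<open>D = U \<down> V\<close>\<close>

definition is_down :: "fm \<Rightarrow> hvar \<Rightarrow> hvar \<Rightarrow> hvar \<Rightarrow> hvar \<Rightarrow> hfm" where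
  "is_down c s D U V = (\<^bold>\<forall>d. d \<^bold>\<in> D \<^bold>\<longleftrightarrow> d \<^bold>\<in> s \<^bold>\<and>
     (\<^bold>\<exists>u. u \<^bold>\<in> U \<^bold>\<and> cov_sing c d u) \<^bold>\<and> (\<^bold>\<exists>v. v \<^bold>\<in> V \<^bold>\<and> cov_sing c d v))"

text \<open>\<open>V = U\<^sup>*\<close>\<close>

definition is_pseudocompl :: "fm \<Rightarrow> hvar \<Rightarrow> hvar \<Rightarrow> hvar \<Rightarrow> hfm" where
  "is_pseudocompl c s V U = (\<^bold>\<forall>a. a \<^bold>\<in> V \<^bold>\<longleftrightarrow> a \<^bold>\<in> s \<^bold>\<and>
     (\<^bold>\<exists>z. \<^bold>\<exists>D. is_sing z a \<^bold>\<and> is_down c s D z U \<^bold>\<and> covs_empty c D))"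

definition formal_space :: "fm \<Rightarrow> hvar \<Rightarrow> hfm" where
  "formal_space c s =
    ((\<^bold>\<forall>a. \<^bold>\<forall>U. a \<^bold>\<in> s \<^bold>\<and> U \<^bold>\<subseteq> s \<^bold>\<and> a \<^bold>\<in> U \<^bold>\<longrightarrow> cov c a U) \<^bold>\<and>
     (\<^bold>\<forall>a. \<^bold>\<forall>U. \<^bold>\<forall>V. a \<^bold>\<in> s \<^bold>\<and> U \<^bold>\<subseteq> s \<^bold>\<and> V \<^bold>\<subseteq> s \<^bold>\<and> cov c a U \<^bold>\<and> covs c U V \<^bold>\<longrightarrow> cov c a V) \<^bold>\<and>
     (\<^bold>\<forall>a. \<^bold>\<forall>U. \<^bold>\<forall>V. a \<^bold>\<in> s \<^bold>\<and> U \<^bold>\<subseteq> s \<^bold>\<and> V \<^bold>\<subseteq> s \<^bold>\<and> cov c a U \<^bold>\<and> cov c a V \<^bold>\<longrightarrow>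
        (\<^bold>\<exists>D. is_down c s D U V \<^bold>\<and> cov c a D)) \<^bold>\<and>
     (\<^bold>\<forall>U. U \<^bold>\<subseteq> s \<^bold>\<longrightarrow> (\<^bold>\<exists>C. \<^bold>\<forall>a. a \<^bold>\<in> C \<^bold>\<longleftrightarrow> a \<^bold>\<in> s \<^bold>\<and> cov c a U)))"

definition nontrivial :: "fm \<Rightarrow> hvar \<Rightarrow> hfm" where
  "nontrivial c s = (covs_empty c s \<^bold>\<longrightarrow> \<^bold>\<bottom>)"

definition de_morgan :: "fm \<Rightarrow> hvar \<Rightarrow> hfm" where
  "de_morgan c s = (\<^bold>\<forall>U. U \<^bold>\<subseteq> s \<^bold>\<longrightarrow> (\<^bold>\<exists>V. \<^bold>\<exists>W. \<^bold>\<exists>X.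
     is_pseudocompl c s V U \<^bold>\<and> is_pseudocompl c s W V \<^bold>\<and> is_union X W V \<^bold>\<and> covs c s X))"

definition maps_to :: "hvar \<Rightarrow> hvar \<Rightarrow> hvar \<Rightarrow> hfm" where
  "maps_to f i x = (\<^bold>\<exists>p. is_opair p i x \<^bold>\<and> p \<^bold>\<in> f)"

definition is_surjection :: "hvar \<Rightarrow> hvar \<Rightarrow> hvar \<Rightarrow> hfm" where
  "is_surjection f n u =
    ((\<^bold>\<forall>p. p \<^bold>\<in> f \<^bold>\<longrightarrow> (\<^bold>\<exists>i. \<^bold>\<exists>x. i \<^bold>\<in> n \<^bold>\<and> x \<^bold>\<in> u \<^bold>\<and> is_opair p i x)) \<^bold>\<and>
     (\<^bold>\<forall>i. i \<^bold>\<in> n \<^bold>\<longrightarrow> (\<^bold>\<exists>x. maps_to f i x \<^bold>\<and> (\<^bold>\<forall>y. maps_to f i y \<^bold>\<longrightarrow> y \<^bold>= x))) \<^bold>\<and>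
     (\<^bold>\<forall>x. x \<^bold>\<in> u \<^bold>\<longrightarrow> (\<^bold>\<exists>i. i \<^bold>\<in> n \<^bold>\<and> maps_to f i x)))"

text \<open>\<open>u = {x\<^sub>1, \<dots>, x\<^sub>n}\<close> for some natural number \<open>n\<close>\<close>

definition finitely_listed :: "hvar \<Rightarrow> hfm" where
  "finitely_listed u = (\<^bold>\<exists>w. \<^bold>\<exists>n. \<^bold>\<exists>f. is_omega w \<^bold>\<and> n \<^bold>\<in> w \<^bold>\<and> is_surjection f n u)"

definition compact_space :: "fm \<Rightarrow> hvar \<Rightarrow> hfm" where
  "compact_space c s = (\<^bold>\<forall>U. U \<^bold>\<subseteq> s \<^bold>\<and> covs c s U \<^bold>\<longrightarrow>
     (\<^bold>\<exists>u. u \<^bold>\<subseteq> U \<^bold>\<and> finitely_listed u \<^bold>\<and> covs c s u))"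

text \<open>A space given by a definition: the set \<open>S\<close> is defined by the formula \<open>p\<close>, with free
  variable \<open>0\<close>, and its cover by the formula \<open>c\<close>, with free variables \<open>0\<close> and \<open>1\<close>.\<close>

definition defines_set :: "fm \<Rightarrow> fm" where
  "defines_set p = (\<^bold>\<exists>s. p\<^bold>[[s]\<^bold>] \<^bold>\<and> (\<^bold>\<forall>t. p\<^bold>[[t]\<^bold>] \<^bold>\<longrightarrow> t \<^bold>= s)) 0"

definition holds_of :: "fm \<Rightarrow> (hvar \<Rightarrow> hfm) \<Rightarrow> fm" where
  "holds_of p A = (\<^bold>\<forall>s. p\<^bold>[[s]\<^bold>] \<^bold>\<longrightarrow> A s) 0"

definition nontrivial_de_morgan_space_in_czf :: "fm set \<Rightarrow> fm \<Rightarrow> fm \<Rightarrow> bool" where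
  "nontrivial_de_morgan_space_in_czf T p c \<longleftrightarrow>
     fv p \<subseteq> {0} \<and> fv c \<subseteq> {0, 1} \<and> T \<turnstile> defines_set p \<and>
     T \<turnstile> holds_of p (formal_space c) \<and>
     T \<turnstile> holds_of p (nontrivial c) \<and>
     T \<turnstile> holds_of p (de_morgan c)"

definition provably_compact_in_czf :: "fm set \<Rightarrow> fm \<Rightarrow> fm \<Rightarrow> bool" where
  "provably_compact_in_czf T p c \<longleftrightarrow> T \<turnstile> holds_of p (compact_space c)"


section \<open>Constructive type theory\<close>

text \<open>Martin-Loef's type theory is presented in Martin-Loef's logical framework. Types and objects of the
  framework are raw expressions in de Bruijn notation over constants from \<open>'c\<close>; \<open>Fun A B\<close> is the
  type \<open>(x : A) B\<close>.\<close>

datatype 'c exp = Var nat | Cst 'c | App "'c exp" "'c exp" | Lam "'c exp"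
  | SET | El "'c exp" | Fun "'c exp" "'c exp"

fun eren :: "(nat \<Rightarrow> nat) \<Rightarrow> 'c exp \<Rightarrow> 'c exp" where
  "eren f (Var i) = Var (f i)"
| "eren f (Cst c) = Cst c"
| "eren f (App a b) = App (eren f a) (eren f b)"
| "eren f (Lam b) = Lam (eren (up f) b)"
| "eren f SET = SET"
| "eren f (El a) = El (eren f a)"
| "eren f (Fun A B) = Fun (eren f A) (eren (up f) B)"

fun eup :: "(nat \<Rightarrow> 'c exp) \<Rightarrow> nat \<Rightarrow> 'c exp" where
  "eup s 0 = Var 0"
| "eup s (Suc i) = eren Suc (s i)"

fun esub :: "(nat \<Rightarrow> 'c exp) \<Rightarrow> 'c exp \<Rightarrow> 'c exp" where
  "esub s (Var i) = s i"
| "esub s (Cst c) = Cst c"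
| "esub s (App a b) = App (esub s a) (esub s b)"
| "esub s (Lam b) = Lam (esub (eup s) b)"
| "esub s SET = SET"
| "esub s (El a) = El (esub s a)"
| "esub s (Fun A B) = Fun (esub s A) (esub (eup s) B)"

fun single :: "'c exp \<Rightarrow> nat \<Rightarrow> 'c exp" where
  "single a 0 = a"
| "single a (Suc i) = Var i"

text \<open>Judgements are pairs of a context (the head being the type of variable \<open>0\<close>) and one of the
  following forms.\<close>

datatype 'e jform = IsCtx | IsType 'e | EqType 'e 'e | Elem 'e 'e | EqElem 'e 'e 'e

type_synonym 'c jdg = "'c exp list \<times> 'c exp jform"

text \<open>A theory in the framework is given by its further rules, each consisting of premises and a
  conclusion.\<close>

type_synonym 'c rule = "'c jdg list \<times> 'c jdg"

inductive der :: "'c rule set \<Rightarrow> 'c exp list \<Rightarrow> 'c exp jform \<Rightarrow> bool" for R where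
  rule: "(Ps, (G, J)) \<in> R \<Longrightarrow> (\<And>D K. (D, K) \<in> set Ps \<Longrightarrow> der R D K) \<Longrightarrow> der R G J"
| ctx_nil: "der R [] IsCtx"
| ctx_cons: "der R G (IsType A) \<Longrightarrow> der R (A # G) IsCtx"
| subst: "der R G J \<Longrightarrow> der R D IsCtx \<Longrightarrow>
    (\<And>i. i < length G \<Longrightarrow> der R D (Elem (s i) (esub s (eren (\<lambda>j. j + Suc i) (G ! i))))) \<Longrightarrow>
    der R D (map_jform (esub s) J)"
| var: "der R G IsCtx \<Longrightarrow> i < length G \<Longrightarrow> der R G (Elem (Var i) (eren (\<lambda>j. j + Suc i) (G ! i)))"
| type_refl: "der R G (IsType A) \<Longrightarrow> der R G (EqType A A)"
| type_sym: "der R G (EqType A B) \<Longrightarrow> der R G (EqType B A)"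
| type_trans: "der R G (EqType A B) \<Longrightarrow> der R G (EqType B C) \<Longrightarrow> der R G (EqType A C)"
| elem_refl: "der R G (Elem a A) \<Longrightarrow> der R G (EqElem a a A)"
| elem_sym: "der R G (EqElem a b A) \<Longrightarrow> der R G (EqElem b a A)"
| elem_trans: "der R G (EqElem a b A) \<Longrightarrow> der R G (EqElem b c A) \<Longrightarrow> der R G (EqElem a c A)"
| elem_conv: "der R G (Elem a A) \<Longrightarrow> der R G (EqType A B) \<Longrightarrow> der R G (Elem a B)"
| eq_conv: "der R G (EqElem a b A) \<Longrightarrow> der R G (EqType A B) \<Longrightarrow> der R G (EqElem a b B)"
| type_cong: "der R (A # G) (IsType B) \<Longrightarrow> der R G (EqElem a b A) \<Longrightarrow>
    der R G (EqType (esub (single a) B) (esub (single b) B))"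
| elem_cong: "der R (A # G) (Elem c B) \<Longrightarrow> der R G (EqElem a b A) \<Longrightarrow>
    der R G (EqElem (esub (single a) c) (esub (single b) c) (esub (single a) B))"
| SET: "der R G IsCtx \<Longrightarrow> der R G (IsType SET)"
| El: "der R G (Elem A SET) \<Longrightarrow> der R G (IsType (El A))"
| El_eq: "der R G (EqElem A B SET) \<Longrightarrow> der R G (EqType (El A) (El B))"
| Fun: "der R G (IsType A) \<Longrightarrow> der R (A # G) (IsType B) \<Longrightarrow> der R G (IsType (Fun A B))"
| Fun_eq: "der R G (EqType A A') \<Longrightarrow> der R (A # G) (EqType B B') \<Longrightarrow>
    der R G (EqType (Fun A B) (Fun A' B'))"
| abs: "der R (A # G) (Elem b B) \<Longrightarrow> der R G (Elem (Lam b) (Fun A B))"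
| app: "der R G (Elem f (Fun A B)) \<Longrightarrow> der R G (Elem a A) \<Longrightarrow>
    der R G (Elem (App f a) (esub (single a) B))"
| app_eq: "der R G (EqElem f g (Fun A B)) \<Longrightarrow> der R G (EqElem a b A) \<Longrightarrow>
    der R G (EqElem (App f a) (App g b) (esub (single a) B))"
| xi: "der R (A # G) (EqElem b b' B) \<Longrightarrow> der R G (EqElem (Lam b) (Lam b') (Fun A B))"
| beta: "der R (A # G) (Elem b B) \<Longrightarrow> der R G (Elem a A) \<Longrightarrow>
    der R G (EqElem (App (Lam b) a) (esub (single a) b) (esub (single a) B))"
| eta: "der R G (Elem f (Fun A B)) \<Longrightarrow>
    der R G (EqElem (Lam (App (eren Suc f) (Var 0))) f (Fun A B))"

subsection \<open>Named variables\<close>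

text \<open>As for formulas, expressions are written as functions of the number of binders above them.\<close>

type_synonym 'c hexp = "nat \<Rightarrow> 'c exp"

definition cst :: "'c \<Rightarrow> 'c hexp" where "cst c = (\<lambda>d. Cst c)"
definition ap :: "'c hexp \<Rightarrow> 'c hexp \<Rightarrow> 'c hexp" (infixl "\<cdot>" 80) where
  "(f \<cdot> a) = (\<lambda>d. App (f d) (a d))"
definition lm :: "('c hexp \<Rightarrow> 'c hexp) \<Rightarrow> 'c hexp" (binder "\<^bold>\<lambda>" 40) where
  "(\<^bold>\<lambda>x. b x) = (\<lambda>d. Lam (b (\<lambda>d'. Var (d' - d - 1)) (Suc d)))"
definition SetT :: "'c hexp" where "SetT = (\<lambda>d. SET)"
definition ElT :: "'c hexp \<Rightarrow> 'c hexp" where "ElT a = (\<lambda>d. El (a d))"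
definition FunT :: "'c hexp \<Rightarrow> ('c hexp \<Rightarrow> 'c hexp) \<Rightarrow> 'c hexp" where
  "FunT A B = (\<lambda>d. Fun (A d) (B (\<lambda>d'. Var (d' - d - 1)) (Suc d)))"
abbreviation ArrT :: "'c hexp \<Rightarrow> 'c hexp \<Rightarrow> 'c hexp" (infixr "\<^bold>\<Rightarrow>" 60) where
  "A \<^bold>\<Rightarrow> B \<equiv> FunT A (\<lambda>_. B)"

text \<open>An expression in the empty context, used under binders.\<close>

definition emb :: "'c exp \<Rightarrow> 'c hexp" where
  "emb e = (\<lambda>d. eren (\<lambda>i. i + d) e)"

subsection \<open>CTT\<close>

text \<open>The constants of CTT with one universe \<open>cU\<close> (with decoding \<open>cT\<close>), those witnessing GUP, and
  those that extensions may add. Identity types are intensional; equality reflection and further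
  universes are instances of extensions.\<close>

datatype 'x cn = cN0 | cCase0 | cN1 | cStar | cCase1 | cN2 | cTrue | cFalse | cCase2
  | cNat | cZero | cSucc | cNatrec
  | cList | cNil | cCons | cListrec
  | cPi | cLambda | cApply | cSigma | cPair | cSplit | cPlus | cInl | cInr | cWhen
  | cId | cRefl | cJ | cW | cSup | cWrec
  | cU | cT | uN0 | uN1 | uN2 | uNat | uList | uPi | uSigma | uPlus | uId | uW
  | cGup | cGupPrf | Ext 'x

abbreviation N0 :: "'x cn hexp" where "N0 \<equiv> cst cN0"
abbreviation N1 :: "'x cn hexp" where "N1 \<equiv> cst cN1"
abbreviation N2 :: "'x cn hexp" where "N2 \<equiv> cst cN2"
abbreviation NatS :: "'x cn hexp" where "NatS \<equiv> cst cNat"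
abbreviation ListS :: "'x cn hexp \<Rightarrow> 'x cn hexp" where "ListS A \<equiv> cst cList \<cdot> A"
abbreviation PlusS :: "'x cn hexp \<Rightarrow> 'x cn hexp \<Rightarrow> 'x cn hexp" where
  "PlusS A B \<equiv> cst cPlus \<cdot> A \<cdot> B"
abbreviation PiS :: "'x cn hexp \<Rightarrow> 'x cn hexp \<Rightarrow> 'x cn hexp" where "PiS A B \<equiv> cst cPi \<cdot> A \<cdot> B"
abbreviation SigmaS :: "'x cn hexp \<Rightarrow> 'x cn hexp \<Rightarrow> 'x cn hexp" where
  "SigmaS A B \<equiv> cst cSigma \<cdot> A \<cdot> B"
abbreviation WS :: "'x cn hexp \<Rightarrow> 'x cn hexp \<Rightarrow> 'x cn hexp" where "WS A B \<equiv> cst cW \<cdot> A \<cdot> B"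
abbreviation IdS :: "'x cn hexp \<Rightarrow> 'x cn hexp \<Rightarrow> 'x cn hexp \<Rightarrow> 'x cn hexp" where
  "IdS A a b \<equiv> cst cId \<cdot> A \<cdot> a \<cdot> b"
abbreviation US :: "'x cn hexp" where "US \<equiv> cst cU"
abbreviation TS :: "'x cn hexp \<Rightarrow> 'x cn hexp" where "TS a \<equiv> cst cT \<cdot> a"

definition decl :: "'c \<Rightarrow> 'c hexp \<Rightarrow> 'c rule" where
  "decl c A = ([], [], Elem (Cst c) (A 0))"

text \<open>Computation rules are closed equations between abstractions, whence their usual form follows
  by application.\<close>

definition law :: "'c hexp \<Rightarrow> 'c hexp \<Rightarrow> 'c hexp \<Rightarrow> 'c rule" where
  "law A l r = ([], [], EqElem (l 0) (r 0) (A 0))"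

definition CTT_decls :: "'x cn rule set" where
  "CTT_decls = {
    decl cN0 SetT,
    decl cCase0 (FunT (ElT N0 \<^bold>\<Rightarrow> SetT) (\<lambda>C. FunT (ElT N0) (\<lambda>a. ElT (C \<cdot> a)))),

    decl cN1 SetT,
    decl cStar (ElT N1),
    decl cCase1 (FunT (ElT N1 \<^bold>\<Rightarrow> SetT) (\<lambda>C. ElT (C \<cdot> cst cStar) \<^bold>\<Rightarrow>
      FunT (ElT N1) (\<lambda>a. ElT (C \<cdot> a)))),

    decl cN2 SetT,
    decl cTrue (ElT N2),
    decl cFalse (ElT N2),
    decl cCase2 (FunT (ElT N2 \<^bold>\<Rightarrow> SetT) (\<lambda>C. ElT (C \<cdot> cst cTrue) \<^bold>\<Rightarrow> ElT (C \<cdot> cst cFalse) \<^bold>\<Rightarrow>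
      FunT (ElT N2) (\<lambda>a. ElT (C \<cdot> a)))),

    decl cNat SetT,
    decl cZero (ElT NatS),
    decl cSucc (ElT NatS \<^bold>\<Rightarrow> ElT NatS),
    decl cNatrec (FunT (ElT NatS \<^bold>\<Rightarrow> SetT) (\<lambda>C. ElT (C \<cdot> cst cZero) \<^bold>\<Rightarrow>
      FunT (ElT NatS) (\<lambda>x. ElT (C \<cdot> x) \<^bold>\<Rightarrow> ElT (C \<cdot> (cst cSucc \<cdot> x))) \<^bold>\<Rightarrow>
      FunT (ElT NatS) (\<lambda>a. ElT (C \<cdot> a)))),

    decl cList (SetT \<^bold>\<Rightarrow> SetT),
    decl cNil (FunT SetT (\<lambda>A. ElT (ListS A))),
    decl cCons (FunT SetT (\<lambda>A. ElT A \<^bold>\<Rightarrow> ElT (ListS A) \<^bold>\<Rightarrow> ElT (ListS A))),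
    decl cListrec (FunT SetT (\<lambda>A. FunT (ElT (ListS A) \<^bold>\<Rightarrow> SetT) (\<lambda>C.
      ElT (C \<cdot> (cst cNil \<cdot> A)) \<^bold>\<Rightarrow>
      FunT (ElT A) (\<lambda>x. FunT (ElT (ListS A)) (\<lambda>y. ElT (C \<cdot> y) \<^bold>\<Rightarrow> ElT (C \<cdot> (cst cCons \<cdot> A \<cdot> x \<cdot> y)))) \<^bold>\<Rightarrow>
      FunT (ElT (ListS A)) (\<lambda>l. ElT (C \<cdot> l))))),

    decl cPi (FunT SetT (\<lambda>A. (ElT A \<^bold>\<Rightarrow> SetT) \<^bold>\<Rightarrow> SetT)),
    decl cLambda (FunT SetT (\<lambda>A. FunT (ElT A \<^bold>\<Rightarrow> SetT) (\<lambda>B.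
      FunT (ElT A) (\<lambda>x. ElT (B \<cdot> x)) \<^bold>\<Rightarrow> ElT (PiS A B)))),
    decl cApply (FunT SetT (\<lambda>A. FunT (ElT A \<^bold>\<Rightarrow> SetT) (\<lambda>B.
      ElT (PiS A B) \<^bold>\<Rightarrow> FunT (ElT A) (\<lambda>x. ElT (B \<cdot> x))))),

    decl cSigma (FunT SetT (\<lambda>A. (ElT A \<^bold>\<Rightarrow> SetT) \<^bold>\<Rightarrow> SetT)),
    decl cPair (FunT SetT (\<lambda>A. FunT (ElT A \<^bold>\<Rightarrow> SetT) (\<lambda>B.
      FunT (ElT A) (\<lambda>x. ElT (B \<cdot> x) \<^bold>\<Rightarrow> ElT (SigmaS A B))))),
    decl cSplit (FunT SetT (\<lambda>A. FunT (ElT A \<^bold>\<Rightarrow> SetT) (\<lambda>B. FunT (ElT (SigmaS A B) \<^bold>\<Rightarrow> SetT) (\<lambda>C.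
      FunT (ElT A) (\<lambda>x. FunT (ElT (B \<cdot> x)) (\<lambda>y. ElT (C \<cdot> (cst cPair \<cdot> A \<cdot> B \<cdot> x \<cdot> y)))) \<^bold>\<Rightarrow>
      FunT (ElT (SigmaS A B)) (\<lambda>p. ElT (C \<cdot> p)))))),

    decl cPlus (SetT \<^bold>\<Rightarrow> SetT \<^bold>\<Rightarrow> SetT),
    decl cInl (FunT SetT (\<lambda>A. FunT SetT (\<lambda>B. ElT A \<^bold>\<Rightarrow> ElT (PlusS A B)))),
    decl cInr (FunT SetT (\<lambda>A. FunT SetT (\<lambda>B. ElT B \<^bold>\<Rightarrow> ElT (PlusS A B)))),
    decl cWhen (FunT SetT (\<lambda>A. FunT SetT (\<lambda>B. FunT (ElT (PlusS A B) \<^bold>\<Rightarrow> SetT) (\<lambda>C.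
      FunT (ElT A) (\<lambda>x. ElT (C \<cdot> (cst cInl \<cdot> A \<cdot> B \<cdot> x))) \<^bold>\<Rightarrow>
      FunT (ElT B) (\<lambda>y. ElT (C \<cdot> (cst cInr \<cdot> A \<cdot> B \<cdot> y))) \<^bold>\<Rightarrow>
      FunT (ElT (PlusS A B)) (\<lambda>p. ElT (C \<cdot> p)))))),

    decl cId (FunT SetT (\<lambda>A. ElT A \<^bold>\<Rightarrow> ElT A \<^bold>\<Rightarrow> SetT)),
    decl cRefl (FunT SetT (\<lambda>A. FunT (ElT A) (\<lambda>a. ElT (IdS A a a)))),
    decl cJ (FunT SetT (\<lambda>A.
      FunT (FunT (ElT A) (\<lambda>x. FunT (ElT A) (\<lambda>y. ElT (IdS A x y) \<^bold>\<Rightarrow> SetT))) (\<lambda>C.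
      FunT (ElT A) (\<lambda>x. ElT (C \<cdot> x \<cdot> x \<cdot> (cst cRefl \<cdot> A \<cdot> x))) \<^bold>\<Rightarrow>
      FunT (ElT A) (\<lambda>a. FunT (ElT A) (\<lambda>b. FunT (ElT (IdS A a b)) (\<lambda>e. ElT (C \<cdot> a \<cdot> b \<cdot> e))))))),

    decl cW (FunT SetT (\<lambda>A. (ElT A \<^bold>\<Rightarrow> SetT) \<^bold>\<Rightarrow> SetT)),
    decl cSup (FunT SetT (\<lambda>A. FunT (ElT A \<^bold>\<Rightarrow> SetT) (\<lambda>B.
      FunT (ElT A) (\<lambda>a. (ElT (B \<cdot> a) \<^bold>\<Rightarrow> ElT (WS A B)) \<^bold>\<Rightarrow> ElT (WS A B))))),
    decl cWrec (FunT SetT (\<lambda>A. FunT (ElT A \<^bold>\<Rightarrow> SetT) (\<lambda>B. FunT (ElT (WS A B) \<^bold>\<Rightarrow> SetT) (\<lambda>C.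
      FunT (ElT A) (\<lambda>a. FunT (ElT (B \<cdot> a) \<^bold>\<Rightarrow> ElT (WS A B)) (\<lambda>f.
        FunT (ElT (B \<cdot> a)) (\<lambda>x. ElT (C \<cdot> (f \<cdot> x))) \<^bold>\<Rightarrow> ElT (C \<cdot> (cst cSup \<cdot> A \<cdot> B \<cdot> a \<cdot> f)))) \<^bold>\<Rightarrow>
      FunT (ElT (WS A B)) (\<lambda>w. ElT (C \<cdot> w)))))),

    decl cU SetT,
    decl cT (ElT US \<^bold>\<Rightarrow> SetT),
    decl uN0 (ElT US),
    decl uN1 (ElT US),
    decl uN2 (ElT US),
    decl uNat (ElT US),
    decl uList (ElT US \<^bold>\<Rightarrow> ElT US),
    decl uPi (FunT (ElT US) (\<lambda>a. (ElT (TS a) \<^bold>\<Rightarrow> ElT US) \<^bold>\<Rightarrow> ElT US)),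
    decl uSigma (FunT (ElT US) (\<lambda>a. (ElT (TS a) \<^bold>\<Rightarrow> ElT US) \<^bold>\<Rightarrow> ElT US)),
    decl uPlus (ElT US \<^bold>\<Rightarrow> ElT US \<^bold>\<Rightarrow> ElT US),
    decl uId (FunT (ElT US) (\<lambda>a. ElT (TS a) \<^bold>\<Rightarrow> ElT (TS a) \<^bold>\<Rightarrow> ElT US)),
    decl uW (FunT (ElT US) (\<lambda>a. (ElT (TS a) \<^bold>\<Rightarrow> ElT US) \<^bold>\<Rightarrow> ElT US)) }"

definition CTT_laws :: "'x cn rule set" where
  "CTT_laws = {
    law (FunT (ElT N1 \<^bold>\<Rightarrow> SetT) (\<lambda>C. ElT (C \<cdot> cst cStar) \<^bold>\<Rightarrow> ElT (C \<cdot> cst cStar)))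
      (\<^bold>\<lambda>C. \<^bold>\<lambda>c. cst cCase1 \<cdot> C \<cdot> c \<cdot> cst cStar) (\<^bold>\<lambda>C. \<^bold>\<lambda>c. c),

    law (FunT (ElT N2 \<^bold>\<Rightarrow> SetT) (\<lambda>C. ElT (C \<cdot> cst cTrue) \<^bold>\<Rightarrow> ElT (C \<cdot> cst cFalse) \<^bold>\<Rightarrow> ElT (C \<cdot> cst cTrue)))
      (\<^bold>\<lambda>C. \<^bold>\<lambda>c. \<^bold>\<lambda>e. cst cCase2 \<cdot> C \<cdot> c \<cdot> e \<cdot> cst cTrue) (\<^bold>\<lambda>C. \<^bold>\<lambda>c. \<^bold>\<lambda>e. c),
    law (FunT (ElT N2 \<^bold>\<Rightarrow> SetT) (\<lambda>C. ElT (C \<cdot> cst cTrue) \<^bold>\<Rightarrow> ElT (C \<cdot> cst cFalse) \<^bold>\<Rightarrow> ElT (C \<cdot> cst cFalse)))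
      (\<^bold>\<lambda>C. \<^bold>\<lambda>c. \<^bold>\<lambda>e. cst cCase2 \<cdot> C \<cdot> c \<cdot> e \<cdot> cst cFalse) (\<^bold>\<lambda>C. \<^bold>\<lambda>c. \<^bold>\<lambda>e. e),

    law (FunT (ElT NatS \<^bold>\<Rightarrow> SetT) (\<lambda>C. ElT (C \<cdot> cst cZero) \<^bold>\<Rightarrow>
        FunT (ElT NatS) (\<lambda>x. ElT (C \<cdot> x) \<^bold>\<Rightarrow> ElT (C \<cdot> (cst cSucc \<cdot> x))) \<^bold>\<Rightarrow> ElT (C \<cdot> cst cZero)))
      (\<^bold>\<lambda>C. \<^bold>\<lambda>c. \<^bold>\<lambda>e. cst cNatrec \<cdot> C \<cdot> c \<cdot> e \<cdot> cst cZero) (\<^bold>\<lambda>C. \<^bold>\<lambda>c. \<^bold>\<lambda>e. c),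
    law (FunT (ElT NatS \<^bold>\<Rightarrow> SetT) (\<lambda>C. ElT (C \<cdot> cst cZero) \<^bold>\<Rightarrow>
        FunT (ElT NatS) (\<lambda>x. ElT (C \<cdot> x) \<^bold>\<Rightarrow> ElT (C \<cdot> (cst cSucc \<cdot> x))) \<^bold>\<Rightarrow>
        FunT (ElT NatS) (\<lambda>a. ElT (C \<cdot> (cst cSucc \<cdot> a)))))
      (\<^bold>\<lambda>C. \<^bold>\<lambda>c. \<^bold>\<lambda>e. \<^bold>\<lambda>a. cst cNatrec \<cdot> C \<cdot> c \<cdot> e \<cdot> (cst cSucc \<cdot> a))
      (\<^bold>\<lambda>C. \<^bold>\<lambda>c. \<^bold>\<lambda>e. \<^bold>\<lambda>a. e \<cdot> a \<cdot> (cst cNatrec \<cdot> C \<cdot> c \<cdot> e \<cdot> a)),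

    law (FunT SetT (\<lambda>A. FunT (ElT (ListS A) \<^bold>\<Rightarrow> SetT) (\<lambda>C. ElT (C \<cdot> (cst cNil \<cdot> A)) \<^bold>\<Rightarrow>
        FunT (ElT A) (\<lambda>x. FunT (ElT (ListS A)) (\<lambda>y. ElT (C \<cdot> y) \<^bold>\<Rightarrow> ElT (C \<cdot> (cst cCons \<cdot> A \<cdot> x \<cdot> y)))) \<^bold>\<Rightarrow>
        ElT (C \<cdot> (cst cNil \<cdot> A)))))
      (\<^bold>\<lambda>A. \<^bold>\<lambda>C. \<^bold>\<lambda>c. \<^bold>\<lambda>e. cst cListrec \<cdot> A \<cdot> C \<cdot> c \<cdot> e \<cdot> (cst cNil \<cdot> A)) (\<^bold>\<lambda>A. \<^bold>\<lambda>C. \<^bold>\<lambda>c. \<^bold>\<lambda>e. c),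
    law (FunT SetT (\<lambda>A. FunT (ElT (ListS A) \<^bold>\<Rightarrow> SetT) (\<lambda>C. ElT (C \<cdot> (cst cNil \<cdot> A)) \<^bold>\<Rightarrow>
        FunT (ElT A) (\<lambda>x. FunT (ElT (ListS A)) (\<lambda>y. ElT (C \<cdot> y) \<^bold>\<Rightarrow> ElT (C \<cdot> (cst cCons \<cdot> A \<cdot> x \<cdot> y)))) \<^bold>\<Rightarrow>
        FunT (ElT A) (\<lambda>a. FunT (ElT (ListS A)) (\<lambda>l. ElT (C \<cdot> (cst cCons \<cdot> A \<cdot> a \<cdot> l)))))))
      (\<^bold>\<lambda>A. \<^bold>\<lambda>C. \<^bold>\<lambda>c. \<^bold>\<lambda>e. \<^bold>\<lambda>a. \<^bold>\<lambda>l. cst cListrec \<cdot> A \<cdot> C \<cdot> c \<cdot> e \<cdot> (cst cCons \<cdot> A \<cdot> a \<cdot> l))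
      (\<^bold>\<lambda>A. \<^bold>\<lambda>C. \<^bold>\<lambda>c. \<^bold>\<lambda>e. \<^bold>\<lambda>a. \<^bold>\<lambda>l. e \<cdot> a \<cdot> l \<cdot> (cst cListrec \<cdot> A \<cdot> C \<cdot> c \<cdot> e \<cdot> l)),

    law (FunT SetT (\<lambda>A. FunT (ElT A \<^bold>\<Rightarrow> SetT) (\<lambda>B. FunT (ElT A) (\<lambda>x. ElT (B \<cdot> x)) \<^bold>\<Rightarrow>
        FunT (ElT A) (\<lambda>a. ElT (B \<cdot> a)))))
      (\<^bold>\<lambda>A. \<^bold>\<lambda>B. \<^bold>\<lambda>b. \<^bold>\<lambda>a. cst cApply \<cdot> A \<cdot> B \<cdot> (cst cLambda \<cdot> A \<cdot> B \<cdot> b) \<cdot> a)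
      (\<^bold>\<lambda>A. \<^bold>\<lambda>B. \<^bold>\<lambda>b. \<^bold>\<lambda>a. b \<cdot> a),

    law (FunT SetT (\<lambda>A. FunT (ElT A \<^bold>\<Rightarrow> SetT) (\<lambda>B. FunT (ElT (SigmaS A B) \<^bold>\<Rightarrow> SetT) (\<lambda>C.
        FunT (ElT A) (\<lambda>x. FunT (ElT (B \<cdot> x)) (\<lambda>y. ElT (C \<cdot> (cst cPair \<cdot> A \<cdot> B \<cdot> x \<cdot> y)))) \<^bold>\<Rightarrow>
        FunT (ElT A) (\<lambda>a. FunT (ElT (B \<cdot> a)) (\<lambda>b. ElT (C \<cdot> (cst cPair \<cdot> A \<cdot> B \<cdot> a \<cdot> b))))))))
      (\<^bold>\<lambda>A. \<^bold>\<lambda>B. \<^bold>\<lambda>C. \<^bold>\<lambda>e. \<^bold>\<lambda>a. \<^bold>\<lambda>b. cst cSplit \<cdot> A \<cdot> B \<cdot> C \<cdot> e \<cdot> (cst cPair \<cdot> A \<cdot> B \<cdot> a \<cdot> b))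
      (\<^bold>\<lambda>A. \<^bold>\<lambda>B. \<^bold>\<lambda>C. \<^bold>\<lambda>e. \<^bold>\<lambda>a. \<^bold>\<lambda>b. e \<cdot> a \<cdot> b),

    law (FunT SetT (\<lambda>A. FunT SetT (\<lambda>B. FunT (ElT (PlusS A B) \<^bold>\<Rightarrow> SetT) (\<lambda>C.
        FunT (ElT A) (\<lambda>x. ElT (C \<cdot> (cst cInl \<cdot> A \<cdot> B \<cdot> x))) \<^bold>\<Rightarrow>
        FunT (ElT B) (\<lambda>y. ElT (C \<cdot> (cst cInr \<cdot> A \<cdot> B \<cdot> y))) \<^bold>\<Rightarrow>
        FunT (ElT A) (\<lambda>a. ElT (C \<cdot> (cst cInl \<cdot> A \<cdot> B \<cdot> a)))))))
      (\<^bold>\<lambda>A. \<^bold>\<lambda>B. \<^bold>\<lambda>C. \<^bold>\<lambda>e. \<^bold>\<lambda>f. \<^bold>\<lambda>a. cst cWhen \<cdot> A \<cdot> B \<cdot> C \<cdot> e \<cdot> f \<cdot> (cst cInl \<cdot> A \<cdot> B \<cdot> a))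
      (\<^bold>\<lambda>A. \<^bold>\<lambda>B. \<^bold>\<lambda>C. \<^bold>\<lambda>e. \<^bold>\<lambda>f. \<^bold>\<lambda>a. e \<cdot> a),
    law (FunT SetT (\<lambda>A. FunT SetT (\<lambda>B. FunT (ElT (PlusS A B) \<^bold>\<Rightarrow> SetT) (\<lambda>C.
        FunT (ElT A) (\<lambda>x. ElT (C \<cdot> (cst cInl \<cdot> A \<cdot> B \<cdot> x))) \<^bold>\<Rightarrow>
        FunT (ElT B) (\<lambda>y. ElT (C \<cdot> (cst cInr \<cdot> A \<cdot> B \<cdot> y))) \<^bold>\<Rightarrow>
        FunT (ElT B) (\<lambda>b. ElT (C \<cdot> (cst cInr \<cdot> A \<cdot> B \<cdot> b)))))))
      (\<^bold>\<lambda>A. \<^bold>\<lambda>B. \<^bold>\<lambda>C. \<^bold>\<lambda>e. \<^bold>\<lambda>f. \<^bold>\<lambda>b. cst cWhen \<cdot> A \<cdot> B \<cdot> C \<cdot> e \<cdot> f \<cdot> (cst cInr \<cdot> A \<cdot> B \<cdot> b))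
      (\<^bold>\<lambda>A. \<^bold>\<lambda>B. \<^bold>\<lambda>C. \<^bold>\<lambda>e. \<^bold>\<lambda>f. \<^bold>\<lambda>b. f \<cdot> b),

    law (FunT SetT (\<lambda>A.
        FunT (FunT (ElT A) (\<lambda>x. FunT (ElT A) (\<lambda>y. ElT (IdS A x y) \<^bold>\<Rightarrow> SetT))) (\<lambda>C.
        FunT (ElT A) (\<lambda>x. ElT (C \<cdot> x \<cdot> x \<cdot> (cst cRefl \<cdot> A \<cdot> x))) \<^bold>\<Rightarrow>
        FunT (ElT A) (\<lambda>a. ElT (C \<cdot> a \<cdot> a \<cdot> (cst cRefl \<cdot> A \<cdot> a))))))
      (\<^bold>\<lambda>A. \<^bold>\<lambda>C. \<^bold>\<lambda>e. \<^bold>\<lambda>a. cst cJ \<cdot> A \<cdot> C \<cdot> e \<cdot> a \<cdot> a \<cdot> (cst cRefl \<cdot> A \<cdot> a))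
      (\<^bold>\<lambda>A. \<^bold>\<lambda>C. \<^bold>\<lambda>e. \<^bold>\<lambda>a. e \<cdot> a),

    law (FunT SetT (\<lambda>A. FunT (ElT A \<^bold>\<Rightarrow> SetT) (\<lambda>B. FunT (ElT (WS A B) \<^bold>\<Rightarrow> SetT) (\<lambda>C.
        FunT (ElT A) (\<lambda>a. FunT (ElT (B \<cdot> a) \<^bold>\<Rightarrow> ElT (WS A B)) (\<lambda>f.
          FunT (ElT (B \<cdot> a)) (\<lambda>x. ElT (C \<cdot> (f \<cdot> x))) \<^bold>\<Rightarrow> ElT (C \<cdot> (cst cSup \<cdot> A \<cdot> B \<cdot> a \<cdot> f)))) \<^bold>\<Rightarrow>
        FunT (ElT A) (\<lambda>a. FunT (ElT (B \<cdot> a) \<^bold>\<Rightarrow> ElT (WS A B)) (\<lambda>f.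
          ElT (C \<cdot> (cst cSup \<cdot> A \<cdot> B \<cdot> a \<cdot> f))))))))
      (\<^bold>\<lambda>A. \<^bold>\<lambda>B. \<^bold>\<lambda>C. \<^bold>\<lambda>e. \<^bold>\<lambda>a. \<^bold>\<lambda>f. cst cWrec \<cdot> A \<cdot> B \<cdot> C \<cdot> e \<cdot> (cst cSup \<cdot> A \<cdot> B \<cdot> a \<cdot> f))
      (\<^bold>\<lambda>A. \<^bold>\<lambda>B. \<^bold>\<lambda>C. \<^bold>\<lambda>e. \<^bold>\<lambda>a. \<^bold>\<lambda>f. e \<cdot> a \<cdot> f \<cdot> (\<^bold>\<lambda>x. cst cWrec \<cdot> A \<cdot> B \<cdot> C \<cdot> e \<cdot> (f \<cdot> x))),

    law SetT (TS (cst uN0)) N0,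
    law SetT (TS (cst uN1)) N1,
    law SetT (TS (cst uN2)) N2,
    law SetT (TS (cst uNat)) NatS,
    law (ElT US \<^bold>\<Rightarrow> SetT) (\<^bold>\<lambda>a. TS (cst uList \<cdot> a)) (\<^bold>\<lambda>a. ListS (TS a)),
    law (FunT (ElT US) (\<lambda>a. (ElT (TS a) \<^bold>\<Rightarrow> ElT US) \<^bold>\<Rightarrow> SetT))
      (\<^bold>\<lambda>a. \<^bold>\<lambda>b. TS (cst uPi \<cdot> a \<cdot> b)) (\<^bold>\<lambda>a. \<^bold>\<lambda>b. PiS (TS a) (\<^bold>\<lambda>x. TS (b \<cdot> x))),
    law (FunT (ElT US) (\<lambda>a. (ElT (TS a) \<^bold>\<Rightarrow> ElT US) \<^bold>\<Rightarrow> SetT))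
      (\<^bold>\<lambda>a. \<^bold>\<lambda>b. TS (cst uSigma \<cdot> a \<cdot> b)) (\<^bold>\<lambda>a. \<^bold>\<lambda>b. SigmaS (TS a) (\<^bold>\<lambda>x. TS (b \<cdot> x))),
    law (ElT US \<^bold>\<Rightarrow> ElT US \<^bold>\<Rightarrow> SetT)
      (\<^bold>\<lambda>a. \<^bold>\<lambda>b. TS (cst uPlus \<cdot> a \<cdot> b)) (\<^bold>\<lambda>a. \<^bold>\<lambda>b. PlusS (TS a) (TS b)),
    law (FunT (ElT US) (\<lambda>a. ElT (TS a) \<^bold>\<Rightarrow> ElT (TS a) \<^bold>\<Rightarrow> SetT))
      (\<^bold>\<lambda>a. \<^bold>\<lambda>x. \<^bold>\<lambda>y. TS (cst uId \<cdot> a \<cdot> x \<cdot> y)) (\<^bold>\<lambda>a. \<^bold>\<lambda>x. \<^bold>\<lambda>y. IdS (TS a) x y),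
    law (FunT (ElT US) (\<lambda>a. (ElT (TS a) \<^bold>\<Rightarrow> ElT US) \<^bold>\<Rightarrow> SetT))
      (\<^bold>\<lambda>a. \<^bold>\<lambda>b. TS (cst uW \<cdot> a \<cdot> b)) (\<^bold>\<lambda>a. \<^bold>\<lambda>b. WS (TS a) (\<^bold>\<lambda>x. TS (b \<cdot> x))) }"

definition CTT :: "'x cn rule set" where
  "CTT = CTT_decls \<union> CTT_laws"

text \<open>Propositions are sets, so a quantification over all propositions is a hypothesis of type \<open>Set\<close>.
  The uniformity principle asserts that for every \<open>I\<close>, \<open>R\<close>, \<open>F\<close> and \<open>r\<close>, where \<open>r P\<close> proves
  \<open>R P (F P)\<close>, there is an element \<open>cGup I R F r\<close> of \<open>I\<close> with a proof of \<open>R P (cGup I R F r)\<close>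
  for all \<open>P\<close>.\<close>

definition gup_hyps :: "('x cn hexp \<Rightarrow> 'x cn hexp \<Rightarrow> 'x cn hexp \<Rightarrow> 'x cn hexp \<Rightarrow> 'x cn hexp) \<Rightarrow> 'x cn hexp"
  where
  "gup_hyps C = FunT SetT (\<lambda>I. FunT (SetT \<^bold>\<Rightarrow> ElT I \<^bold>\<Rightarrow> SetT) (\<lambda>R. FunT (SetT \<^bold>\<Rightarrow> ElT I) (\<lambda>F.
     FunT (FunT SetT (\<lambda>P. ElT (R \<cdot> P \<cdot> (F \<cdot> P)))) (\<lambda>r. C I R F r))))"

definition GUP_CTT :: "'x cn rule set" where
  "GUP_CTT = {
    decl cGup (gup_hyps (\<lambda>I R F r. ElT I)),
    decl cGupPrf (gup_hyps (\<lambda>I R F r. FunT SetT (\<lambda>P. ElT (R \<cdot> P \<cdot> (cst cGup \<cdot> I \<cdot> R \<cdot> F \<cdot> r))))) }"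

definition inhabited :: "'x cn rule set \<Rightarrow> 'x cn hexp \<Rightarrow> bool" where
  "inhabited R A \<longleftrightarrow> (\<exists>t. der R [] (Elem t (A 0)))"

definition CTT_star :: "'x cn rule set \<Rightarrow> bool" where
  "CTT_star R \<longleftrightarrow> CTT \<subseteq> R \<and> \<not> inhabited (R \<union> GUP_CTT) (ElT N0)"

subsection \<open>Formal spaces in type theory\<close>

definition pAll :: "'x cn hexp \<Rightarrow> ('x cn hexp \<Rightarrow> 'x cn hexp) \<Rightarrow> 'x cn hexp" where
  "pAll A B = PiS A (\<^bold>\<lambda>x. B x)"
definition pEx :: "'x cn hexp \<Rightarrow> ('x cn hexp \<Rightarrow> 'x cn hexp) \<Rightarrow> 'x cn hexp" where
  "pEx A B = SigmaS A (\<^bold>\<lambda>x. B x)"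
definition pImp :: "'x cn hexp \<Rightarrow> 'x cn hexp \<Rightarrow> 'x cn hexp" where
  "pImp A B = PiS A (\<^bold>\<lambda>x. B)"
definition pAnd :: "'x cn hexp \<Rightarrow> 'x cn hexp \<Rightarrow> 'x cn hexp" where
  "pAnd A B = SigmaS A (\<^bold>\<lambda>x. B)"
definition pOr :: "'x cn hexp \<Rightarrow> 'x cn hexp \<Rightarrow> 'x cn hexp" where
  "pOr A B = PlusS A B"
definition pNot :: "'x cn hexp \<Rightarrow> 'x cn hexp" where
  "pNot A = pImp A N0"

text \<open>In the following, \<open>S\<close> is a set, subsets \<open>U\<close>, \<open>V\<close> of \<open>S\<close> are propositional functions of type
  \<open>(El S) Set\<close>, and the cover \<open>c\<close> has type \<open>(El S) ((El S) Set) Set\<close>.\<close>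

abbreviation SubT :: "'x cn hexp \<Rightarrow> 'x cn hexp" where
  "SubT S \<equiv> ElT S \<^bold>\<Rightarrow> SetT"

definition tEmpty :: "'x cn hexp" where
  "tEmpty = (\<^bold>\<lambda>x. N0)"

definition tSing :: "'x cn hexp \<Rightarrow> 'x cn hexp \<Rightarrow> 'x cn hexp" where
  "tSing S a = (\<^bold>\<lambda>x. IdS S x a)"

definition tUn :: "'x cn hexp \<Rightarrow> 'x cn hexp \<Rightarrow> 'x cn hexp" where
  "tUn U V = (\<^bold>\<lambda>x. pOr (U \<cdot> x) (V \<cdot> x))"

definition tCovs :: "'x cn hexp \<Rightarrow> 'x cn hexp \<Rightarrow> 'x cn hexp \<Rightarrow> 'x cn hexp \<Rightarrow> 'x cn hexp" where
  "tCovs S c U V = pAll S (\<lambda>u. pImp (U \<cdot> u) (c \<cdot> u \<cdot> V))"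

definition tCovAll :: "'x cn hexp \<Rightarrow> 'x cn hexp \<Rightarrow> 'x cn hexp \<Rightarrow> 'x cn hexp" where
  "tCovAll S c U = pAll S (\<lambda>a. c \<cdot> a \<cdot> U)"

definition tDown :: "'x cn hexp \<Rightarrow> 'x cn hexp \<Rightarrow> 'x cn hexp \<Rightarrow> 'x cn hexp \<Rightarrow> 'x cn hexp" where
  "tDown S c U V = (\<^bold>\<lambda>d. pAnd
     (pEx S (\<lambda>u. pAnd (U \<cdot> u) (c \<cdot> d \<cdot> tSing S u)))
     (pEx S (\<lambda>v. pAnd (V \<cdot> v) (c \<cdot> d \<cdot> tSing S v))))"

definition tPseudocompl :: "'x cn hexp \<Rightarrow> 'x cn hexp \<Rightarrow> 'x cn hexp \<Rightarrow> 'x cn hexp" where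
  "tPseudocompl S c U = (\<^bold>\<lambda>a. tCovs S c (tDown S c (tSing S a) U) tEmpty)"

definition tAppend :: "'x cn hexp \<Rightarrow> 'x cn hexp \<Rightarrow> 'x cn hexp \<Rightarrow> 'x cn hexp" where
  "tAppend S k l = cst cListrec \<cdot> S \<cdot> (\<^bold>\<lambda>z. ListS S) \<cdot> l \<cdot> (\<^bold>\<lambda>x. \<^bold>\<lambda>y. \<^bold>\<lambda>z. cst cCons \<cdot> S \<cdot> x \<cdot> z) \<cdot> k"

text \<open>The subset \<open>{x\<^sub>1, \<dots>, x\<^sub>n}\<close> listed by \<open>l\<close>. Recursion on \<open>l\<close> with values in \<open>Set\<close> is not
  available, so that \<open>x\<close> occurs in \<open>l\<close> is expressed as \<open>l = j @ x # k\<close> for some \<open>j\<close> and \<open>k\<close>.\<close>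

definition tListed :: "'x cn hexp \<Rightarrow> 'x cn hexp \<Rightarrow> 'x cn hexp" where
  "tListed S l = (\<^bold>\<lambda>x. pEx (ListS S) (\<lambda>j. pEx (ListS S) (\<lambda>k.
     IdS (ListS S) l (tAppend S j (cst cCons \<cdot> S \<cdot> x \<cdot> k)))))"

definition tCovRefl :: "'x cn hexp \<Rightarrow> 'x cn hexp \<Rightarrow> 'x cn hexp" where
  "tCovRefl S c = FunT (ElT S) (\<lambda>a. FunT (SubT S) (\<lambda>U. ElT (U \<cdot> a) \<^bold>\<Rightarrow> ElT (c \<cdot> a \<cdot> U)))"

definition tCovTrans :: "'x cn hexp \<Rightarrow> 'x cn hexp \<Rightarrow> 'x cn hexp" where
  "tCovTrans S c = FunT (ElT S) (\<lambda>a. FunT (SubT S) (\<lambda>U. FunT (SubT S) (\<lambda>V.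
     ElT (c \<cdot> a \<cdot> U) \<^bold>\<Rightarrow> ElT (tCovs S c U V) \<^bold>\<Rightarrow> ElT (c \<cdot> a \<cdot> V))))"

definition tCovDown :: "'x cn hexp \<Rightarrow> 'x cn hexp \<Rightarrow> 'x cn hexp" where
  "tCovDown S c = FunT (ElT S) (\<lambda>a. FunT (SubT S) (\<lambda>U. FunT (SubT S) (\<lambda>V.
     ElT (c \<cdot> a \<cdot> U) \<^bold>\<Rightarrow> ElT (c \<cdot> a \<cdot> V) \<^bold>\<Rightarrow> ElT (c \<cdot> a \<cdot> tDown S c U V))))"

definition tNontrivial :: "'x cn hexp \<Rightarrow> 'x cn hexp \<Rightarrow> 'x cn hexp" where
  "tNontrivial S c = ElT (pNot (tCovAll S c tEmpty))"

definition tDeMorgan :: "'x cn hexp \<Rightarrow> 'x cn hexp \<Rightarrow> 'x cn hexp" where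
  "tDeMorgan S c = FunT (SubT S) (\<lambda>U. ElT (tCovAll S c
     (tUn (tPseudocompl S c (tPseudocompl S c U)) (tPseudocompl S c U))))"

definition tCompact :: "'x cn hexp \<Rightarrow> 'x cn hexp \<Rightarrow> 'x cn hexp" where
  "tCompact S c = FunT (SubT S) (\<lambda>U. ElT (tCovAll S c U) \<^bold>\<Rightarrow> ElT (pEx (ListS S) (\<lambda>l.
     pAnd (pAll S (\<lambda>x. pImp (tListed S l \<cdot> x) (U \<cdot> x))) (tCovAll S c (tListed S l)))))"

definition nontrivial_de_morgan_space_in_ctt :: "'x cn rule set \<Rightarrow> 'x cn exp \<Rightarrow> 'x cn exp \<Rightarrow> bool" where
  "nontrivial_de_morgan_space_in_ctt R S c \<longleftrightarrow>
     der R [] (Elem S SET) \<and>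
     der R [] (Elem c ((ElT (emb S) \<^bold>\<Rightarrow> SubT (emb S) \<^bold>\<Rightarrow> SetT) 0)) \<and>
     inhabited R (tCovRefl (emb S) (emb c)) \<and>
     inhabited R (tCovTrans (emb S) (emb c)) \<and>
     inhabited R (tCovDown (emb S) (emb c)) \<and>
     inhabited R (tNontrivial (emb S) (emb c)) \<and>
     inhabited R (tDeMorgan (emb S) (emb c))"

definition provably_compact_in_ctt :: "'x cn rule set \<Rightarrow> 'x cn exp \<Rightarrow> 'x cn exp \<Rightarrow> bool" where
  "provably_compact_in_ctt R S c \<longleftrightarrow> inhabited R (tCompact (emb S) (emb c))"

end

theory Submission
  imports Defs "HOL-Library.Countable" "HOL-Library.Infinite_Set"
begin

text \<open>A set \<open>x\<close> gives the subset \<open>U = S \<inter> x\<close> of \<open>S\<close>, and a proposition \<open>P\<close> gives the subset \<open>U = {a \<in> S : P}\<close>.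
  By the De Morgan property and compactness, \<open>S\<close> is covered by a finite subset of \<open>U\<^sup>*\<^sup>* \<union> U\<^sup>*\<close>, which by
  uniformity may be chosen independently of \<open>U\<close>. For an element \<open>y\<close> of this finite subset uniformity,
  applied once more to the alternative \<open>y \<in> U\<^sup>*\<^sup>*\<close> or \<open>y \<in> U\<^sup>*\<close>, makes the alternative independent of \<open>U\<close>, too.
  In the first case \<open>U = \<emptyset>\<close> and in the second case \<open>U = S\<close> gives \<open>y \<lhd> \<emptyset>\<close>. Hence \<open>S \<lhd> \<emptyset>\<close>.

  In set theory there is no need to form the set of all finite subsets of \<open>S\<close>: uniformity first fixes the number
  \<open>n\<close> of elements of the finite subset, and subset collection provides a set containing all images of \<open>n\<close> in \<open>S\<close>.

  The set-theoretic derivations are carried out semantically: a formula not derivable from a set of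
  hypotheses fails in a prime extension of that set with witnesses for existential formulas.\<close>

section \<open>Set theory\<close>

subsection \<open>Saturated extensions of intuitionistic theories\<close>

text \<open>Both halves work in the theory extended by uniformity: a provably compact space yields
  falsum there, against the consistency demanded by \<open>CZF_star\<close> and
  \<open>CTT_star\<close>. Uniformity varies an object over all sets, or all propositions, while its
  value stays in one fixed set. Propositions are not objects of set theory, hence the detour through
  \<open>S \<inter> x\<close>, which bounded separation provides. An alternative is not an element
  of a set either, so it is coded by one. One and the same code must be unable to stand for both
  sides: in set theory an element of \<omega> cannot be both empty and inhabited, in type theory the
  decoding of an element of the universe cannot be both true and refuted. A saturated set decides
  disjunctions and supplies witnesses, but says nothing direct about implications and universal
  statements; these are checked in all saturated sets that share finitely many facts with the given
  one. Type theory gets by without such models: truth is inhabitation in a context, an existential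
  yields a witness term, and a quantifier over propositions is a context variable of type
  \<open>SET\<close>.\<close>

lemma up_comp: "up f \<circ> up g = up (f \<circ> g)"
proof
  show "(up f \<circ> up g) i = up (f \<circ> g) i" for i by (cases i) auto
qed

lemma up_ident: "up (\<lambda>i. i) = (\<lambda>i. i)"
proof
  show "up (\<lambda>i. i) i = i" for i by (cases i) auto
qed

lemma fren_fren: "fren f (fren g p) = fren (f \<circ> g) p"
  by (induction p arbitrary: f g) (simp_all only: fren.simps up_comp comp_apply)

lemma fren_cong: "(\<And>i. i \<in> fv p \<Longrightarrow> f i = g i) \<Longrightarrow> fren f p = fren g p"
proof (induction p arbitrary: f g)
  case (And p q)
  show ?case using And.IH[of f g] And.prems by simp
next
  case (Or p q)
  show ?case using Or.IH[of f g] Or.prems by simp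
next
  case (Imp p q)
  show ?case using Imp.IH[of f g] Imp.prems by simp
next
  case (All p)
  have "up f i = up g i" if "i \<in> fv p" for i
    using that All.prems by (cases i) auto
  from All.IH[OF this] show ?case by simp
next
  case (Ex p)
  have "up f i = up g i" if "i \<in> fv p" for i
    using that Ex.prems by (cases i) auto
  from Ex.IH[OF this] show ?case by simp
qed simp_all

lemma fren_id: "(\<And>i. i \<in> fv p \<Longrightarrow> f i = i) \<Longrightarrow> fren f p = p"
proof -
  have "fren (\<lambda>i. i) q = q" for q
    by (induction q) (simp_all add: up_ident)
  then show "(\<And>i. i \<in> fv p \<Longrightarrow> f i = i) \<Longrightarrow> fren f p = p"
    using fren_cong[of p f "\<lambda>i. i"] by simp
qed

lemma finite_fv: "finite (fv p)"
proof (induction p)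
  case (All p)
  have "{i. Suc i \<in> fv p} = Suc -` fv p" by auto
  then show ?case using finite_vimageI[OF All, of Suc] by simp
next
  case (Ex p)
  have "{i. Suc i \<in> fv p} = Suc -` fv p" by auto
  then show ?case using finite_vimageI[OF Ex, of Suc] by simp
qed auto

section \<open>Structural properties of derivability\<close>

lemma nd_weaken: "G \<turnstile> p \<Longrightarrow> G \<subseteq> H \<Longrightarrow> H \<turnstile> p"
proof (induction arbitrary: H rule: nd.induct)
  case (OrE G p q r)
  show ?case
    by (rule nd.OrE[OF OrE.IH(1)[OF OrE.prems] OrE.IH(2) OrE.IH(3)]) (use OrE.prems in auto)
next
  case (ImpI p G q)
  show ?case by (rule nd.ImpI, rule ImpI.IH) (use ImpI.prems in auto)
next
  case (AllI G p)
  show ?case by (rule nd.AllI, rule AllI.IH) (use AllI.prems in auto)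
next
  case (ExE G p q)
  show ?case by (rule nd.ExE[OF ExE.IH(1)[OF ExE.prems] ExE.IH(2)]) (use ExE.prems in auto)
next
  case (ExI G x p)
  show ?case by (rule nd.ExI[OF ExI.IH[OF ExI.prems]])
next
  case (AllE G p x)
  show ?case by (rule nd.AllE[OF AllE.IH[OF AllE.prems]])
next
  case (EqE G x y p)
  show ?case by (rule nd.EqE[OF EqE.IH(1)[OF EqE.prems] EqE.IH(2)[OF EqE.prems]])
qed (meson nd.Hyp nd.BotE nd.AndI nd.AndE1 nd.AndE2 nd.OrI1 nd.OrI2 nd.ImpE nd.EqI subsetD)+

lemma up_o_inst: "fren f (fren (inst x) p) = fren (inst (f x)) (fren (up f) p)"
proof -
  have "(f \<circ> inst x) i = (inst (f x) \<circ> up f) i" for i by (cases i) auto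
  then have "f \<circ> inst x = inst (f x) \<circ> up f" by blast
  then show ?thesis by (simp add: fren_fren)
qed

lemma up_o_Suc: "fren (up f) (fren Suc p) = fren Suc (fren f p)"
proof -
  have "up f \<circ> Suc = Suc \<circ> f" by auto
  then show ?thesis by (simp add: fren_fren)
qed

text \<open>The renaming need not be injective. The eigenvariable of a quantifier rule is index 0,
  which \<open>up f\<close> keeps apart from all other variables, and shifting the hypotheses
  commutes with \<open>f\<close>.\<close>

lemma nd_rename: "G \<turnstile> p \<Longrightarrow> fren f ` G \<turnstile> fren f p"
proof (induction arbitrary: f rule: nd.induct)
  case (OrE G p q r)
  show ?case
    by (rule nd.OrE[of _ "fren f p" "fren f q"]) (use OrE.IH[of f] in auto)
next
  case (AllI G p)
  have "fren (up f) ` fren Suc ` G = fren Suc ` fren f ` G"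
    by (auto simp: image_image up_o_Suc)
  with AllI.IH[of "up f"] show ?case by (auto intro: nd.AllI)
next
  case (ExE G p q)
  have "fren (up f) ` fren Suc ` G = fren Suc ` fren f ` G"
    by (auto simp: image_image up_o_Suc)
  with ExE.IH(2)[of "up f"] have "insert (fren (up f) p) (fren Suc ` fren f ` G) \<turnstile> fren Suc (fren f q)"
    by (simp add: up_o_Suc)
  with ExE.IH(1)[of f] show ?case by (auto intro: nd.ExE)
next
  case (AllE G p x)
  then show ?case using nd.AllE[of "fren f ` G" "fren (up f) p" "f x"] by (simp add: up_o_inst)
next
  case (ExI G x p)
  then show ?case using nd.ExI[of "fren f ` G" "f x" "fren (up f) p"] by (simp add: up_o_inst)
next
  case (EqE G x y p)
  then show ?case using nd.EqE[of "fren f ` G" "f x" "f y" "fren (up f) p"] by (simp add: up_o_inst)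
qed (auto intro: nd.intros)

text \<open>Makes the union of an increasing chain of theories derive no more than its stages do. In
  the quantifier rules the finite set consists of shifted hypotheses, and finitely many preimages of
  them are chosen.\<close>

lemma nd_finite: "G \<turnstile> p \<Longrightarrow> \<exists>F. finite F \<and> F \<subseteq> G \<and> F \<turnstile> p"
proof (induction rule: nd.induct)
  case (Hyp p G)
  then show ?case by (intro exI[of _ "{p}"]) (auto intro: nd.Hyp)
next
  case (AndI G p q)
  then obtain F1 F2 where "finite F1" "F1 \<subseteq> G" "F1 \<turnstile> p" "finite F2" "F2 \<subseteq> G" "F2 \<turnstile> q" by blast
  then show ?case by (intro exI[of _ "F1 \<union> F2"]) (auto intro!: nd.AndI intro: nd_weaken)
next
  case (ImpE G p q)
  then obtain F1 F2 where F: "finite F1" "F1 \<subseteq> G" "F1 \<turnstile> Imp p q" "finite F2" "F2 \<subseteq> G" "F2 \<turnstile> p" by blast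
  then have "F1 \<union> F2 \<turnstile> q" by (blast intro: nd.ImpE[of _ p] nd_weaken)
  then show ?case using F by (intro exI[of _ "F1 \<union> F2"]) auto
next
  case (EqE G x y p)
  then obtain F1 F2 where F: "finite F1" "F1 \<subseteq> G" "F1 \<turnstile> Eq x y" "finite F2" "F2 \<subseteq> G" "F2 \<turnstile> fren (inst x) p" by blast
  then have "F1 \<union> F2 \<turnstile> fren (inst y) p" by (blast intro: nd.EqE[of _ x] nd_weaken)
  then show ?case using F by (intro exI[of _ "F1 \<union> F2"]) auto
next
  case (OrE G p q r)
  then obtain F1 F2 F3 where F: "finite F1" "F1 \<subseteq> G" "F1 \<turnstile> Or p q"
    "finite F2" "F2 \<subseteq> insert p G" "F2 \<turnstile> r" "finite F3" "F3 \<subseteq> insert q G" "F3 \<turnstile> r" by blast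
  let ?F = "F1 \<union> (F2 - {p}) \<union> (F3 - {q})"
  have "?F \<turnstile> r"
    by (rule nd.OrE[of _ p q]) (auto intro: nd_weaken[OF F(3)] nd_weaken[OF F(6)] nd_weaken[OF F(9)])
  then show ?case using F by (intro exI[of _ ?F]) auto
next
  case (ImpI p G q)
  then obtain F where F: "finite F" "F \<subseteq> insert p G" "F \<turnstile> q" by blast
  have "F - {p} \<turnstile> Imp p q" by (rule nd.ImpI) (auto intro: nd_weaken[OF F(3)])
  then show ?case using F by (intro exI[of _ "F - {p}"]) auto
next
  case (AllI G p)
  then obtain F where F: "finite F" "F \<subseteq> fren Suc ` G" "F \<turnstile> p" by blast
  from finite_subset_image[OF F(1,2)] obtain F' where "F' \<subseteq> G" "finite F'" "F = fren Suc ` F'" by blast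
  with F(3) show ?case by (intro exI[of _ F']) (auto intro: nd.AllI)
next
  case (ExE G p q)
  then obtain F1 F2 where F: "finite F1" "F1 \<subseteq> G" "F1 \<turnstile> Ex p"
    "finite F2" "F2 \<subseteq> insert p (fren Suc ` G)" "F2 \<turnstile> fren Suc q" by blast
  have "F2 - {p} \<subseteq> fren Suc ` G" "finite (F2 - {p})" using F by auto
  from finite_subset_image[OF this(2,1)] obtain F' where F': "F' \<subseteq> G" "finite F'" "F2 - {p} = fren Suc ` F'"
    by blast
  have "F1 \<union> F' \<turnstile> q"
  proof (rule nd.ExE)
    show "F1 \<union> F' \<turnstile> Ex p" by (rule nd_weaken[OF F(3)]) auto
    show "insert p (fren Suc ` (F1 \<union> F')) \<turnstile> fren Suc q"
      by (rule nd_weaken[OF F(6)]) (use F' in auto)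
  qed
  then show ?case using F F' by (intro exI[of _ "F1 \<union> F'"]) auto
next
  case (ExI G x p)
  then show ?case by (blast intro: nd.ExI)
next
  case (AllE G p x)
  then show ?case by (blast intro: nd.AllE)
next
  case (EqI G x)
  show ?case by (intro exI[of _ "{}"]) (auto intro: nd.EqI)
qed (meson nd.BotE nd.AndE1 nd.AndE2 nd.OrI1 nd.OrI2)+

lemma nd_cut:
  assumes "finite F" and "H \<union> F \<turnstile> q" and "\<And>p. p \<in> F \<Longrightarrow> H \<turnstile> p"
  shows "H \<turnstile> q"
  using assms
proof (induction F arbitrary: q rule: finite_induct)
  case (insert p F)
  have "H \<union> F \<turnstile> Imp p q" using insert.prems(1) by (auto intro: nd.ImpI)
  then have "H \<turnstile> Imp p q" using insert.IH insert.prems(2) by blast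
  then show ?case using insert.prems(2) by (blast intro: nd.ImpE)
qed auto

text \<open>Turns a named eigenvariable \<open>x\<close> into the bound index 0. It undoes
  \<open>inst x\<close> on a formula not containing \<open>x\<close> and agrees with
  \<open>Suc\<close> on hypotheses not containing \<open>x\<close>, so the de Bruijn rules become
  the textbook rules with a freshness condition.\<close>

definition freshen :: "nat \<Rightarrow> nat \<Rightarrow> nat" where
  "freshen x i = (if i = x then 0 else Suc i)"

lemma freshen_hyps:
  assumes "\<And>q. q \<in> G \<Longrightarrow> x \<notin> fv q"
  shows "fren (freshen x) ` G = fren Suc ` G"
proof -
  have "fren (freshen x) q = fren Suc q" if "q \<in> G" for q
    using assms[OF that] by (intro fren_cong) (auto simp: freshen_def)
  then show ?thesis by (auto simp: image_iff)
qed

lemma freshen_inst: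
  assumes "x \<notin> {i. Suc i \<in> fv p}"
  shows "fren (freshen x) (fren (inst x) p) = p"
  unfolding fren_fren
proof (rule fren_id)
  fix i assume "i \<in> fv p"
  then show "(freshen x \<circ> inst x) i = i"
    using assms by (cases i) (auto simp: freshen_def)
qed

lemma nd_AllI_fresh:
  assumes "G \<turnstile> fren (inst x) p" and "\<And>q. q \<in> G \<Longrightarrow> x \<notin> fv q" and "x \<notin> fv (All p)"
  shows "G \<turnstile> All p"
proof (rule nd.AllI)
  show "fren Suc ` G \<turnstile> p"
    using nd_rename[OF assms(1), of "freshen x"] freshen_hyps[of G x] freshen_inst[of x p] assms by simp
qed

lemma nd_ExE_fresh:
  assumes "G \<turnstile> Ex p" and "insert (fren (inst x) p) G \<turnstile> q"
    and "\<And>q. q \<in> G \<Longrightarrow> x \<notin> fv q" and "x \<notin> fv (Ex p)" and "x \<notin> fv q"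
  shows "G \<turnstile> q"
proof (rule nd.ExE[OF assms(1)])
  have "fren (freshen x) q = fren Suc q"
    using assms(5) by (intro fren_cong) (auto simp: freshen_def)
  then show "insert p (fren Suc ` G) \<turnstile> fren Suc q"
    using nd_rename[OF assms(2), of "freshen x"] freshen_hyps[of G x] freshen_inst[of x p] assms by simp
qed

lemma obtain_fresh:
  assumes "\<forall>p\<in>T. fv p = {}" and "finite F"
  obtains x where "\<And>q. q \<in> T \<union> F \<Longrightarrow> x \<notin> fv q"
proof -
  have "finite (\<Union>(fv ` F))" using assms(2) by (auto simp: finite_fv)
  then obtain x where "x \<notin> \<Union>(fv ` F)" using ex_new_if_finite[OF infinite_UNIV_nat] by blast
  then show ?thesis using that assms(1) by blast
qed

text \<open>The disjunction and existence properties, phrased through derivability, so that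
  \<open>H\<close> itself need not be closed under deduction. Variables are the only terms and hence
  the only possible witnesses.\<close>

definition saturated :: "fm set \<Rightarrow> bool" where
  "saturated H \<longleftrightarrow> (\<forall>p q. H \<turnstile> Or p q \<longrightarrow> H \<turnstile> p \<or> H \<turnstile> q) \<and>
     (\<forall>p. H \<turnstile> Ex p \<longrightarrow> (\<exists>x. H \<turnstile> fren (inst x) p))"

section \<open>Construction of saturated extensions\<close>

instance fm :: countable by countable_datatype

text \<open>Treats one formula \<open>r\<close>. If both disjuncts of a derivable disjunction led to
  \<open>Z\<close>, then so would the disjunction; a fresh variable as witness of a derivable
  existential leads to \<open>Z\<close> only if the existential does.\<close>

lemma saturation_step:
  assumes T: "\<forall>p\<in>T. fv p = {}" and F: "finite F" and Z: "\<not> T \<union> F \<turnstile> Z"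
  shows "\<exists>F'. finite F' \<and> F \<subseteq> F' \<and> \<not> T \<union> F' \<turnstile> Z \<and>
    (\<forall>p q. r = Or p q \<longrightarrow> T \<union> F \<turnstile> r \<longrightarrow> p \<in> F' \<or> q \<in> F') \<and>
    (\<forall>p. r = Ex p \<longrightarrow> T \<union> F \<turnstile> r \<longrightarrow> (\<exists>x. fren (inst x) p \<in> F'))"
proof (cases "T \<union> F \<turnstile> r \<and> ((\<exists>p q. r = Or p q) \<or> (\<exists>p. r = Ex p))")
  case False
  then show ?thesis using F Z by (intro exI[of _ F]) auto
next
  case True
  then consider p q where "r = Or p q" | p where "r = Ex p" by blast
  then show ?thesis
  proof cases
    case 1
    have "\<not> T \<union> insert p F \<turnstile> Z \<or> \<not> T \<union> insert q F \<turnstile> Z"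
      using nd.OrE[of "T \<union> F" p q Z] True Z 1 by auto
    then show ?thesis
    proof
      assume "\<not> T \<union> insert p F \<turnstile> Z"
      then show ?thesis using F 1 by (intro exI[of _ "insert p F"]) auto
    next
      assume "\<not> T \<union> insert q F \<turnstile> Z"
      then show ?thesis using F 1 by (intro exI[of _ "insert q F"]) auto
    qed
  next
    case 2
    obtain x where x: "\<And>q. q \<in> T \<union> insert Z (insert r F) \<Longrightarrow> x \<notin> fv q"
      using obtain_fresh[OF T, of "insert Z (insert r F)"] F by blast
    have "T \<union> F \<turnstile> Z" if "T \<union> insert (fren (inst x) p) F \<turnstile> Z"
      by (rule nd_ExE_fresh[of _ p x]) (use that True 2 x x[of "Ex p"] in simp_all)
    then have "\<not> T \<union> insert (fren (inst x) p) F \<turnstile> Z" using Z by blast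
    then show ?thesis using F 2 by (intro exI[of _ "insert (fren (inst x) p) F"]) auto
  qed
qed

text \<open>The Henkin construction for intuitionistic logic: consistency is replaced by the
  underivability of a chosen formula \<open>Z\<close>, since a negation cannot be added to refute
  it.\<close>

theorem saturation:
  assumes T: "\<forall>p\<in>T. fv p = {}" and F: "finite F" and Z: "\<not> T \<union> F \<turnstile> Z"
  obtains H where "T \<union> F \<subseteq> H" and "saturated H" and "\<not> H \<turnstile> Z"
proof -
  \<comment> \<open>The second component makes every formula occur infinitely often: a disjunction
    or existential may become derivable long after its first turn.\<close>
  define r :: "nat \<Rightarrow> fm" where "r n = fst (from_nat n :: fm \<times> nat)" for n
  define good where "good E \<longleftrightarrow> finite E \<and> \<not> T \<union> E \<turnstile> Z" for E
  define next_ok where "next_ok n E E' \<longleftrightarrow> E \<subseteq> E' \<and>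
    (\<forall>p q. r n = Or p q \<longrightarrow> T \<union> E \<turnstile> r n \<longrightarrow> p \<in> E' \<or> q \<in> E') \<and>
    (\<forall>p. r n = Ex p \<longrightarrow> T \<union> E \<turnstile> r n \<longrightarrow> (\<exists>x. fren (inst x) p \<in> E'))" for n E E'
  \<comment> \<open>The conjunct about \<open>n = 0\<close> pins the start of the sequence to
    \<open>F\<close>, which dependent choice leaves open.\<close>
  have "\<exists>f. \<forall>n. good (f n) \<and> (n = 0 \<longrightarrow> f n = F) \<and> next_ok n (f n) (f (Suc n))"
  proof (rule dependent_nat_choice[where P="\<lambda>n E. good E \<and> (n = 0 \<longrightarrow> E = F)" and Q=next_ok,
      unfolded conj_assoc])
    show "\<exists>E. good E \<and> (0 = (0::nat) \<longrightarrow> E = F)" using F Z by (auto simp: good_def)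
    fix E and n :: nat assume "good E \<and> (n = 0 \<longrightarrow> E = F)"
    then have "finite E" and "\<not> T \<union> E \<turnstile> Z" by (simp_all add: good_def)
    from saturation_step[OF T this, of "r n"] obtain E' where "good E'" "next_ok n E E'"
      unfolding good_def next_ok_def by (elim exE conjE) simp
    then show "\<exists>E'. good E' \<and> (Suc n = 0 \<longrightarrow> E' = F) \<and> next_ok n E E'" by auto
  qed
  then obtain f where f: "\<And>n. good (f n)" "f 0 = F" "\<And>n. next_ok n (f n) (f (Suc n))" by blast
  have mono: "f m \<subseteq> f n" if "m \<le> n" for m n
    by (rule lift_Suc_mono_le[OF _ that]) (use f(3) in \<open>auto simp: next_ok_def\<close>)
  define H where "H = T \<union> (\<Union>n. f n)"
  have stage: "\<exists>n. T \<union> f n \<turnstile> q" if q: "H \<turnstile> q" for q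
  proof -
    obtain E where E: "finite E" "E \<subseteq> H" "E \<turnstile> q" using nd_finite[OF q] by blast
    have "\<exists>n. E \<subseteq> T \<union> f n" using E(1,2)
    proof (induction E rule: finite_induct)
      case (insert p E)
      then obtain n m where "E \<subseteq> T \<union> f n" "p \<in> T \<union> f m" unfolding H_def by blast
      then have "insert p E \<subseteq> T \<union> f (max n m)" using mono[of n "max n m"] mono[of m "max n m"] by auto
      then show ?case by blast
    qed auto
    then show ?thesis using E(3) nd_weaken by blast
  qed
  \<comment> \<open>Once derivable at stage \<open>m\<close>, the formula is still derivable at one
    of its infinitely many turns from \<open>m\<close> on.\<close>
  have later: "\<exists>n. r n = q \<and> T \<union> f n \<turnstile> q" if q: "H \<turnstile> q" for q
  proof -
    obtain m where m: "T \<union> f m \<turnstile> q" using stage[OF q] by blast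
    have "infinite (range (\<lambda>k. to_nat (q, k :: nat)))"
      by (rule range_inj_infinite) (auto simp: inj_on_def)
    then obtain n where n: "n \<ge> m" "n \<in> range (\<lambda>k. to_nat (q, k :: nat))"
      by (meson infinite_nat_iff_unbounded_le)
    then have "r n = q" by (auto simp: r_def)
    moreover have "T \<union> f n \<turnstile> q" by (rule nd_weaken[OF m]) (use mono[OF n(1)] in auto)
    ultimately show ?thesis by blast
  qed
  have "H \<turnstile> p \<or> H \<turnstile> q" if pq: "H \<turnstile> Or p q" for p q
  proof -
    obtain n where "r n = Or p q" "T \<union> f n \<turnstile> Or p q" using later[OF pq] by blast
    then have "p \<in> f (Suc n) \<or> q \<in> f (Suc n)" using f(3)[of n] by (auto simp: next_ok_def)
    then show ?thesis unfolding H_def by (blast intro: nd.Hyp)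
  qed
  moreover have "\<exists>x. H \<turnstile> fren (inst x) p" if ex: "H \<turnstile> Ex p" for p
  proof -
    obtain n where "r n = Ex p" "T \<union> f n \<turnstile> Ex p" using later[OF ex] by blast
    then obtain x where "fren (inst x) p \<in> f (Suc n)" using f(3)[of n] by (auto simp: next_ok_def)
    then show ?thesis unfolding H_def by (blast intro: nd.Hyp)
  qed
  ultimately have "saturated H" by (auto simp: saturated_def)
  moreover have "\<not> H \<turnstile> Z" using stage f(1) by (auto simp: good_def)
  moreover have "T \<union> F \<subseteq> H" using f(2) by (auto simp: H_def)
  ultimately show ?thesis using that by blast
qed

subsection \<open>Renaming of formulas with named variables\<close>

text \<open>The variable that is number \<open>v\<close> in the whole expression: each binder above
  it raises its index by one.\<close>

definition K :: "nat \<Rightarrow> hvar" where "K v = (\<lambda>d. v + d)"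

text \<open>\<open>f\<close> carries an expression from depth \<open>d\<close> to depth
  \<open>e\<close> without disturbing its parameters.\<close>

definition shifts :: "(nat \<Rightarrow> nat) \<Rightarrow> nat \<Rightarrow> nat \<Rightarrow> bool" where
  "shifts f d e \<longleftrightarrow> (\<forall>v. f (v + d) = v + e)"

text \<open>Formulas with named variables are parametric: related variables give related formulas. Hence
  instantiating a de Bruijn index in \<open>A x\<close> amounts to applying \<open>A\<close> to another variable.\<close>

definition vrel :: "(nat \<Rightarrow> nat) \<Rightarrow> nat \<Rightarrow> nat \<Rightarrow> hvar \<Rightarrow> hvar \<Rightarrow> bool" where
  "vrel f d e x y \<longleftrightarrow> (\<forall>k. (up ^^ k) f (x (d + k)) = y (e + k))"

definition frel :: "(nat \<Rightarrow> nat) \<Rightarrow> nat \<Rightarrow> nat \<Rightarrow> hfm \<Rightarrow> hfm \<Rightarrow> bool" where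
  "frel f d e A B \<longleftrightarrow> (\<forall>k. fren ((up ^^ k) f) (A (d + k)) = B (e + k))"

lemma up_pow: "(up ^^ k) f i = (if i < k then i else f (i - k) + k)"
proof (induction k arbitrary: i)
  case (Suc k)
  show ?case by (cases i) (auto simp: Suc)
qed simp

lemma shifts_up: "shifts f d e \<Longrightarrow> shifts ((up ^^ k) f) (d + k) (e + k)"
  by (auto simp: shifts_def up_pow add.assoc[symmetric])

lemma vrel_up: "vrel f d e x y \<Longrightarrow> vrel ((up ^^ k) f) (d + k) (e + k) x y"
  unfolding vrel_def by (metis funpow_add comp_apply add.assoc add.commute)

lemma vrel_K: "shifts f d e \<Longrightarrow> vrel f d e (K v) (K v)"
  by (auto simp: vrel_def K_def up_pow shifts_def add.assoc[symmetric])

section \<open>Connectives and quantifiers respect renaming\<close>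

lemma frel_hBot: "frel f d e \<^bold>\<bottom> \<^bold>\<bottom>"
  by (simp add: frel_def hBot_def)

lemma frel_hMem: "vrel f d e x x' \<Longrightarrow> vrel f d e y y' \<Longrightarrow> frel f d e (x \<^bold>\<in> y) (x' \<^bold>\<in> y')"
  by (simp add: frel_def vrel_def hMem_def)

lemma frel_hEq: "vrel f d e x x' \<Longrightarrow> vrel f d e y y' \<Longrightarrow> frel f d e (x \<^bold>= y) (x' \<^bold>= y')"
  by (simp add: frel_def vrel_def hEq_def)

lemma frel_hAnd: "frel f d e A A' \<Longrightarrow> frel f d e B B' \<Longrightarrow> frel f d e (A \<^bold>\<and> B) (A' \<^bold>\<and> B')"
  by (simp add: frel_def hAnd_def)

lemma frel_hOr: "frel f d e A A' \<Longrightarrow> frel f d e B B' \<Longrightarrow> frel f d e (A \<^bold>\<or> B) (A' \<^bold>\<or> B')"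
  by (simp add: frel_def hOr_def)

lemma frel_hImp: "frel f d e A A' \<Longrightarrow> frel f d e B B' \<Longrightarrow> frel f d e (A \<^bold>\<longrightarrow> B) (A' \<^bold>\<longrightarrow> B')"
  by (simp add: frel_def hImp_def)

lemma frel_hIff: "frel f d e A A' \<Longrightarrow> frel f d e B B' \<Longrightarrow> frel f d e (A \<^bold>\<longleftrightarrow> B) (A' \<^bold>\<longleftrightarrow> B')"
  unfolding hIff_def by (intro frel_hAnd frel_hImp)

text \<open>Another \<open>j\<close> binders further in, the newly bound variable has index
  \<open>j\<close> on both sides, and \<open>j\<close> lies below the threshold up to which the
  lifted renaming is the identity.\<close>

lemma vrel_bound: "vrel ((up ^^ Suc k) f) (d + Suc k) (e + Suc k) (\<lambda>d'. d' - (d + k) - 1) (\<lambda>d'. d' - (e + k) - 1)"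
  unfolding vrel_def
proof
  fix j
  have "(up ^^ j) ((up ^^ Suc k) f) i = (up ^^ (j + Suc k)) f i" for i
    by (simp only: funpow_add comp_apply)
  then show "(up ^^ j) ((up ^^ Suc k) f) (d + Suc k + j - (d + k) - 1) = e + Suc k + j - (e + k) - 1"
    by (simp only: up_pow) simp
qed

text \<open>The assumption ranges over all \<open>k\<close> because a binder may itself stand at any
  depth below the point where the formulas are compared.\<close>

lemma frel_binder:
  assumes "\<And>k x y. vrel ((up ^^ k) f) (d + k) (e + k) x y \<Longrightarrow> frel ((up ^^ k) f) (d + k) (e + k) (A x) (B y)"
  shows "fren (up ((up ^^ k) f)) (A (\<lambda>d'. d' - (d + k) - 1) (Suc (d + k))) =
    B (\<lambda>d'. d' - (e + k) - 1) (Suc (e + k))"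
proof -
  have "frel ((up ^^ Suc k) f) (d + Suc k) (e + Suc k)
      (A (\<lambda>d'. d' - (d + k) - 1)) (B (\<lambda>d'. d' - (e + k) - 1))"
    by (rule assms) (rule vrel_bound)
  then have "fren ((up ^^ 0) ((up ^^ Suc k) f)) (A (\<lambda>d'. d' - (d + k) - 1) (d + Suc k + 0)) =
      B (\<lambda>d'. d' - (e + k) - 1) (e + Suc k + 0)"
    unfolding frel_def by blast
  then show ?thesis by simp
qed

lemma frel_hAll:
  assumes "\<And>k x y. vrel ((up ^^ k) f) (d + k) (e + k) x y \<Longrightarrow> frel ((up ^^ k) f) (d + k) (e + k) (A x) (B y)"
  shows "frel f d e (\<^bold>\<forall>x. A x) (\<^bold>\<forall>x. B x)"
  using frel_binder[of f d e A B, OF assms] by (simp add: frel_def hAll_def)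

lemma frel_hEx:
  assumes "\<And>k x y. vrel ((up ^^ k) f) (d + k) (e + k) x y \<Longrightarrow> frel ((up ^^ k) f) (d + k) (e + k) (A x) (B y)"
  shows "frel f d e (\<^bold>\<exists>x. A x) (\<^bold>\<exists>x. B x)"
  using frel_binder[of f d e A B, OF assms] by (simp add: frel_def hEx_def)

text \<open>An arbitrary \<open>p\<close> may have parameters besides its two arguments;
  \<open>shifts\<close> is what makes \<open>f\<close> preserve them.\<close>

lemma frel_happ2:
  assumes "shifts f d e" and "vrel f d e x x'" and "vrel f d e y y'"
  shows "frel f d e (p\<^bold>[[x, y]\<^bold>]) (p\<^bold>[[x', y']\<^bold>])"
  unfolding frel_def happ_def fren_fren
proof (intro allI fren_cong)
  fix k i
  show "((up ^^ k) f \<circ> (\<lambda>i. if i < length [x, y] then ([x, y] ! i) (d + k) else d + k + (i - length [x, y]))) i =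
    (if i < length [x', y'] then ([x', y'] ! i) (e + k) else e + k + (i - length [x', y']))"
  proof (cases "i < 2")
    case True
    then have "i = 0 \<or> i = 1" by auto
    then show ?thesis using assms(2,3) by (auto simp: vrel_def)
  next
    case False
    have "f (d + (i - 2)) = e + (i - 2)" using assms(1) by (metis shifts_def add.commute)
    moreover have "d + k + (i - 2) - k = d + (i - 2)" by simp
    ultimately show ?thesis using False by (simp add: up_pow numeral_2_eq_2 del: add_diff_assoc add_diff_assoc2)
  qed
qed

text \<open>The cover has no parameters, so the relation of the two arguments alone decides the
  matter.\<close>

lemma frel_cov:
  assumes "fv c \<subseteq> {0, 1}" and "vrel f d e x x'" and "vrel f d e U U'"
  shows "frel f d e (cov c x U) (cov c x' U')"
  unfolding frel_def cov_def happ_def fren_fren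
proof (intro allI fren_cong)
  fix k i
  assume "i \<in> fv c"
  with assms(1) have "i = 0 \<or> i = 1" by auto
  then show "((up ^^ k) f \<circ> (\<lambda>i. if i < length [x, U] then ([x, U] ! i) (d + k) else d + k + (i - length [x, U]))) i =
    (if i < length [x', U'] then ([x', U'] ! i) (e + k) else e + k + (i - length [x', U']))"
    using assms(2,3) by (auto simp: vrel_def)
qed

text \<open>One rule per connective: a formula is related to its renaming by following its syntax,
  and all naturality proofs below consist of that.\<close>

lemmas frel_basic = frel_hBot frel_hMem frel_hEq frel_hAnd frel_hOr frel_hImp frel_hIff frel_hAll frel_hEx
  vrel_K vrel_up shifts_up

lemma frel_hsub: "vrel f d e x x' \<Longrightarrow> vrel f d e y y' \<Longrightarrow> frel f d e (x \<^bold>\<subseteq> y) (x' \<^bold>\<subseteq> y')"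
  unfolding hsub_def by (assumption | rule frel_basic)+

lemma frel_is_empty: "vrel f d e x x' \<Longrightarrow> frel f d e (is_empty x) (is_empty x')"
  unfolding is_empty_def by (assumption | rule frel_basic)+

lemma frel_is_sing: "vrel f d e x x' \<Longrightarrow> vrel f d e y y' \<Longrightarrow> frel f d e (is_sing x y) (is_sing x' y')"
  unfolding is_sing_def by (assumption | rule frel_basic)+

lemma frel_is_pair: "vrel f d e x x' \<Longrightarrow> vrel f d e y y' \<Longrightarrow> vrel f d e z z' \<Longrightarrow>
    frel f d e (is_pair x y z) (is_pair x' y' z')"
  unfolding is_pair_def by (assumption | rule frel_basic)+

lemma frel_is_union: "vrel f d e x x' \<Longrightarrow> vrel f d e y y' \<Longrightarrow> vrel f d e z z' \<Longrightarrow>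
    frel f d e (is_union x y z) (is_union x' y' z')"
  unfolding is_union_def by (assumption | rule frel_basic)+

lemma frel_is_succ: "vrel f d e x x' \<Longrightarrow> vrel f d e y y' \<Longrightarrow> frel f d e (is_succ x y) (is_succ x' y')"
  unfolding is_succ_def by (assumption | rule frel_basic)+

lemma frel_is_opair: "vrel f d e x x' \<Longrightarrow> vrel f d e y y' \<Longrightarrow> vrel f d e z z' \<Longrightarrow>
    frel f d e (is_opair x y z) (is_opair x' y' z')"
  unfolding is_opair_def by (assumption | rule frel_basic frel_is_sing frel_is_pair)+

lemma frel_is_inductive: "vrel f d e x x' \<Longrightarrow> frel f d e (is_inductive x) (is_inductive x')"
  unfolding is_inductive_def by (assumption | rule frel_basic frel_is_empty frel_is_succ)+

lemma frel_is_omega: "vrel f d e x x' \<Longrightarrow> frel f d e (is_omega x) (is_omega x')"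
  unfolding is_omega_def by (assumption | rule frel_basic frel_is_inductive frel_hsub)+

lemma frel_maps_to: "vrel f d e x x' \<Longrightarrow> vrel f d e y y' \<Longrightarrow> vrel f d e z z' \<Longrightarrow>
    frel f d e (maps_to x y z) (maps_to x' y' z')"
  unfolding maps_to_def by (assumption | rule frel_basic frel_is_opair)+

lemma frel_is_surjection: "vrel f d e x x' \<Longrightarrow> vrel f d e y y' \<Longrightarrow> vrel f d e z z' \<Longrightarrow>
    frel f d e (is_surjection x y z) (is_surjection x' y' z')"
  unfolding is_surjection_def by (assumption | rule frel_basic frel_is_opair frel_maps_to)+

lemma frel_finitely_listed: "vrel f d e x x' \<Longrightarrow> frel f d e (finitely_listed x) (finitely_listed x')"
  unfolding finitely_listed_def by (assumption | rule frel_basic frel_is_omega frel_is_surjection)+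

lemmas frel_sets = frel_basic frel_hsub frel_is_empty frel_is_sing frel_is_pair frel_is_union frel_is_succ
  frel_is_opair frel_is_inductive frel_is_omega frel_maps_to frel_is_surjection frel_finitely_listed frel_happ2

text \<open>A function from variables to formulas need not be a formula with a hole, as it could
  inspect the index that it is given. Naturality rules this out and is what quantifier rules
  need.\<close>

definition natural :: "(hvar \<Rightarrow> hfm) \<Rightarrow> bool" where
  "natural A \<longleftrightarrow> (\<forall>f d e x y. shifts f d e \<longrightarrow> vrel f d e x y \<longrightarrow> frel f d e (A x) (A y))"

definition natural2 :: "(hvar \<Rightarrow> hvar \<Rightarrow> hfm) \<Rightarrow> bool" where
  "natural2 A \<longleftrightarrow> (\<forall>f d e x x' y y'. shifts f d e \<longrightarrow> vrel f d e x x' \<longrightarrow> vrel f d e y y' \<longrightarrow>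
     frel f d e (A x y) (A x' y'))"

lemma naturalI:
  "(\<And>f d e x y. shifts f d e \<Longrightarrow> vrel f d e x y \<Longrightarrow> frel f d e (A x) (A y)) \<Longrightarrow> natural A"
  by (simp add: natural_def)

lemma natural2I:
  "(\<And>f d e x x' y y'. shifts f d e \<Longrightarrow> vrel f d e x x' \<Longrightarrow> vrel f d e y y' \<Longrightarrow> frel f d e (A x y) (A x' y')) \<Longrightarrow>
    natural2 A"
  by (simp add: natural2_def)

text \<open>\<open>inst a\<close> takes depth 1 to depth 0, fixes the parameters, and sends the
  variable bound at depth 0 to \<open>K a\<close>.\<close>

lemma natural_inst:
  assumes "natural A"
  shows "fren (inst a) (A (\<lambda>d'. d' - 0 - 1) (Suc 0)) = A (K a) 0"
proof -
  have "shifts (inst a) 1 0" by (simp add: shifts_def)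
  moreover have "vrel (inst a) 1 0 (\<lambda>d'. d' - 0 - 1) (K a)" by (simp add: vrel_def K_def up_pow)
  ultimately have "frel (inst a) 1 0 (A (\<lambda>d'. d' - 0 - 1)) (A (K a))"
    using assms unfolding natural_def by blast
  then have "fren ((up ^^ 0) (inst a)) (A (\<lambda>d'. d' - 0 - 1) (1 + 0)) = A (K a) (0 + 0)"
    unfolding frel_def by blast
  then show ?thesis by simp
qed

text \<open>Axiom schemes take raw formulas. At depth 2 the two arguments have the indices 0 and 1
  and parameters start at 2, which is the convention of \<open>happ\<close> for a list of length
  two.\<close>

definition formula2 :: "(hvar \<Rightarrow> hvar \<Rightarrow> hfm) \<Rightarrow> fm" where
  "formula2 A = A (\<lambda>d. d - 2) (\<lambda>d. d - 1) 2"

text \<open>The side conditions say that \<open>x\<close> and \<open>y\<close> are genuine variables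
  from depth \<open>d\<close> on; a bound variable, with its truncated subtraction, meets them only
  inside its own binder.\<close>

lemma happ_formula2:
  assumes "natural2 A" and "\<And>k. x (d + k) = x d + k" and "\<And>k. y (d + k) = y d + k"
  shows "((formula2 A)\<^bold>[[x, y]\<^bold>]) d = A x y d"
proof -
  define f where "f i = (if i < length [x, y] then ([x, y] ! i) d else d + (i - length [x, y]))" for i
  have "shifts f 2 d" by (simp add: shifts_def f_def)
  moreover have "vrel f 2 d (\<lambda>d. d - 2) x" by (simp add: vrel_def f_def up_pow assms(2))
  moreover have "vrel f 2 d (\<lambda>d. d - 1) y" by (simp add: vrel_def f_def up_pow assms(3))
  ultimately have "frel f 2 d (A (\<lambda>d. d - 2) (\<lambda>d. d - 1)) (A x y)"
    using assms(1) unfolding natural2_def by blast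
  then have "fren ((up ^^ 0) f) (A (\<lambda>d. d - 2) (\<lambda>d. d - 1) (2 + 0)) = A x y (d + 0)"
    unfolding frel_def by blast
  then have "fren f (formula2 A) = A x y d" by (simp add: formula2_def)
  then show ?thesis by (simp only: happ_def f_def[abs_def])
qed

text \<open>The indices 0, 1 and 2 stand for argument, value and graph, the order in which subset
  collection supplies them.\<close>

definition maps_to_fm :: fm where
  "maps_to_fm = maps_to (\<lambda>d. d - 1) (\<lambda>d. d - 3) (\<lambda>d. d - 2) 3"

lemma happ_maps_to_fm:
  assumes "\<And>k. x (d + k) = x d + k" and "\<And>k. y (d + k) = y d + k" and "\<And>k. u (d + k) = u d + k"
  shows "(maps_to_fm\<^bold>[[x, y, u]\<^bold>]) d = maps_to u x y d"
proof -
  define f where "f i = (if i < length [x, y, u] then ([x, y, u] ! i) d else d + (i - length [x, y, u]))" for i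
  have "vrel f 3 d (\<lambda>d. d - 3) x" by (simp add: vrel_def f_def up_pow assms)
  moreover have "vrel f 3 d (\<lambda>d. d - 2) y" by (simp add: vrel_def f_def up_pow assms)
  moreover have "vrel f 3 d (\<lambda>d. d - 1) u" by (simp add: vrel_def f_def up_pow assms numeral_2_eq_2)
  ultimately have "frel f 3 d (maps_to (\<lambda>d. d - 1) (\<lambda>d. d - 3) (\<lambda>d. d - 2)) (maps_to u x y)"
    by (intro frel_maps_to)
  then have "fren ((up ^^ 0) f) (maps_to (\<lambda>d. d - 1) (\<lambda>d. d - 3) (\<lambda>d. d - 2) (3 + 0)) = maps_to u x y (d + 0)"
    unfolding frel_def by blast
  then have "fren f maps_to_fm = maps_to u x y d" by (simp add: maps_to_fm_def)
  then show ?thesis by (simp only: happ_def f_def[abs_def])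
qed

subsection \<open>Truth in saturated sets\<close>

text \<open>Truth in \<open>H\<close> is derivability from \<open>H\<close>. For saturated
  \<open>H\<close> it behaves classically on conjunction, disjunction and existence.\<close>

definition holds :: "fm set \<Rightarrow> hfm \<Rightarrow> bool" (infix "\<models>" 40) where
  "H \<models> A \<longleftrightarrow> H \<turnstile> A 0"

abbreviation mem :: "fm set \<Rightarrow> nat \<Rightarrow> nat \<Rightarrow> bool" where
  "mem H x y \<equiv> H \<models> K x \<^bold>\<in> K y"
abbreviation sub :: "fm set \<Rightarrow> nat \<Rightarrow> nat \<Rightarrow> bool" where
  "sub H x y \<equiv> H \<models> K x \<^bold>\<subseteq> K y"
abbreviation eqv :: "fm set \<Rightarrow> nat \<Rightarrow> nat \<Rightarrow> bool" where
  "eqv H x y \<equiv> H \<models> K x \<^bold>= K y"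

definition model :: "fm set \<Rightarrow> fm set \<Rightarrow> bool" where
  "model T H \<longleftrightarrow> (\<forall>p\<in>T. fv p = {}) \<and> T \<subseteq> H \<and> saturated H"

lemma holds_hAnd: "H \<models> A \<^bold>\<and> B \<longleftrightarrow> H \<models> A \<and> H \<models> B"
  by (auto simp: holds_def hAnd_def intro: nd.AndI dest: nd.AndE1 nd.AndE2)

lemma holds_hOr: "model T H \<Longrightarrow> H \<models> A \<^bold>\<or> B \<longleftrightarrow> H \<models> A \<or> H \<models> B"
  by (auto simp: holds_def hOr_def model_def saturated_def intro: nd.OrI1 nd.OrI2)

lemma holds_hImpD: "H \<models> A \<^bold>\<longrightarrow> B \<Longrightarrow> H \<models> A \<Longrightarrow> H \<models> B"
  by (auto simp: holds_def hImp_def intro: nd.ImpE)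

lemma holds_hIffD: "H \<models> A \<^bold>\<longleftrightarrow> B \<Longrightarrow> (H \<models> A) = (H \<models> B)"
  by (auto simp: hIff_def holds_hAnd dest: holds_hImpD)

lemma holds_hBotD: "H \<models> \<^bold>\<bottom> \<Longrightarrow> H \<models> A"
  by (auto simp: holds_def hBot_def intro: nd.BotE)

lemma holds_hEq_refl: "eqv H x x"
  by (simp add: holds_def hEq_def nd.EqI)

lemma holds_hAllD: "H \<models> (\<^bold>\<forall>x. A x) \<Longrightarrow> natural A \<Longrightarrow> H \<models> A (K v)"
  unfolding holds_def hAll_def by (drule nd.AllE[of H _ v]) (simp only: natural_inst)

lemma holds_hEx:
  assumes "model T H" and "natural A"
  shows "H \<models> (\<^bold>\<exists>x. A x) \<longleftrightarrow> (\<exists>v. H \<models> A (K v))"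
proof -
  let ?A = "A (\<lambda>d'. d' - 0 - 1) (Suc 0)"
  have "H \<turnstile> Ex ?A \<longleftrightarrow> (\<exists>v. H \<turnstile> fren (inst v) ?A)"
    using assms(1) unfolding model_def saturated_def by (blast intro: nd.ExI)
  then show ?thesis unfolding holds_def hEx_def natural_inst[OF assms(2)] .
qed

lemma holds_subst:
  assumes "eqv H x y" and "natural A" and "H \<models> A (K x)"
  shows "H \<models> A (K y)"
proof -
  have "H \<turnstile> Eq x y" using assms(1) by (simp add: holds_def hEq_def K_def)
  from nd.EqE[OF this, of "A (\<lambda>d'. d' - 0 - 1) (Suc 0)"] show ?thesis
    using assms(3) unfolding holds_def natural_inst[OF assms(2)] by blast
qed

text \<open>The contrapositive of saturation: an underivable \<open>q\<close> fails in some model of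
  the facts \<open>G\<close> and the formulas \<open>F\<close>. The facts in \<open>G\<close> are
  those carried over from the model at hand.\<close>

lemma model_complete:
  assumes "model T H" and "finite G" and "\<And>A. A \<in> G \<Longrightarrow> H \<models> A"
    and "\<And>H'. model T H' \<Longrightarrow> (\<And>A. A \<in> G \<Longrightarrow> H' \<models> A) \<Longrightarrow> (\<And>p. p \<in> F \<Longrightarrow> H' \<turnstile> p) \<Longrightarrow> H' \<turnstile> q"
    and "finite F"
  shows "T \<union> ((\<lambda>A. A 0) ` G \<union> F) \<turnstile> q"
proof (rule ccontr)
  assume n: "\<not> ?thesis"
  have T: "\<forall>p\<in>T. fv p = {}" using assms(1) by (simp add: model_def)
  obtain H' where H': "T \<union> ((\<lambda>A. A 0) ` G \<union> F) \<subseteq> H'" "saturated H'" "\<not> H' \<turnstile> q"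
    using saturation[OF T _ n] assms(2,5) by blast
  then have "H' \<turnstile> q" using T by (intro assms(4)) (auto simp: model_def holds_def intro!: nd.Hyp)
  with H'(3) show False by blast
qed

lemma holds_cut:
  assumes "model T H" and "finite G" and "\<And>A. A \<in> G \<Longrightarrow> H \<models> A" and "T \<union> (\<lambda>A. A 0) ` G \<turnstile> q"
  shows "H \<turnstile> q"
proof (rule nd_cut)
  show "H \<union> (\<lambda>A. A 0) ` G \<turnstile> q"
    using assms(1) by (intro nd_weaken[OF assms(4)]) (auto simp: model_def)
qed (use assms(2,3) in \<open>auto simp: holds_def\<close>)

text \<open>Only finitely many facts can be kept when passing to an extension, since the bound variable
  has to become a variable not occurring in them.\<close>

lemma holds_hImpI:
  assumes "model T H" and "finite G" and "\<And>A. A \<in> G \<Longrightarrow> H \<models> A"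
    and "\<And>H'. model T H' \<Longrightarrow> (\<And>A. A \<in> G \<Longrightarrow> H' \<models> A) \<Longrightarrow> H' \<models> A \<Longrightarrow> H' \<models> B"
  shows "H \<models> A \<^bold>\<longrightarrow> B"
proof -
  have "T \<union> ((\<lambda>A. A 0) ` G \<union> {A 0}) \<turnstile> B 0"
    by (rule model_complete[OF assms(1-3)]) (use assms(4) in \<open>auto simp: holds_def\<close>)
  then have "T \<union> (\<lambda>A. A 0) ` G \<turnstile> Imp (A 0) (B 0)"
    by (intro nd.ImpI) simp
  from holds_cut[OF assms(1-3) this] show ?thesis by (simp add: holds_def hImp_def)
qed

text \<open>Choose \<open>x\<close> fresh for the body and for \<open>G\<close>. Validity of the
  body at \<open>x\<close> in all models of \<open>G\<close> gives a derivation from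
  \<open>T\<close> and \<open>G\<close>, which is generalised over \<open>x\<close> and then cut
  against \<open>H\<close>.\<close>

lemma holds_hAllI:
  assumes "model T H" and "natural A" and "finite G" and "\<And>B. B \<in> G \<Longrightarrow> H \<models> B"
    and "\<And>H' x. model T H' \<Longrightarrow> (\<And>B. B \<in> G \<Longrightarrow> H' \<models> B) \<Longrightarrow> H' \<models> A (K x)"
  shows "H \<models> (\<^bold>\<forall>x. A x)"
proof -
  let ?A = "A (\<lambda>d'. d' - 0 - 1) (Suc 0)"
  obtain x where x: "\<And>q. q \<in> T \<union> insert (All ?A) ((\<lambda>A. A 0) ` G) \<Longrightarrow> x \<notin> fv q"
    using obtain_fresh[of T "insert (All ?A) ((\<lambda>A. A 0) ` G)"] assms(1,3) by (auto simp: model_def)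
  have "T \<union> ((\<lambda>A. A 0) ` G \<union> {}) \<turnstile> A (K x) 0"
    by (rule model_complete[OF assms(1,3,4)]) (use assms(5) in \<open>auto simp: holds_def\<close>)
  then have "T \<union> (\<lambda>A. A 0) ` G \<turnstile> fren (inst x) ?A" by (simp only: natural_inst[OF assms(2)]) simp
  then have "T \<union> (\<lambda>A. A 0) ` G \<turnstile> All ?A"
    by (rule nd_AllI_fresh) (use x x[of "All ?A"] in blast)+
  from holds_cut[OF assms(1,3,4) this] show ?thesis by (simp add: holds_def hAll_def)
qed

text \<open>An instance of a scheme may contain parameters, while the theory contains only its
  closures. Some closure has sufficiently many quantifiers, and these are stripped again.\<close>

lemma holds_closure:
  assumes "closures X \<subseteq> T" and "A \<in> X" and "model T H"
  shows "H \<models> A"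
proof -
  have T: "\<forall>p\<in>T. fv p = {}" using assms(3) by (simp add: model_def)
  have fv_Alls: "fv ((All ^^ n) q) = {i. i + n \<in> fv q}" for n q
    by (induction n) auto
  obtain n where n: "\<And>i. i \<in> fv (A 0) \<Longrightarrow> i < n"
    using finite_fv[of "A 0"] by (meson finite_nat_set_iff_bounded)
  have "fv ((All ^^ n) (A 0)) = {}" unfolding fv_Alls using n by fastforce
  then have "(All ^^ n) (A 0) \<in> closures X" using assms(2) by (auto simp: closures_def)
  then have "T \<turnstile> (All ^^ n) (A 0)" using assms(1) by (blast intro: nd.Hyp)
  \<comment> \<open>A quantifier is removed without renaming anything: shift the other variables up,
    then instantiate with variable 0; the composite renaming is the identity. Closedness of
    \<open>T\<close> keeps the hypotheses unchanged.\<close>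
  moreover have "T \<turnstile> q" if "T \<turnstile> All q" for q
  proof -
    have "fren Suc ` T = T"
    proof -
      have "fren Suc p = p" if "p \<in> T" for p using T that by (intro fren_id) auto
      then show ?thesis by force
    qed
    then have "T \<turnstile> All (fren (up Suc) q)" using nd_rename[OF that, of Suc] by simp
    then have "T \<turnstile> fren (inst 0) (fren (up Suc) q)" by (rule nd.AllE)
    moreover have "(inst 0 \<circ> up Suc) i = i" for i by (cases i) auto
    ultimately show ?thesis by (simp add: fren_fren fren_id)
  qed
  ultimately have "T \<turnstile> A 0" by (induction n) auto
  then show ?thesis using assms(3) nd_weaken unfolding holds_def model_def by blast
qed

subsection \<open>Covers in set theory\<close>

lemma holds_all_sets_hIffI:
  assumes "model T H" and "natural A" and "natural B" and "finite G" and "\<forall>C\<in>G. H \<models> C"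
    and "\<And>H' x. model T H' \<Longrightarrow> \<forall>C\<in>G. H' \<models> C \<Longrightarrow> (H' \<models> A (K x)) = (H' \<models> B (K x))"
  shows "H \<models> (\<^bold>\<forall>x. A x \<^bold>\<longleftrightarrow> B x)"
proof (rule holds_hAllI[OF assms(1) _ assms(4)])
  show "natural (\<lambda>x. A x \<^bold>\<longleftrightarrow> B x)"
    using assms(2,3) by (auto simp: natural_def intro: frel_hIff)
  fix H' x assume H': "model T H'" "\<And>C. C \<in> G \<Longrightarrow> H' \<models> C"
  show "H' \<models> A (K x) \<^bold>\<longleftrightarrow> B (K x)"
    unfolding hIff_def holds_hAnd
    by (intro conjI; rule holds_hImpI[OF H'(1) assms(4) H'(2)]) (use assms(6) in blast)+
qed (use assms(5) in blast)

lemma holds_all_sets_hImpI: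
  assumes "model T H" and "natural A" and "natural B" and "finite G" and "\<forall>C\<in>G. H \<models> C"
    and "\<And>H' x. model T H' \<Longrightarrow> \<forall>C\<in>G. H' \<models> C \<Longrightarrow> H' \<models> A (K x) \<Longrightarrow> H' \<models> B (K x)"
  shows "H \<models> (\<^bold>\<forall>x. A x \<^bold>\<longrightarrow> B x)"
proof (rule holds_hAllI[OF assms(1) _ assms(4)])
  show "natural (\<lambda>x. A x \<^bold>\<longrightarrow> B x)"
    using assms(2,3) by (auto simp: natural_def intro: frel_hImp)
  fix H' x assume H': "model T H'" "\<And>C. C \<in> G \<Longrightarrow> H' \<models> C"
  show "H' \<models> A (K x) \<^bold>\<longrightarrow> B (K x)"
    by (rule holds_hImpI[OF H'(1) assms(4) H'(2)]) (use assms(6) in blast)+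
qed (use assms(5) in blast)

lemma holds_hExE:
  assumes "model T H" and "H \<models> (\<^bold>\<exists>x. A x)" and "natural A" and "\<And>v. H \<models> A (K v) \<Longrightarrow> P"
  shows P
  using assms holds_hEx by blast

text \<open>Equality and membership are arbitrary relations \<open>e\<close> and \<open>m\<close>
  here because those of a model are derivability of formulas. The case \<open>e b a'\<close> makes
  all four components equal; otherwise \<open>e b b'\<close> is immediate.\<close>

lemma kuratowski_snd:
  fixes e m :: "nat \<Rightarrow> nat \<Rightarrow> bool"
  assumes 1: "\<And>v. m v q = e v a" "\<And>v. m v r = (e v a \<or> e v b)" "\<And>v. m v p = (e v q \<or> e v r)"
    and 2: "\<And>v. m v q' = e v a'" "\<And>v. m v r' = (e v a' \<or> e v b')" "\<And>v. m v p = (e v q' \<or> e v r')"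
    and refl: "\<And>x. e x x" and sym: "\<And>x y. e x y \<Longrightarrow> e y x" and eq: "\<And>x y z. e x y \<Longrightarrow> e x z \<Longrightarrow> e y z"
    and mem: "\<And>x y z. e x y \<Longrightarrow> m z x \<Longrightarrow> m z y"
  shows "e b b'"
proof -
  have "e q q' \<or> e q r'" using 1(3)[of q] 2(3)[of q] refl by blast
  then have "m a' q" using 2(1,2)[of a'] refl sym mem by metis
  then have aa': "e a a'" using 1(1) sym by blast
  have "e r q' \<or> e r r'" using 1(3)[of r] 2(3)[of r] refl by blast
  then have "e b a' \<or> e b b'" using 1(2)[of b] 2(1,2)[of b] refl mem by metis
  then show ?thesis
  proof
    assume ba': "e b a'"
    have "e r' q \<or> e r' r" using 1(3)[of r'] 2(3)[of r'] refl by blast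
    then have "e b' a \<or> e b' b" using 1(1,2)[of b'] 2(2)[of b'] refl mem by metis
    then show ?thesis using aa' ba' eq sym by metis
  qed
qed

text \<open>To be used with the given theory extended by uniformity. The cover is parameter-free;
  the set of the space is kept as a variable \<open>s\<close> of the model.\<close>

locale czf_theory =
  fixes T :: "fm set" and c :: fm
  assumes CZF: "CZF \<subseteq> T" and GUP: "GUP_CZF \<subseteq> T" and fv_cover: "fv c \<subseteq> {0, 1}"
begin

lemmas frel_cover = frel_cov[OF fv_cover]

lemma frel_covs: "vrel f d e x x' \<Longrightarrow> vrel f d e y y' \<Longrightarrow> frel f d e (covs c x y) (covs c x' y')"
  unfolding covs_def by (assumption | rule frel_sets frel_cover)+

lemma frel_cov_sing: "vrel f d e x x' \<Longrightarrow> vrel f d e y y' \<Longrightarrow> frel f d e (cov_sing c x y) (cov_sing c x' y')"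
  unfolding cov_sing_def by (assumption | rule frel_sets frel_cover)+

lemma frel_covs_empty: "vrel f d e x x' \<Longrightarrow> frel f d e (covs_empty c x) (covs_empty c x')"
  unfolding covs_empty_def by (assumption | rule frel_sets frel_covs)+

lemma frel_is_down:
  "vrel f d e s s' \<Longrightarrow> vrel f d e x x' \<Longrightarrow> vrel f d e y y' \<Longrightarrow> vrel f d e z z' \<Longrightarrow>
    frel f d e (is_down c s x y z) (is_down c s' x' y' z')"
  unfolding is_down_def by (assumption | rule frel_sets frel_cov_sing)+

lemma frel_is_pseudocompl:
  "vrel f d e s s' \<Longrightarrow> vrel f d e x x' \<Longrightarrow> vrel f d e y y' \<Longrightarrow>
    frel f d e (is_pseudocompl c s x y) (is_pseudocompl c s' x' y')"
  unfolding is_pseudocompl_def by (assumption | rule frel_sets frel_is_down frel_covs_empty)+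

lemmas frel_space = frel_sets frel_cover frel_covs frel_cov_sing frel_covs_empty frel_is_down frel_is_pseudocompl

lemmas natural_space = naturalI frel_space

section \<open>Set-theoretic formulas read as statements about a model\<close>

lemma holds_hsubD: "sub H x y \<Longrightarrow> mem H v x \<Longrightarrow> mem H v y"
  unfolding hsub_def
  by (rule holds_hImpD, erule holds_hAllD[of H _ v])
    (assumption | rule natural_space)+

lemma holds_is_emptyD: "H \<models> is_empty (K x) \<Longrightarrow> mem H v x \<Longrightarrow> H \<models> A"
  unfolding is_empty_def
  by (rule holds_hBotD, rule holds_hImpD, erule holds_hAllD[of H _ v])
    (assumption | rule natural_space)+

lemma holds_is_singD: "H \<models> is_sing (K z) (K a) \<Longrightarrow> (mem H v z) = (eqv H v a)"
  unfolding is_sing_def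
  by (rule holds_hIffD, erule holds_hAllD[of H _ v])
    (assumption | rule natural_space)+

lemma holds_is_pairD: "model T H \<Longrightarrow> H \<models> is_pair (K z) (K a) (K b) \<Longrightarrow>
    (mem H v z) = (eqv H v a \<or> eqv H v b)"
  unfolding is_pair_def
  by (subst holds_hOr[symmetric], assumption, rule holds_hIffD, erule holds_hAllD[of H _ v])
    (assumption | rule natural_space)+

lemma holds_is_unionD: "model T H \<Longrightarrow> H \<models> is_union (K z) (K a) (K b) \<Longrightarrow>
    (mem H v z) = (mem H v a \<or> mem H v b)"
  unfolding is_union_def
  by (subst holds_hOr[symmetric], assumption, rule holds_hIffD, erule holds_hAllD[of H _ v])
    (assumption | rule natural_space)+

lemma holds_is_succD: "model T H \<Longrightarrow> H \<models> is_succ (K y) (K x) \<Longrightarrow>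
    (mem H v y) = (mem H v x \<or> eqv H v x)"
  unfolding is_succ_def
  by (subst holds_hOr[symmetric], assumption, rule holds_hIffD, erule holds_hAllD[of H _ v])
    (assumption | rule natural_space)+

lemma holds_covsD: "H \<models> covs c (K x) (K y) \<Longrightarrow> mem H v x \<Longrightarrow> H \<models> cov c (K v) (K y)"
  unfolding covs_def
  by (rule holds_hImpD, erule holds_hAllD[of H _ v])
    (assumption | rule natural_space)+

lemma holds_cov_sing: "model T H \<Longrightarrow>
    H \<models> cov_sing c (K d) (K u) \<longleftrightarrow> (\<exists>z. H \<models> is_sing (K z) (K u) \<and> H \<models> cov c (K d) (K z))"
  unfolding cov_sing_def
  by (subst holds_hEx) (assumption | rule natural_space | simp add: holds_hAnd)+

lemma holds_covs_empty: "model T H \<Longrightarrow>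
    H \<models> covs_empty c (K U) \<longleftrightarrow> (\<exists>z. H \<models> is_empty (K z) \<and> H \<models> covs c (K U) (K z))"
  unfolding covs_empty_def
  by (subst holds_hEx) (assumption | rule natural_space | simp add: holds_hAnd)+

lemma holds_is_downD:
  assumes "model T H" and "H \<models> is_down c (K s) (K D) (K U) (K V)"
  shows "mem H d D \<longleftrightarrow> mem H d s \<and> (\<exists>u. mem H u U \<and> H \<models> cov_sing c (K d) (K u)) \<and>
    (\<exists>v. mem H v V \<and> H \<models> cov_sing c (K d) (K v))"
proof -
  have ex: "H \<models> (\<^bold>\<exists>u. u \<^bold>\<in> K X \<^bold>\<and> cov_sing c (K d) u) \<longleftrightarrow> (\<exists>u. mem H u X \<and> H \<models> cov_sing c (K d) (K u))" for X
    by (subst holds_hEx[OF assms(1)]) (assumption | rule natural_space | simp add: holds_hAnd)+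
  have "(mem H d D) = (H \<models> K d \<^bold>\<in> K s \<^bold>\<and> (\<^bold>\<exists>u. u \<^bold>\<in> K U \<^bold>\<and> cov_sing c (K d) u) \<^bold>\<and> (\<^bold>\<exists>u. u \<^bold>\<in> K V \<^bold>\<and> cov_sing c (K d) u))"
    by (rule holds_hIffD, rule holds_hAllD[OF assms(2)[unfolded is_down_def]])
      (assumption | rule natural_space)+
  then show ?thesis by (simp only: holds_hAnd ex)
qed

lemma holds_is_pseudocomplD:
  assumes "model T H" and "H \<models> is_pseudocompl c (K s) (K V) (K U)"
  shows "mem H a V \<longleftrightarrow> mem H a s \<and>
    (\<exists>z D. H \<models> is_sing (K z) (K a) \<and> H \<models> is_down c (K s) (K D) (K z) (K U) \<and> H \<models> covs_empty c (K D))"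
proof -
  have 1: "H \<models> (\<^bold>\<exists>D. is_sing (K z) (K a) \<^bold>\<and> is_down c (K s) D (K z) (K U) \<^bold>\<and> covs_empty c D) \<longleftrightarrow>
      (\<exists>D. H \<models> is_sing (K z) (K a) \<and> H \<models> is_down c (K s) (K D) (K z) (K U) \<and> H \<models> covs_empty c (K D))" for z
    by (subst holds_hEx[OF assms(1)]) (assumption | rule natural_space | simp add: holds_hAnd)+
  have 2: "H \<models> (\<^bold>\<exists>z. \<^bold>\<exists>D. is_sing z (K a) \<^bold>\<and> is_down c (K s) D z (K U) \<^bold>\<and> covs_empty c D) \<longleftrightarrow>
      (\<exists>z D. H \<models> is_sing (K z) (K a) \<and> H \<models> is_down c (K s) (K D) (K z) (K U) \<and> H \<models> covs_empty c (K D))"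
    by (subst holds_hEx[OF assms(1)]) (assumption | rule natural_space | simp only: 1)+
  have "(mem H a V) = (H \<models> K a \<^bold>\<in> K s \<^bold>\<and>
     (\<^bold>\<exists>z. \<^bold>\<exists>D. is_sing z (K a) \<^bold>\<and> is_down c (K s) D z (K U) \<^bold>\<and> covs_empty c D))"
    by (rule holds_hIffD, rule holds_hAllD[OF assms(2)[unfolded is_pseudocompl_def]])
      (assumption | rule natural_space)+
  then show ?thesis by (simp only: holds_hAnd 2)
qed

lemma holds_hsubI:
  assumes "model T H" and "finite G" and "\<forall>C\<in>G. H \<models> C"
    and "\<And>H' v. model T H' \<Longrightarrow> \<forall>C\<in>G. H' \<models> C \<Longrightarrow> mem H' v x \<Longrightarrow> mem H' v y"
  shows "sub H x y"
  unfolding hsub_def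
  by (rule holds_all_sets_hImpI[OF assms(1) _ _ assms(2,3)], (assumption | rule natural_space)+,
      rule assms(4))

lemma holds_covsI:
  assumes "model T H" and "finite G" and "\<forall>C\<in>G. H \<models> C"
    and "\<And>H' v. model T H' \<Longrightarrow> \<forall>C\<in>G. H' \<models> C \<Longrightarrow> mem H' v x \<Longrightarrow> H' \<models> cov c (K v) (K y)"
  shows "H \<models> covs c (K x) (K y)"
  unfolding covs_def
  by (rule holds_all_sets_hImpI[OF assms(1) _ _ assms(2,3)], (assumption | rule natural_space)+,
      rule assms(4))

lemma formal_space_refl:
  assumes fs: "H \<models> formal_space c (K s)" and p: "mem H a s" "sub H U s" "mem H a U"
  shows "H \<models> cov c (K a) (K U)"
proof -
  note 0 = fs[unfolded formal_space_def holds_hAnd, THEN conjunct1]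
  let ?P = "\<lambda>a U. a \<^bold>\<in> K s \<^bold>\<and> U \<^bold>\<subseteq> K s \<^bold>\<and> a \<^bold>\<in> U \<^bold>\<longrightarrow> cov c a U"
  have "H \<models> (\<^bold>\<forall>U. ?P (K a) U)" using 0 by (rule holds_hAllD) (assumption | rule natural_space)+
  then have "H \<models> ?P (K a) (K U)" by (rule holds_hAllD) (assumption | rule natural_space)+
  then show ?thesis by (rule holds_hImpD) (simp add: p holds_hAnd)
qed

lemma formal_space_trans:
  assumes fs: "H \<models> formal_space c (K s)"
    and p: "mem H a s" "sub H U s" "sub H V s" "H \<models> cov c (K a) (K U)" "H \<models> covs c (K U) (K V)"
  shows "H \<models> cov c (K a) (K V)"
proof -
  note 0 = fs[unfolded formal_space_def holds_hAnd, THEN conjunct2, THEN conjunct1]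
  let ?P = "\<lambda>a U V. a \<^bold>\<in> K s \<^bold>\<and> U \<^bold>\<subseteq> K s \<^bold>\<and> V \<^bold>\<subseteq> K s \<^bold>\<and> cov c a U \<^bold>\<and> covs c U V \<^bold>\<longrightarrow> cov c a V"
  have "H \<models> (\<^bold>\<forall>U. \<^bold>\<forall>V. ?P (K a) U V)" using 0 by (rule holds_hAllD) (assumption | rule natural_space)+
  then have "H \<models> (\<^bold>\<forall>V. ?P (K a) (K U) V)" by (rule holds_hAllD) (assumption | rule natural_space)+
  then have "H \<models> ?P (K a) (K U) (K V)" by (rule holds_hAllD) (assumption | rule natural_space)+
  then show ?thesis by (rule holds_hImpD) (simp add: p holds_hAnd)
qed

lemma eq_mem:
  assumes "eqv H x y" and "mem H x z"
  shows "mem H y z"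
  by (rule holds_subst[where A="\<lambda>x. x \<^bold>\<in> K z", OF assms(1) _ assms(2)]) (assumption | rule natural_space)+

lemma mem_eq:
  assumes "eqv H x y" and "mem H z x"
  shows "mem H z y"
  by (rule holds_subst[where A="\<lambda>x. K z \<^bold>\<in> x", OF assms(1) _ assms(2)]) (assumption | rule natural_space)+

lemma eq_eq:
  assumes "eqv H x y" and "eqv H x z"
  shows "eqv H y z"
  by (rule holds_subst[where A="\<lambda>x. x \<^bold>= K z", OF assms(1) _ assms(2)]) (assumption | rule natural_space)+

lemma eq_sym: "eqv H x y \<Longrightarrow> eqv H y x"
  using eq_eq[of H x y x] holds_hEq_refl[of H x] by blast

lemma holds_is_emptyI:
  assumes "model T H" and "finite G" and "\<forall>C\<in>G. H \<models> C"
    and "\<And>H' v. model T H' \<Longrightarrow> \<forall>C\<in>G. H' \<models> C \<Longrightarrow> mem H' v x \<Longrightarrow> H' \<models> \<^bold>\<bottom>"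
  shows "H \<models> is_empty (K x)"
  unfolding is_empty_def
  by (rule holds_all_sets_hImpI[OF assms(1) _ _ assms(2,3)], (assumption | rule natural_space)+,
      rule assms(4))

lemma axiom: "A \<in> {extensionality, pairing, union_set, strong_infinity}
     \<union> {set_induction p | p. True} \<union> {separation p | p. bounded p}
     \<union> {strong_collection p | p. True} \<union> {subset_collection p | p. True} \<Longrightarrow> model T H \<Longrightarrow> H \<models> A"
  by (rule holds_closure[OF CZF[unfolded CZF_def]])

lemma singleton_exists:
  assumes m: "model T H"
  shows "\<exists>z. H \<models> is_sing (K z) (K a)"
proof -
  have "H \<models> pairing" by (rule axiom[OF _ m]) simp
  then have "H \<models> (\<^bold>\<forall>b. \<^bold>\<exists>c. is_pair c (K a) b)"
    unfolding pairing_def by (rule holds_hAllD) (assumption | rule natural_space)+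
  then have "H \<models> (\<^bold>\<exists>c. is_pair c (K a) (K a))"
    by (rule holds_hAllD) (assumption | rule natural_space)+
  then obtain z where z: "H \<models> is_pair (K z) (K a) (K a)"
    by (rule holds_hExE[OF m]) (assumption | rule natural_space)+
  have "H \<models> is_sing (K z) (K a)"
    unfolding is_sing_def
    by (rule holds_all_sets_hIffI[OF m, of _ _ "{is_pair (K z) (K a) (K a)}"])
      (assumption | rule natural_space | use z in \<open>simp add: holds_is_pairD\<close>)+
  then show ?thesis ..
qed

lemma cov_sing_refl:
  assumes m: "model T H" and fs: "H \<models> formal_space c (K s)" and a: "mem H a s"
  shows "H \<models> cov_sing c (K a) (K a)"
proof -
  obtain z where z: "H \<models> is_sing (K z) (K a)" using singleton_exists[OF m] by blast
  have "sub H z s"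
    by (rule holds_hsubI[OF m, where G="{is_sing (K z) (K a), K a \<^bold>\<in> K s}"])
      (use z a in \<open>auto simp: holds_is_singD intro: eq_mem[OF eq_sym]\<close>)
  then have "H \<models> cov c (K a) (K z)"
    by (rule formal_space_refl[OF fs a]) (simp add: holds_is_singD[OF z] holds_hEq_refl)
  then show ?thesis using z holds_cov_sing[OF m] by blast
qed

section \<open>Pseudocomplements\<close>

lemma is_pseudocompl_sub:
  assumes m: "model T H" and V: "H \<models> is_pseudocompl c (K s) (K V) (K U)"
  shows "sub H V s"
  by (rule holds_hsubI[OF m, where G="{is_pseudocompl c (K s) (K V) (K U)}"])
    (use V in \<open>auto simp: holds_is_pseudocomplD\<close>)

lemma is_union_sub:
  assumes m: "model T H" and "H \<models> is_union (K X) (K W) (K V)" and "sub H W s" and "sub H V s"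
  shows "sub H X s"
  by (rule holds_hsubI[OF m, where G="{is_union (K X) (K W) (K V), K W \<^bold>\<subseteq> K s, K V \<^bold>\<subseteq> K s}"])
    (use assms in \<open>auto simp: holds_is_unionD dest: holds_hsubD\<close>)

text \<open>The point \<open>y\<close> is covered by \<open>{y}\<close>, so it lies itself in the
  meet of \<open>{y}\<close> with \<open>U\<close>, and that meet is covered by the empty
  set.\<close>

lemma covered_by_empty:
  assumes m: "model T H" and fs: "H \<models> formal_space c (K s)"
    and V: "H \<models> is_pseudocompl c (K s) (K V) (K U)" and y: "mem H y V" "mem H y U"
  shows "\<exists>z. H \<models> is_empty (K z) \<and> H \<models> cov c (K y) (K z)"
proof -
  have ys: "mem H y s" using holds_is_pseudocomplD[OF m V] y by blast
  obtain z D where z: "H \<models> is_sing (K z) (K y)" and D: "H \<models> is_down c (K s) (K D) (K z) (K U)"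
    and E: "H \<models> covs_empty c (K D)" using holds_is_pseudocomplD[OF m V] y by blast
  have "mem H y z" by (simp add: holds_is_singD[OF z] holds_hEq_refl)
  then have "mem H y D"
    using holds_is_downD[OF m D] ys y cov_sing_refl[OF m fs ys] by blast
  then show ?thesis using E holds_covs_empty[OF m] holds_covsD by blast
qed

text \<open>The meet of anything with the empty \<open>U\<close> is empty, so \<open>U\<close>
  serves both as the meet \<open>D\<close> and as the empty set that covers it.\<close>

lemma pseudocompl_of_empty:
  assumes m: "model T H" and V: "H \<models> is_pseudocompl c (K s) (K V) (K U)"
    and U: "H \<models> is_empty (K U)" and y: "mem H y s"
  shows "mem H y V"
proof -
  obtain z where z: "H \<models> is_sing (K z) (K y)" using singleton_exists[OF m] by blast
  have nat: "natural (\<lambda>d. d \<^bold>\<in> K U)"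
    "natural (\<lambda>d. d \<^bold>\<in> K s \<^bold>\<and> (\<^bold>\<exists>u. u \<^bold>\<in> K z \<^bold>\<and> cov_sing c d u) \<^bold>\<and> (\<^bold>\<exists>v. v \<^bold>\<in> K U \<^bold>\<and> cov_sing c d v))"
    by (assumption | rule natural_space)+
  have "H \<models> is_down c (K s) (K U) (K z) (K U)"
    unfolding is_down_def
  proof (rule holds_all_sets_hIffI[OF m nat, of "{is_empty (K U)}"])
    fix H' d assume m': "model T H'" and "\<forall>C\<in>{is_empty (K U)}. H' \<models> C"
    then have U': "H' \<models> is_empty (K U)" by simp
    have ex: "H' \<models> (\<^bold>\<exists>u. u \<^bold>\<in> K U \<^bold>\<and> cov_sing c (K d) u) \<longleftrightarrow> (\<exists>u. mem H' u U \<and> H' \<models> cov_sing c (K d) (K u))"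
      by (subst holds_hEx[OF m']) (assumption | rule natural_space | simp add: holds_hAnd)+
    show "(mem H' d U) = (H' \<models> K d \<^bold>\<in> K s \<^bold>\<and> (\<^bold>\<exists>u. u \<^bold>\<in> K z \<^bold>\<and> cov_sing c (K d) u) \<^bold>\<and> (\<^bold>\<exists>v. v \<^bold>\<in> K U \<^bold>\<and> cov_sing c (K d) v))"
      using holds_is_emptyD[OF U'] unfolding holds_hAnd ex by blast
  qed (use U in simp_all)
  moreover have "H \<models> covs c (K U) (K U)"
    by (rule holds_covsI[OF m, where G="{is_empty (K U)}"]) (use U in \<open>auto dest: holds_is_emptyD\<close>)
  ultimately show ?thesis
    using holds_is_pseudocomplD[OF m V] y z U holds_covs_empty[OF m] by blast
qed

lemma opair_functional:
  assumes m: "model T H" and "H \<models> is_opair (K p) (K a) (K b)" and "H \<models> is_opair (K p) (K a') (K b')"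
  shows "eqv H b b'"
proof -
  have ex: "\<exists>q r. (\<forall>v. (mem H v q) = (eqv H v a)) \<and>
      (\<forall>v. (mem H v r) = (eqv H v a \<or> eqv H v b)) \<and>
      (\<forall>v. (mem H v p) = (eqv H v q \<or> eqv H v r))"
    if o: "H \<models> is_opair (K p) (K a) (K b)" for a b
  proof -
    obtain q where "H \<models> (\<^bold>\<exists>r. is_sing (K q) (K a) \<^bold>\<and> is_pair r (K a) (K b) \<^bold>\<and> is_pair (K p) (K q) r)"
      using o unfolding is_opair_def
      by (rule holds_hExE[OF m]) (assumption | rule natural_space)+
    then obtain r where "H \<models> is_sing (K q) (K a) \<^bold>\<and> is_pair (K r) (K a) (K b) \<^bold>\<and> is_pair (K p) (K q) (K r)"
      by (rule holds_hExE[OF m]) (assumption | rule natural_space)+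
    then show ?thesis unfolding holds_hAnd using holds_is_singD holds_is_pairD[OF m] by blast
  qed
  obtain q r where 1: "\<And>v. (mem H v q) = (eqv H v a)"
    "\<And>v. (mem H v r) = (eqv H v a \<or> eqv H v b)"
    "\<And>v. (mem H v p) = (eqv H v q \<or> eqv H v r)"
    using ex[OF assms(2)] by blast
  obtain q' r' where 2: "\<And>v. (mem H v q') = (eqv H v a')"
    "\<And>v. (mem H v r') = (eqv H v a' \<or> eqv H v b')"
    "\<And>v. (mem H v p) = (eqv H v q' \<or> eqv H v r')"
    using ex[OF assms(3)] by blast
  show ?thesis
  proof (rule kuratowski_snd[where e="\<lambda>x y. eqv H x y" and m="\<lambda>x y. mem H x y", OF 1 2])
    show "eqv H x x" for x by (rule holds_hEq_refl)
    show "eqv H y x" if "eqv H x y" for x y using that by (rule eq_sym)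
    show "eqv H y z" if "eqv H x y" "eqv H x z" for x y z using that by (rule eq_eq)
    show "mem H z y" if "eqv H x y" "mem H z x" for x y z using that by (rule mem_eq)
  qed
qed

section \<open>Finite enumerations in a model\<close>

lemma holds_maps_to: "model T H \<Longrightarrow>
    H \<models> maps_to (K f) (K i) (K x) \<longleftrightarrow> (\<exists>p. H \<models> is_opair (K p) (K i) (K x) \<and> mem H p f)"
  unfolding maps_to_def
  by (subst holds_hEx) (assumption | rule natural_space | simp add: holds_hAnd)+

lemma surjection_total:
  assumes m: "model T H" and f: "H \<models> is_surjection (K f) (K n) (K u)" and i: "mem H i n"
  shows "\<exists>x. H \<models> maps_to (K f) (K i) (K x) \<and> (\<forall>y. H \<models> maps_to (K f) (K i) (K y) \<longrightarrow> eqv H y x)"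
proof -
  have "H \<models> (\<^bold>\<forall>i. i \<^bold>\<in> K n \<^bold>\<longrightarrow> (\<^bold>\<exists>x. maps_to (K f) i x \<^bold>\<and> (\<^bold>\<forall>y. maps_to (K f) i y \<^bold>\<longrightarrow> y \<^bold>= x)))"
    using f by (simp add: is_surjection_def holds_hAnd)
  then have "H \<models> K i \<^bold>\<in> K n \<^bold>\<longrightarrow> (\<^bold>\<exists>x. maps_to (K f) (K i) x \<^bold>\<and> (\<^bold>\<forall>y. maps_to (K f) (K i) y \<^bold>\<longrightarrow> y \<^bold>= x))"
    by (rule holds_hAllD) (assumption | rule natural_space)+
  then have "H \<models> (\<^bold>\<exists>x. maps_to (K f) (K i) x \<^bold>\<and> (\<^bold>\<forall>y. maps_to (K f) (K i) y \<^bold>\<longrightarrow> y \<^bold>= x))"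
    using i by (rule holds_hImpD)
  then obtain x where x: "H \<models> maps_to (K f) (K i) (K x)" "H \<models> (\<^bold>\<forall>y. maps_to (K f) (K i) y \<^bold>\<longrightarrow> y \<^bold>= K x)"
    by (rule holds_hExE[OF m]) ((assumption | rule natural_space)+, simp only: holds_hAnd, blast)
  have "H \<models> maps_to (K f) (K i) (K y) \<^bold>\<longrightarrow> K y \<^bold>= K x" for y
    using x(2) by (rule holds_hAllD) (assumption | rule natural_space)+
  then show ?thesis using x(1) holds_hImpD by blast
qed

text \<open>The pair witnessing \<open>maps_to\<close> belongs to the graph, hence is also a pair
  with second component in \<open>u\<close>; second components of one pair agree.\<close>

lemma surjection_range:
  assumes m: "model T H" and f: "H \<models> is_surjection (K f) (K n) (K u)"
    and y: "H \<models> maps_to (K f) (K i) (K y)"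
  shows "mem H y u"
proof -
  obtain p where p: "H \<models> is_opair (K p) (K i) (K y)" "mem H p f"
    using y holds_maps_to[OF m] by blast
  have "H \<models> (\<^bold>\<forall>p. p \<^bold>\<in> K f \<^bold>\<longrightarrow> (\<^bold>\<exists>i. \<^bold>\<exists>x. i \<^bold>\<in> K n \<^bold>\<and> x \<^bold>\<in> K u \<^bold>\<and> is_opair p i x))"
    using f by (simp add: is_surjection_def holds_hAnd)
  then have "H \<models> K p \<^bold>\<in> K f \<^bold>\<longrightarrow> (\<^bold>\<exists>i. \<^bold>\<exists>x. i \<^bold>\<in> K n \<^bold>\<and> x \<^bold>\<in> K u \<^bold>\<and> is_opair (K p) i x)"
    by (rule holds_hAllD) (assumption | rule natural_space)+
  then have "H \<models> (\<^bold>\<exists>i. \<^bold>\<exists>x. i \<^bold>\<in> K n \<^bold>\<and> x \<^bold>\<in> K u \<^bold>\<and> is_opair (K p) i x)"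
    using p(2) by (rule holds_hImpD)
  then obtain j where "H \<models> (\<^bold>\<exists>x. K j \<^bold>\<in> K n \<^bold>\<and> x \<^bold>\<in> K u \<^bold>\<and> is_opair (K p) (K j) x)"
    by (rule holds_hExE[OF m]) (assumption | rule natural_space)+
  then obtain x where "mem H x u" "H \<models> is_opair (K p) (K j) (K x)"
    by (rule holds_hExE[OF m]) ((assumption | rule natural_space)+, simp only: holds_hAnd, blast)
  then show ?thesis using opair_functional[OF m _ p(1)] eq_mem by blast
qed

lemma surjection_onto:
  assumes m: "model T H" and f: "H \<models> is_surjection (K f) (K n) (K u)" and x: "mem H x u"
  shows "\<exists>i. mem H i n \<and> H \<models> maps_to (K f) (K i) (K x)"
proof -
  have "H \<models> (\<^bold>\<forall>x. x \<^bold>\<in> K u \<^bold>\<longrightarrow> (\<^bold>\<exists>i. i \<^bold>\<in> K n \<^bold>\<and> maps_to (K f) i x))"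
    using f by (simp add: is_surjection_def holds_hAnd)
  then have "H \<models> K x \<^bold>\<in> K u \<^bold>\<longrightarrow> (\<^bold>\<exists>i. i \<^bold>\<in> K n \<^bold>\<and> maps_to (K f) i (K x))"
    by (rule holds_hAllD) (assumption | rule natural_space)+
  then have "H \<models> (\<^bold>\<exists>i. i \<^bold>\<in> K n \<^bold>\<and> maps_to (K f) i (K x))"
    using x by (rule holds_hImpD)
  then show ?thesis
    by (rule holds_hExE[OF m]) ((assumption | rule natural_space)+, simp only: holds_hAnd, blast)
qed

text \<open>The form in which the scheme is used: the premise is checked in every model of finitely
  many facts, and \<open>A\<close> may contain variables of the model as parameters, since the
  theory contains the closures of all instances.\<close>

lemma uniformity:
  assumes m: "model T H" and nat: "natural2 A" and G: "finite G" "\<forall>C\<in>G. H \<models> C"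
    and "\<And>H' x. model T H' \<Longrightarrow> \<forall>C\<in>G. H' \<models> C \<Longrightarrow> \<exists>y. mem H' y i \<and> H' \<models> A (K x) (K y)"
  shows "\<exists>y. mem H y i \<and> H \<models> (\<^bold>\<forall>x. A x (K y))"
proof -
  note A = nat[unfolded natural2_def, rule_format]
  let ?p = "formula2 A"
  have "H \<models> gup_czf ?p"
    by (rule holds_closure[OF GUP[unfolded GUP_CZF_def] _ m]) blast
  then have "H \<models> (\<^bold>\<forall>x. \<^bold>\<exists>y. y \<^bold>\<in> K i \<^bold>\<and> ?p\<^bold>[[x, y]\<^bold>]) \<^bold>\<longrightarrow> (\<^bold>\<exists>y. y \<^bold>\<in> K i \<^bold>\<and> (\<^bold>\<forall>x. ?p\<^bold>[[x, y]\<^bold>]))"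
    unfolding gup_czf_def by (rule holds_hAllD) (assumption | rule natural_space)+
  moreover have "((\<^bold>\<forall>x. \<^bold>\<exists>y. y \<^bold>\<in> K i \<^bold>\<and> ?p\<^bold>[[x, y]\<^bold>]) \<^bold>\<longrightarrow> (\<^bold>\<exists>y. y \<^bold>\<in> K i \<^bold>\<and> (\<^bold>\<forall>x. ?p\<^bold>[[x, y]\<^bold>]))) =
      ((\<^bold>\<forall>x. \<^bold>\<exists>y. y \<^bold>\<in> K i \<^bold>\<and> A x y) \<^bold>\<longrightarrow> (\<^bold>\<exists>y. y \<^bold>\<in> K i \<^bold>\<and> (\<^bold>\<forall>x. A x y)))"
    by (simp add: hAll_def hEx_def hImp_def hAnd_def happ_formula2[OF nat])
  ultimately have imp: "H \<models> (\<^bold>\<forall>x. \<^bold>\<exists>y. y \<^bold>\<in> K i \<^bold>\<and> A x y) \<^bold>\<longrightarrow> (\<^bold>\<exists>y. y \<^bold>\<in> K i \<^bold>\<and> (\<^bold>\<forall>x. A x y))"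
    by (simp only:)
  have "H \<models> (\<^bold>\<forall>x. \<^bold>\<exists>y. y \<^bold>\<in> K i \<^bold>\<and> A x y)"
  proof (rule holds_hAllI[OF m _ G(1)])
    show "natural (\<lambda>x. \<^bold>\<exists>y. y \<^bold>\<in> K i \<^bold>\<and> A x y)"
      by (rule naturalI, (assumption | rule frel_space A)+)
    fix H' x assume m': "model T H'" and "\<And>C. C \<in> G \<Longrightarrow> H' \<models> C"
    then have "\<exists>y. mem H' y i \<and> H' \<models> A (K x) (K y)" using assms(5) by blast
    then show "H' \<models> (\<^bold>\<exists>y. y \<^bold>\<in> K i \<^bold>\<and> A (K x) y)"
      by (subst holds_hEx[OF m']) (assumption | rule naturalI frel_space A | simp only: holds_hAnd)+
  qed (use G in blast)
  with imp have "H \<models> (\<^bold>\<exists>y. y \<^bold>\<in> K i \<^bold>\<and> (\<^bold>\<forall>x. A x y))" by (rule holds_hImpD)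
  then show ?thesis
    by (rule holds_hExE[OF m]) ((rule naturalI, (assumption | rule frel_space A)+), simp only: holds_hAnd, blast)
qed

end

subsection \<open>Uniform choice of a finite cover\<close>

lemma holds_hEx_iff:
  assumes "model T H" and "natural A" and "\<And>v. H \<models> A (K v) \<longleftrightarrow> P v"
  shows "H \<models> (\<^bold>\<exists>x. A x) \<longleftrightarrow> (\<exists>v. P v)"
  using holds_hEx[OF assms(1,2)] assms(3) by simp

definition is_inter :: "hvar \<Rightarrow> hvar \<Rightarrow> hvar \<Rightarrow> hfm" where
  "is_inter U s x = (\<^bold>\<forall>a. a \<^bold>\<in> U \<^bold>\<longleftrightarrow> a \<^bold>\<in> s \<^bold>\<and> a \<^bold>\<in> x)"

lemma frel_is_inter: "vrel f d e x x' \<Longrightarrow> vrel f d e y y' \<Longrightarrow> vrel f d e z z' \<Longrightarrow>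
    frel f d e (is_inter x y z) (is_inter x' y' z')"
  unfolding is_inter_def by (assumption | rule frel_sets)+

text \<open>The instance of subset collection for relations coded by a set \<open>u\<close>: for
  every \<open>u\<close> relating all of \<open>a\<close> to elements of \<open>b\<close>, some
  member of \<open>q\<close> consists of related values. It replaces a power set of finite
  subsets.\<close>

definition has_images :: "hvar \<Rightarrow> hvar \<Rightarrow> hvar \<Rightarrow> hfm" where
  "has_images a b q = (\<^bold>\<forall>u. (\<^bold>\<forall>x. x \<^bold>\<in> a \<^bold>\<longrightarrow> (\<^bold>\<exists>y. y \<^bold>\<in> b \<^bold>\<and> maps_to u x y)) \<^bold>\<longrightarrow>
     (\<^bold>\<exists>e. e \<^bold>\<in> q \<^bold>\<and> (\<^bold>\<forall>x. x \<^bold>\<in> a \<^bold>\<longrightarrow> (\<^bold>\<exists>y. y \<^bold>\<in> e \<^bold>\<and> maps_to u x y)) \<^bold>\<and>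
       (\<^bold>\<forall>y. y \<^bold>\<in> e \<^bold>\<longrightarrow> (\<^bold>\<exists>x. x \<^bold>\<in> a \<^bold>\<and> maps_to u x y))))"

lemma frel_has_images: "vrel f d e x x' \<Longrightarrow> vrel f d e y y' \<Longrightarrow> vrel f d e z z' \<Longrightarrow>
    frel f d e (has_images x y z) (has_images x' y' z')"
  unfolding has_images_def by (assumption | rule frel_sets)+

context czf_theory
begin

text \<open>With \<open>U = s \<inter> x\<close>, the set \<open>V\<close> is the pseudocomplement
  of \<open>U\<close>, \<open>W\<close> that of \<open>V\<close>, and \<open>X\<close> the union
  that the De Morgan law asserts to be a cover. They are arguments because each use constrains them
  further.\<close>

definition dm_split :: "hvar \<Rightarrow> hvar \<Rightarrow> hvar \<Rightarrow> hvar \<Rightarrow> hvar \<Rightarrow> hfm" where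
  "dm_split s x V W X = (\<^bold>\<exists>U. is_inter U s x \<^bold>\<and> is_pseudocompl c s V U \<^bold>\<and> is_pseudocompl c s W V \<^bold>\<and> is_union X W V)"

text \<open>The relation for the first use of uniformity, with value \<open>n\<close> in \<omega>;
  the finite subset \<open>u\<close> may still depend on \<open>x\<close>. In
  \<open>selection\<close> the value is the subset itself.\<close>

definition listing :: "hvar \<Rightarrow> hvar \<Rightarrow> hvar \<Rightarrow> hfm" where
  "listing s x n = (\<^bold>\<exists>V. \<^bold>\<exists>W. \<^bold>\<exists>X. \<^bold>\<exists>u. \<^bold>\<exists>f.
     dm_split s x V W X \<^bold>\<and> X \<^bold>\<subseteq> s \<^bold>\<and> u \<^bold>\<subseteq> X \<^bold>\<and> is_surjection f n u \<^bold>\<and> covs c s u)"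

definition selection :: "hvar \<Rightarrow> hvar \<Rightarrow> hvar \<Rightarrow> hfm" where
  "selection s x e = (\<^bold>\<exists>V. \<^bold>\<exists>W. \<^bold>\<exists>X. dm_split s x V W X \<^bold>\<and> e \<^bold>\<subseteq> X \<^bold>\<and> e \<^bold>\<subseteq> s \<^bold>\<and> covs c s e)"

text \<open>Uniformity needs the alternative to be an element of a set; \<open>\<omega>\<close> has an empty and a nonempty element.\<close>

definition tagging :: "hvar \<Rightarrow> hvar \<Rightarrow> hvar \<Rightarrow> hvar \<Rightarrow> hfm" where
  "tagging s y x t = (\<^bold>\<exists>V. \<^bold>\<exists>W. \<^bold>\<exists>X. dm_split s x V W X \<^bold>\<and>
     (is_empty t \<^bold>\<and> y \<^bold>\<in> W \<^bold>\<or> (\<^bold>\<exists>r. r \<^bold>\<in> t) \<^bold>\<and> y \<^bold>\<in> V))"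

lemma frel_dm_split:
  "vrel f d e s s' \<Longrightarrow> vrel f d e x x' \<Longrightarrow> vrel f d e V V' \<Longrightarrow> vrel f d e W W' \<Longrightarrow> vrel f d e X X' \<Longrightarrow>
    frel f d e (dm_split s x V W X) (dm_split s' x' V' W' X')"
  unfolding dm_split_def by (assumption | rule frel_space frel_is_inter)+

lemma frel_listing: "vrel f d e s s' \<Longrightarrow> vrel f d e x x' \<Longrightarrow> vrel f d e y y' \<Longrightarrow>
    frel f d e (listing s x y) (listing s' x' y')"
  unfolding listing_def by (assumption | rule frel_space frel_dm_split)+

lemma frel_selection: "vrel f d e s s' \<Longrightarrow> vrel f d e x x' \<Longrightarrow> vrel f d e y y' \<Longrightarrow>
    frel f d e (selection s x y) (selection s' x' y')"
  unfolding selection_def by (assumption | rule frel_space frel_dm_split)+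

lemma frel_tagging: "vrel f d e s s' \<Longrightarrow> vrel f d e y y' \<Longrightarrow> vrel f d e x x' \<Longrightarrow> vrel f d e t t' \<Longrightarrow>
    frel f d e (tagging s y x t) (tagging s' y' x' t')"
  unfolding tagging_def by (assumption | rule frel_space frel_dm_split)+

lemmas frel_all = frel_space frel_is_inter frel_has_images frel_dm_split frel_listing frel_selection frel_tagging

lemmas natural_all = naturalI frel_all

lemma holds_dm_split: "model T H \<Longrightarrow> H \<models> dm_split (K s) (K x) (K V) (K W) (K X) \<longleftrightarrow>
    (\<exists>U. H \<models> is_inter (K U) (K s) (K x) \<and> H \<models> is_pseudocompl c (K s) (K V) (K U) \<and>
      H \<models> is_pseudocompl c (K s) (K W) (K V) \<and> H \<models> is_union (K X) (K W) (K V))"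
  unfolding dm_split_def
  by ((rule holds_hEx_iff, assumption, ((assumption | rule natural_all)+)[1])+, simp only: holds_hAnd)

lemma holds_listing: "model T H \<Longrightarrow> H \<models> listing (K s) (K x) (K n) \<longleftrightarrow>
    (\<exists>V W X u f. H \<models> dm_split (K s) (K x) (K V) (K W) (K X) \<and> sub H X s \<and> sub H u X \<and>
      H \<models> is_surjection (K f) (K n) (K u) \<and> H \<models> covs c (K s) (K u))"
  unfolding listing_def
  by ((rule holds_hEx_iff, assumption, ((assumption | rule natural_all)+)[1])+, simp only: holds_hAnd)

lemma holds_selection: "model T H \<Longrightarrow> H \<models> selection (K s) (K x) (K e) \<longleftrightarrow>
    (\<exists>V W X. H \<models> dm_split (K s) (K x) (K V) (K W) (K X) \<and> sub H e X \<and> sub H e s \<and> H \<models> covs c (K s) (K e))"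
  unfolding selection_def
  by ((rule holds_hEx_iff, assumption, ((assumption | rule natural_all)+)[1])+, simp only: holds_hAnd)

lemma holds_tagging:
  assumes m: "model T H"
  shows "H \<models> tagging (K s) (K y) (K x) (K t) \<longleftrightarrow>
    (\<exists>V W X. H \<models> dm_split (K s) (K x) (K V) (K W) (K X) \<and>
      (H \<models> is_empty (K t) \<and> mem H y W \<or> (\<exists>r. mem H r t) \<and> mem H y V))"
proof -
  have r: "H \<models> (\<^bold>\<exists>r. r \<^bold>\<in> K t) \<longleftrightarrow> (\<exists>r. mem H r t)"
    by (rule holds_hEx[OF m]) (assumption | rule natural_all)+
  show ?thesis unfolding tagging_def
    by ((rule holds_hEx_iff[OF m], ((assumption | rule natural_all)+)[1])+, simp only: holds_hAnd holds_hOr[OF m] r)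
qed

lemma holds_is_interD: "H \<models> is_inter (K U) (K s) (K x) \<Longrightarrow>
    (mem H v U) = (mem H v s \<and> mem H v x)"
  unfolding is_inter_def
  by (subst holds_hAnd[symmetric], rule holds_hIffD, erule holds_hAllD[of H _ v])
    (assumption | rule natural_all)+

lemma inter_exists:
  assumes m: "model T H"
  shows "\<exists>U. H \<models> is_inter (K U) (K s) (K x)"
proof -
  \<comment> \<open>In the scheme, index 0 is the candidate element, so the parameter
    \<open>x\<close> appears as \<open>Suc x\<close>.\<close>
  have "H \<models> separation (Mem 0 (Suc x))"
    by (rule axiom[OF _ m]) (auto intro: bounded.intros)
  moreover have "separation (Mem 0 (Suc x)) = (\<^bold>\<forall>a. \<^bold>\<exists>b. is_inter b a (K x))"
    by (simp add: separation_def is_inter_def happ_def hMem_def K_def add.commute)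
  ultimately have "H \<models> (\<^bold>\<forall>a. \<^bold>\<exists>b. is_inter b a (K x))" by (simp only:)
  then have "H \<models> (\<^bold>\<exists>b. is_inter b (K s) (K x))"
    by (rule holds_hAllD) (assumption | rule natural_all)+
  then show ?thesis
    by (subst (asm) holds_hEx[OF m]) (assumption | rule natural_all)+
qed

section \<open>Natural numbers in a model\<close>

lemma holds_is_inductiveD:
  assumes m: "model T H" and i: "H \<models> is_inductive (K w)"
  shows "\<exists>z. mem H z w \<and> H \<models> is_empty (K z)"
    and "mem H x w \<Longrightarrow> \<exists>y. mem H y w \<and> H \<models> is_succ (K y) (K x)"
proof -
  have "H \<models> (\<^bold>\<exists>z. z \<^bold>\<in> K w \<^bold>\<and> is_empty z)" using i by (simp add: is_inductive_def holds_hAnd)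
  moreover have "H \<models> (\<^bold>\<exists>z. z \<^bold>\<in> K w \<^bold>\<and> is_empty z) \<longleftrightarrow> (\<exists>z. mem H z w \<and> H \<models> is_empty (K z))"
    by ((rule holds_hEx_iff[OF m], ((assumption | rule natural_all)+)[1])+, simp only: holds_hAnd)
  ultimately show "\<exists>z. mem H z w \<and> H \<models> is_empty (K z)" by simp
  assume x: "mem H x w"
  have "H \<models> (\<^bold>\<forall>x. x \<^bold>\<in> K w \<^bold>\<longrightarrow> (\<^bold>\<exists>y. y \<^bold>\<in> K w \<^bold>\<and> is_succ y x))"
    using i by (simp add: is_inductive_def holds_hAnd)
  then have "H \<models> K x \<^bold>\<in> K w \<^bold>\<longrightarrow> (\<^bold>\<exists>y. y \<^bold>\<in> K w \<^bold>\<and> is_succ y (K x))"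
    by (rule holds_hAllD) (assumption | rule natural_all)+
  then have "H \<models> (\<^bold>\<exists>y. y \<^bold>\<in> K w \<^bold>\<and> is_succ y (K x))" using x by (rule holds_hImpD)
  moreover have "H \<models> (\<^bold>\<exists>y. y \<^bold>\<in> K w \<^bold>\<and> is_succ y (K x)) \<longleftrightarrow> (\<exists>y. mem H y w \<and> H \<models> is_succ (K y) (K x))"
    by ((rule holds_hEx_iff[OF m], ((assumption | rule natural_all)+)[1])+, simp only: holds_hAnd)
  ultimately show "\<exists>y. mem H y w \<and> H \<models> is_succ (K y) (K x)" by simp
qed

lemma omega_zero:
  assumes m: "model T H" and w: "H \<models> is_omega (K w)"
  shows "\<exists>z. mem H z w \<and> H \<models> is_empty (K z)"
  using holds_is_inductiveD(1)[OF m] w by (simp add: is_omega_def holds_hAnd)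

text \<open>A successor contains its predecessor, so it is an inhabited element: the second
  tag.\<close>

lemma omega_one:
  assumes m: "model T H" and w: "H \<models> is_omega (K w)"
  shows "\<exists>t r. mem H t w \<and> mem H r t"
proof -
  have i: "H \<models> is_inductive (K w)" using w by (simp add: is_omega_def holds_hAnd)
  obtain z where z: "mem H z w" using holds_is_inductiveD(1)[OF m i] by auto
  obtain t where t: "mem H t w" "H \<models> is_succ (K t) (K z)"
    using holds_is_inductiveD(2)[OF m i z] by auto
  have "mem H z t" using holds_is_succD[OF m t(2)] holds_hEq_refl by simp
  with t(1) show ?thesis by auto
qed

text \<open>Finiteness brings its own set of natural numbers each time; for uniformity the lengths
  must come from one fixed \<open>w\<close>.\<close>

lemma omega_least:
  assumes "H \<models> is_omega (K w)" and "H \<models> is_omega (K w')" and "mem H n w'"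
  shows "mem H n w"
proof -
  have "H \<models> (\<^bold>\<forall>b. is_inductive b \<^bold>\<longrightarrow> K w' \<^bold>\<subseteq> b)" using assms(2) by (simp add: is_omega_def holds_hAnd)
  then have "H \<models> is_inductive (K w) \<^bold>\<longrightarrow> K w' \<^bold>\<subseteq> K w"
    by (rule holds_hAllD) (assumption | rule natural_all)+
  then have "sub H w' w" by (rule holds_hImpD) (use assms(1) in \<open>simp add: is_omega_def holds_hAnd\<close>)
  then show ?thesis using assms(3) by (rule holds_hsubD)
qed

lemma omega_exists:
  assumes m: "model T H"
  shows "\<exists>w. H \<models> is_omega (K w)"
proof -
  have "H \<models> strong_infinity" by (rule axiom[OF _ m]) simp
  then show ?thesis unfolding strong_infinity_def
    by (subst (asm) holds_hEx[OF m]) (assumption | rule natural_all)+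
qed

lemma has_images_exists:
  assumes m: "model T H"
  shows "\<exists>q. H \<models> has_images (K a) (K b) (K q)"
proof -
  have "H \<models> subset_collection maps_to_fm" by (rule axiom[OF _ m]) blast
  moreover have "subset_collection maps_to_fm = (\<^bold>\<forall>a. \<^bold>\<forall>b. \<^bold>\<exists>q. has_images a b q)"
    by (simp add: subset_collection_def has_images_def hAll_def hEx_def hImp_def hAnd_def happ_maps_to_fm)
  ultimately have "H \<models> (\<^bold>\<forall>a. \<^bold>\<forall>b. \<^bold>\<exists>q. has_images a b q)" by (simp only:)
  then have "H \<models> (\<^bold>\<forall>b. \<^bold>\<exists>q. has_images (K a) b q)"
    by (rule holds_hAllD) (assumption | rule natural_all)+
  then have "H \<models> (\<^bold>\<exists>q. has_images (K a) (K b) q)"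
    by (rule holds_hAllD) (assumption | rule natural_all)+
  then show ?thesis
    by (subst (asm) holds_hEx[OF m]) (assumption | rule natural_all)+
qed

text \<open>Subset collection promises only a set of values meeting every fibre of the relation. As
  \<open>f\<close> is single-valued, such a set has the same elements as \<open>u\<close>.\<close>

lemma has_images_surjection:
  assumes m: "model T H" and q: "H \<models> has_images (K n) (K s) (K q)"
    and f: "H \<models> is_surjection (K f) (K n) (K u)" and u: "sub H u s"
  shows "\<exists>e. mem H e q \<and> sub H e u \<and> sub H u e"
proof -
  have ex: "H' \<models> (\<^bold>\<exists>y. y \<^bold>\<in> K e \<^bold>\<and> maps_to (K f) (K x) y) \<longleftrightarrow> (\<exists>y. mem H' y e \<and> H' \<models> maps_to (K f) (K x) (K y))"
    if "model T H'" for H' x e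
    by ((rule holds_hEx_iff[OF that], ((assumption | rule natural_all)+)[1])+, simp only: holds_hAnd)
  have ex': "H' \<models> (\<^bold>\<exists>x. x \<^bold>\<in> K n \<^bold>\<and> maps_to (K f) x (K y)) \<longleftrightarrow> (\<exists>x. mem H' x n \<and> H' \<models> maps_to (K f) (K x) (K y))"
    if "model T H'" for H' y
    by ((rule holds_hEx_iff[OF that], ((assumption | rule natural_all)+)[1])+, simp only: holds_hAnd)
  let ?to = "\<lambda>e. (\<^bold>\<forall>x. x \<^bold>\<in> K n \<^bold>\<longrightarrow> (\<^bold>\<exists>y. y \<^bold>\<in> e \<^bold>\<and> maps_to (K f) x y))"
  let ?from = "\<lambda>e. (\<^bold>\<forall>y. y \<^bold>\<in> e \<^bold>\<longrightarrow> (\<^bold>\<exists>x. x \<^bold>\<in> K n \<^bold>\<and> maps_to (K f) x y))"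
  let ?G = "{is_surjection (K f) (K n) (K u), K u \<^bold>\<subseteq> K s}"
  have "H \<models> ?to (K s)"
  proof (rule holds_all_sets_hImpI[OF m, of _ _ ?G])
    show "natural (\<lambda>x. x \<^bold>\<in> K n)" "natural (\<lambda>x. \<^bold>\<exists>y. y \<^bold>\<in> K s \<^bold>\<and> maps_to (K f) x y)"
      by (assumption | rule natural_all)+
    fix H' x assume m': "model T H'" and "\<forall>C\<in>?G. H' \<models> C"
    then have f': "H' \<models> is_surjection (K f) (K n) (K u)" and u': "sub H' u s" by simp_all
    assume "mem H' x n"
    then obtain y where y: "H' \<models> maps_to (K f) (K x) (K y)" using surjection_total[OF m' f'] by auto
    have "mem H' y s" by (rule holds_hsubD[OF u']) (rule surjection_range[OF m' f' y])
    then show "H' \<models> (\<^bold>\<exists>y. y \<^bold>\<in> K s \<^bold>\<and> maps_to (K f) (K x) y)" unfolding ex[OF m'] using y by auto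
  qed (use f u in simp_all)
  moreover have "H \<models> ?to (K s) \<^bold>\<longrightarrow> (\<^bold>\<exists>e. e \<^bold>\<in> K q \<^bold>\<and> ?to e \<^bold>\<and> ?from e)"
    using q unfolding has_images_def by (rule holds_hAllD) (assumption | rule natural_all)+
  ultimately have "H \<models> (\<^bold>\<exists>e. e \<^bold>\<in> K q \<^bold>\<and> ?to e \<^bold>\<and> ?from e)" using holds_hImpD by simp
  moreover have "H \<models> (\<^bold>\<exists>e. e \<^bold>\<in> K q \<^bold>\<and> ?to e \<^bold>\<and> ?from e) \<longleftrightarrow>
      (\<exists>e. mem H e q \<and> H \<models> ?to (K e) \<and> H \<models> ?from (K e))"
    by (rule holds_hEx_iff[OF m], ((assumption | rule natural_all)+)[1], simp only: holds_hAnd)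
  ultimately obtain e where e: "mem H e q" "H \<models> ?to (K e)" "H \<models> ?from (K e)" by auto
  have "sub H e u"
  proof (rule holds_hsubI[OF m, of "{?from (K e), is_surjection (K f) (K n) (K u)}"])
    fix H' y assume m': "model T H'" and "\<forall>C\<in>{?from (K e), is_surjection (K f) (K n) (K u)}. H' \<models> C"
      and y: "mem H' y e"
    then have f': "H' \<models> is_surjection (K f) (K n) (K u)" and e': "H' \<models> ?from (K e)" by simp_all
    have imp: "H' \<models> K y \<^bold>\<in> K e \<^bold>\<longrightarrow> (\<^bold>\<exists>x. x \<^bold>\<in> K n \<^bold>\<and> maps_to (K f) x (K y))"
      using e' by (rule holds_hAllD) (assumption | rule natural_all)+
    obtain x where "H' \<models> maps_to (K f) (K x) (K y)"
      using holds_hImpD[OF imp y] unfolding ex'[OF m'] by auto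
    then show "mem H' y u" by (rule surjection_range[OF m' f'])
  qed (use e f in simp_all)
  moreover have "sub H u e"
  proof (rule holds_hsubI[OF m, of "{?to (K e), is_surjection (K f) (K n) (K u)}"])
    fix H' y assume m': "model T H'" and "\<forall>C\<in>{?to (K e), is_surjection (K f) (K n) (K u)}. H' \<models> C"
      and y: "mem H' y u"
    then have f': "H' \<models> is_surjection (K f) (K n) (K u)" and e': "H' \<models> ?to (K e)" by simp_all
    obtain x where x: "mem H' x n" "H' \<models> maps_to (K f) (K x) (K y)"
      using surjection_onto[OF m' f' y] by auto
    have imp: "H' \<models> K x \<^bold>\<in> K n \<^bold>\<longrightarrow> (\<^bold>\<exists>y. y \<^bold>\<in> K e \<^bold>\<and> maps_to (K f) (K x) y)"
      using e' by (rule holds_hAllD) (assumption | rule natural_all)+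
    obtain y' where y': "mem H' y' e" "H' \<models> maps_to (K f) (K x) (K y')"
      using holds_hImpD[OF imp x(1)] unfolding ex[OF m'] by auto
    \<comment> \<open>Both \<open>y\<close> and \<open>y'\<close> are values at \<open>x\<close>,
      hence equal to its unique value.\<close>
    obtain v where "eqv H' y v" "eqv H' y' v"
      using surjection_total[OF m' f' x(1)] x(2) y'(2) by auto
    then have "eqv H' y' y" using eq_eq eq_sym by metis
    then show "mem H' y e" using y'(1) by (rule eq_mem)
  qed (use e f in simp_all)
  ultimately show ?thesis using e(1) by auto
qed

section \<open>Inclusion and covering\<close>

lemma hsub_trans:
  assumes "model T H" and "sub H x y" and "sub H y z"
  shows "sub H x z"
  by (rule holds_hsubI[OF assms(1), where G="{K x \<^bold>\<subseteq> K y, K y \<^bold>\<subseteq> K z}"])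
    (use assms(2,3) in \<open>auto dest: holds_hsubD\<close>)

lemma covs_if_sub:
  assumes m: "model T H" and fs: "H \<models> formal_space c (K s)" and uv: "sub H u v" and vs: "sub H v s"
  shows "H \<models> covs c (K u) (K v)"
proof (rule holds_covsI[OF m, where G="{formal_space c (K s), K u \<^bold>\<subseteq> K v, K v \<^bold>\<subseteq> K s}"])
  fix H' a assume "\<forall>C\<in>{formal_space c (K s), K u \<^bold>\<subseteq> K v, K v \<^bold>\<subseteq> K s}. H' \<models> C" and a: "mem H' a u"
  then have H': "H' \<models> formal_space c (K s)" "sub H' u v" "sub H' v s" by simp_all
  from holds_hsubD[OF H'(2) a] have "mem H' a v" .
  then show "H' \<models> cov c (K a) (K v)"
    using formal_space_refl[OF H'(1)] H'(3) holds_hsubD by simp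
qed (use fs uv vs in simp_all)

lemma covs_trans:
  assumes m: "model T H" and fs: "H \<models> formal_space c (K s)" and us: "sub H u s" and vs: "sub H v s"
    and su: "H \<models> covs c (K s) (K u)" and uv: "H \<models> covs c (K u) (K v)"
  shows "H \<models> covs c (K s) (K v)"
proof (rule holds_covsI[OF m, where G="{formal_space c (K s), K u \<^bold>\<subseteq> K s, K v \<^bold>\<subseteq> K s, covs c (K s) (K u), covs c (K u) (K v)}"])
  fix H' a
  assume "\<forall>C\<in>{formal_space c (K s), K u \<^bold>\<subseteq> K s, K v \<^bold>\<subseteq> K s, covs c (K s) (K u), covs c (K u) (K v)}. H' \<models> C"
    and a: "mem H' a s"
  then have H': "H' \<models> formal_space c (K s)" "sub H' u s" "sub H' v s"
    "H' \<models> covs c (K s) (K u)" "H' \<models> covs c (K u) (K v)" by simp_all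
  show "H' \<models> cov c (K a) (K v)"
    by (rule formal_space_trans[OF H'(1) a H'(2,3) holds_covsD[OF H'(4) a] H'(5)])
qed (use fs us vs su uv in simp_all)

lemma is_empty_sub:
  assumes "model T H" and "H \<models> is_empty (K z)"
  shows "sub H z x"
  by (rule holds_hsubI[OF assms(1), where G="{is_empty (K z)}"]) (use assms(2) in \<open>auto dest: holds_is_emptyD\<close>)

lemma de_morganD:
  assumes m: "model T H" and dm: "H \<models> de_morgan c (K s)"
  shows "\<exists>V W X. H \<models> dm_split (K s) (K x) (K V) (K W) (K X) \<and> sub H X s \<and> H \<models> covs c (K s) (K X)"
proof -
  obtain U where U: "H \<models> is_inter (K U) (K s) (K x)" using inter_exists[OF m] by auto
  let ?ex = "\<lambda>U. (\<^bold>\<exists>V. \<^bold>\<exists>W. \<^bold>\<exists>X. is_pseudocompl c (K s) V U \<^bold>\<and> is_pseudocompl c (K s) W V \<^bold>\<and> is_union X W V \<^bold>\<and> covs c (K s) X)"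
  have "H \<models> K U \<^bold>\<subseteq> K s \<^bold>\<longrightarrow> ?ex (K U)"
    using dm unfolding de_morgan_def by (rule holds_hAllD) (assumption | rule natural_all)+
  moreover have "sub H U s"
    by (rule holds_hsubI[OF m, where G="{is_inter (K U) (K s) (K x)}"]) (use U in \<open>auto simp: holds_is_interD\<close>)
  ultimately have "H \<models> ?ex (K U)" by (rule holds_hImpD)
  moreover have "H \<models> ?ex (K U) \<longleftrightarrow> (\<exists>V W X. H \<models> is_pseudocompl c (K s) (K V) (K U) \<and>
      H \<models> is_pseudocompl c (K s) (K W) (K V) \<and> H \<models> is_union (K X) (K W) (K V) \<and> H \<models> covs c (K s) (K X))"
    by ((rule holds_hEx_iff[OF m], ((assumption | rule natural_all)+)[1])+, simp only: holds_hAnd)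
  ultimately obtain V W X where VWX: "H \<models> is_pseudocompl c (K s) (K V) (K U)"
    "H \<models> is_pseudocompl c (K s) (K W) (K V)" "H \<models> is_union (K X) (K W) (K V)" "H \<models> covs c (K s) (K X)"
    by auto
  have "sub H X s"
    by (rule is_union_sub[OF m VWX(3)]) (rule is_pseudocompl_sub[OF m] VWX(1,2))+
  then show ?thesis using U VWX holds_dm_split[OF m] by auto
qed

lemma compact_spaceD:
  assumes m: "model T H" and co: "H \<models> compact_space c (K s)"
    and X: "sub H X s" "H \<models> covs c (K s) (K X)"
  shows "\<exists>u w n f. sub H u X \<and> H \<models> is_omega (K w) \<and> mem H n w \<and>
    H \<models> is_surjection (K f) (K n) (K u) \<and> H \<models> covs c (K s) (K u)"
proof -
  have "H \<models> K X \<^bold>\<subseteq> K s \<^bold>\<and> covs c (K s) (K X) \<^bold>\<longrightarrow> (\<^bold>\<exists>u. u \<^bold>\<subseteq> K X \<^bold>\<and> finitely_listed u \<^bold>\<and> covs c (K s) u)"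
    using co unfolding compact_space_def by (rule holds_hAllD) (assumption | rule natural_all)+
  then have "H \<models> (\<^bold>\<exists>u. u \<^bold>\<subseteq> K X \<^bold>\<and> finitely_listed u \<^bold>\<and> covs c (K s) u)"
    by (rule holds_hImpD) (simp add: X holds_hAnd)
  moreover have "H \<models> (\<^bold>\<exists>u. u \<^bold>\<subseteq> K X \<^bold>\<and> finitely_listed u \<^bold>\<and> covs c (K s) u) \<longleftrightarrow>
      (\<exists>u. sub H u X \<and> H \<models> finitely_listed (K u) \<and> H \<models> covs c (K s) (K u))"
    by ((rule holds_hEx_iff[OF m], ((assumption | rule natural_all)+)[1])+, simp only: holds_hAnd)
  moreover have "H \<models> finitely_listed (K u) \<longleftrightarrow>
      (\<exists>w n f. H \<models> is_omega (K w) \<and> mem H n w \<and> H \<models> is_surjection (K f) (K n) (K u))" for u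
    unfolding finitely_listed_def
    by ((rule holds_hEx_iff[OF m], ((assumption | rule natural_all)+)[1])+, simp only: holds_hAnd)
  ultimately show ?thesis by metis
qed

section \<open>The relations to be made uniform\<close>

lemma listing_exists:
  assumes m: "model T H" and dm: "H \<models> de_morgan c (K s)" and co: "H \<models> compact_space c (K s)"
    and w: "H \<models> is_omega (K w)"
  shows "\<exists>n. mem H n w \<and> H \<models> listing (K s) (K x) (K n)"
proof -
  obtain V W X where X: "H \<models> dm_split (K s) (K x) (K V) (K W) (K X)" "sub H X s" "H \<models> covs c (K s) (K X)"
    using de_morganD[OF m dm, of x] by auto
  obtain u w' n f where u: "sub H u X" "H \<models> is_omega (K w')" "mem H n w'"
    "H \<models> is_surjection (K f) (K n) (K u)" "H \<models> covs c (K s) (K u)"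
    using compact_spaceD[OF m co X(2,3)] by auto
  have "H \<models> listing (K s) (K x) (K n)"
    unfolding holds_listing[OF m]
    by (rule exI[of _ V], rule exI[of _ W], rule exI[of _ X], rule exI[of _ u], rule exI[of _ f])
      (simp add: X u)
  then show ?thesis using omega_least[OF w u(2,3)] by auto
qed

lemma selection_exists:
  assumes m: "model T H" and fs: "H \<models> formal_space c (K s)"
    and q: "H \<models> has_images (K n) (K s) (K q)" and l: "H \<models> listing (K s) (K x) (K n)"
  shows "\<exists>e. mem H e q \<and> H \<models> selection (K s) (K x) (K e)"
proof -
  obtain V W X u f where X: "H \<models> dm_split (K s) (K x) (K V) (K W) (K X)" "sub H X s" "sub H u X"
    "H \<models> is_surjection (K f) (K n) (K u)" "H \<models> covs c (K s) (K u)"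
    using l holds_listing[OF m] by auto
  have us: "sub H u s" by (rule hsub_trans[OF m X(3,2)])
  obtain e where e: "mem H e q" "sub H e u" "sub H u e"
    using has_images_surjection[OF m q X(4) us] by auto
  have eX: "sub H e X" and es: "sub H e s"
    by (rule hsub_trans[OF m e(2)], fact)+
  have "H \<models> covs c (K s) (K e)"
    by (rule covs_trans[OF m fs us es X(5) covs_if_sub[OF m fs e(3) es]])
  then show ?thesis using e X(1) eX es holds_selection[OF m] by auto
qed

lemma tagging_exists:
  assumes m: "model T H" and l: "H \<models> selection (K s) (K x) (K e)" and y: "mem H y e"
    and w: "H \<models> is_omega (K w)"
  shows "\<exists>t. mem H t w \<and> H \<models> tagging (K s) (K y) (K x) (K t)"
proof -
  obtain V W X where X: "H \<models> dm_split (K s) (K x) (K V) (K W) (K X)" "sub H e X"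
    using l holds_selection[OF m] by auto
  have "mem H y X" using X(2) y by (rule holds_hsubD)
  then have "mem H y W \<or> mem H y V"
    using X(1) holds_dm_split[OF m] holds_is_unionD[OF m] by auto
  then show ?thesis
    using omega_zero[OF m w] omega_one[OF m w] X(1) unfolding holds_tagging[OF m] by metis
qed

text \<open>The same tag \<open>t\<close> is used for two values of \<open>x\<close>. Taking
  \<open>x\<close> empty makes \<open>U\<close> empty, where the tag for \<open>W\<close> suffices;
  taking \<open>x = s\<close> makes \<open>U\<close> all of the space, where the tag for
  \<open>V\<close> suffices. A tag cannot pair the remaining alternatives without being both empty
  and inhabited.\<close>

lemma tagging_covered:
  assumes m: "model T H" and fs: "H \<models> formal_space c (K s)" and z: "H \<models> is_empty (K z)"
    and y: "mem H y s"
    and t0: "H \<models> tagging (K s) (K y) (K z) (K t)" and t1: "H \<models> tagging (K s) (K y) (K s) (K t)"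
  shows "\<exists>z. H \<models> is_empty (K z) \<and> H \<models> cov c (K y) (K z)"
proof -
  obtain V W X where 0: "H \<models> dm_split (K s) (K z) (K V) (K W) (K X)"
      "H \<models> is_empty (K t) \<and> mem H y W \<or> (\<exists>r. mem H r t) \<and> mem H y V"
    using t0 holds_tagging[OF m] by auto
  obtain V' W' X' where 1: "H \<models> dm_split (K s) (K s) (K V') (K W') (K X')"
      "H \<models> is_empty (K t) \<and> mem H y W' \<or> (\<exists>r. mem H r t) \<and> mem H y V'"
    using t1 holds_tagging[OF m] by auto
  obtain U where U: "H \<models> is_inter (K U) (K s) (K z)" "H \<models> is_pseudocompl c (K s) (K V) (K U)"
      "H \<models> is_pseudocompl c (K s) (K W) (K V)"
    using 0(1) holds_dm_split[OF m] by auto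
  obtain U' where U': "H \<models> is_inter (K U') (K s) (K s)" "H \<models> is_pseudocompl c (K s) (K V') (K U')"
    using 1(1) holds_dm_split[OF m] by auto
  \<comment> \<open>\<open>H\<close> is not known to be consistent, so contradictory tags are
    exploited through falsum, which yields the claim as well.\<close>
  have absurd: ?thesis if "H \<models> is_empty (K t)" "mem H r t" for r
    using holds_is_emptyD[OF that, of "is_empty (K z)"] holds_is_emptyD[OF that, of "cov c (K y) (K z)"] by auto
  have "mem H y W \<or> mem H y V' \<or> ?thesis" using 0(2) 1(2) absurd by metis
  moreover have ?thesis if "mem H y V'"
    by (rule covered_by_empty[OF m fs U'(2) that]) (simp add: holds_is_interD[OF U'(1)] y)
  moreover have ?thesis if "mem H y W"
  proof (rule covered_by_empty[OF m fs U(3) that])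
    have "H \<models> is_empty (K U)"
      by (rule holds_is_emptyI[OF m, where G="{is_inter (K U) (K s) (K z), is_empty (K z)}"])
        (use U z in \<open>auto simp: holds_is_interD dest: holds_is_emptyD\<close>)
    then show "mem H y V" using y by (rule pseudocompl_of_empty[OF m U(2)])
  qed
  ultimately show ?thesis by metis
qed

text \<open>With \<open>e\<close> fixed, \<open>y\<close> lies in the union belonging to every
  \<open>x\<close>. Uniformity over \<omega> turns this into one tag valid for all
  \<open>x\<close>.\<close>

lemma selected_covered:
  assumes m: "model T H" and fs: "H \<models> formal_space c (K s)" and w: "H \<models> is_omega (K w)"
    and z: "H \<models> is_empty (K z)" and e: "H \<models> (\<^bold>\<forall>x. selection (K s) x (K e))" and y: "mem H y e"
  shows "\<exists>z. H \<models> is_empty (K z) \<and> H \<models> cov c (K y) (K z)"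
proof -
  have sel: "H' \<models> selection (K s) (K x) (K e)" if "H' \<models> (\<^bold>\<forall>x. selection (K s) x (K e))" for H' x
    using that by (rule holds_hAllD) (assumption | rule natural_all)+
  have "sub H e s" using sel[OF e] holds_selection[OF m] by auto
  then have ys: "mem H y s" using y by (rule holds_hsubD)
  let ?G = "{\<^bold>\<forall>x. selection (K s) x (K e), K y \<^bold>\<in> K e, is_omega (K w)}"
  have "\<exists>t. mem H t w \<and> H \<models> (\<^bold>\<forall>x. tagging (K s) (K y) x (K t))"
  proof (rule uniformity[OF m, where G="?G"])
    show "natural2 (tagging (K s) (K y))" by (rule natural2I, (assumption | rule frel_all)+)
    fix H' x assume m': "model T H'" and "\<forall>C\<in>?G. H' \<models> C"
    then have H': "H' \<models> (\<^bold>\<forall>x. selection (K s) x (K e))" "mem H' y e" "H' \<models> is_omega (K w)" by simp_all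
    show "\<exists>t. mem H' t w \<and> H' \<models> tagging (K s) (K y) (K x) (K t)"
      by (rule tagging_exists[OF m' sel[OF H'(1)] H'(2,3)])
  qed (use e y w in simp_all)
  then obtain t where t: "H \<models> (\<^bold>\<forall>x. tagging (K s) (K y) x (K t))" by auto
  have "H \<models> tagging (K s) (K y) (K x) (K t)" for x
    using t by (rule holds_hAllD) (assumption | rule natural_all)+
  then show ?thesis using tagging_covered[OF m fs z ys] by metis
qed

text \<open>A cover by the empty set is stated with some empty \<open>z\<close>. Any two empty sets
  cover each other, so the witness may be exchanged.\<close>

lemma is_empty_eq_covers:
  assumes m: "model T H" and fs: "H \<models> formal_space c (K s)" and y: "mem H y s"
    and z: "H \<models> is_empty (K z)" "H \<models> cov c (K y) (K z)" and z': "H \<models> is_empty (K z')"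
  shows "H \<models> cov c (K y) (K z')"
  by (rule formal_space_trans[OF fs y is_empty_sub[OF m z(1)] is_empty_sub[OF m z'] z(2)])
    (rule covs_if_sub[OF m fs is_empty_sub[OF m z(1)] is_empty_sub[OF m z']])

theorem compact_de_morgan_trivial:
  assumes m: "model T H" and fs: "H \<models> formal_space c (K s)" and nt: "H \<models> nontrivial c (K s)"
    and dm: "H \<models> de_morgan c (K s)" and co: "H \<models> compact_space c (K s)"
  shows "H \<models> \<^bold>\<bottom>"
proof -
  obtain w where w: "H \<models> is_omega (K w)" using omega_exists[OF m] by auto
  obtain z where z: "H \<models> is_empty (K z)" using omega_zero[OF m w] by auto
  let ?G = "{de_morgan c (K s), compact_space c (K s), is_omega (K w)}"
  have "\<exists>n. mem H n w \<and> H \<models> (\<^bold>\<forall>x. listing (K s) x (K n))"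
  proof (rule uniformity[OF m, where G="?G"])
    show "natural2 (listing (K s))" by (rule natural2I, (assumption | rule frel_all)+)
    fix H' x assume m': "model T H'" and "\<forall>C\<in>?G. H' \<models> C"
    then show "\<exists>n. mem H' n w \<and> H' \<models> listing (K s) (K x) (K n)"
      by (intro listing_exists[OF m']) simp_all
  qed (use dm co w in simp_all)
  then obtain n where n: "H \<models> (\<^bold>\<forall>x. listing (K s) x (K n))" by auto
  \<comment> \<open>Only now that \<open>n\<close> is independent of \<open>x\<close> can a single
    set of images of \<open>n\<close> serve every \<open>x\<close>.\<close>
  obtain q where q: "H \<models> has_images (K n) (K s) (K q)" using has_images_exists[OF m] by auto
  let ?G = "{formal_space c (K s), has_images (K n) (K s) (K q), \<^bold>\<forall>x. listing (K s) x (K n)}"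
  have "\<exists>e. mem H e q \<and> H \<models> (\<^bold>\<forall>x. selection (K s) x (K e))"
  proof (rule uniformity[OF m, where G="?G"])
    show "natural2 (selection (K s))" by (rule natural2I, (assumption | rule frel_all)+)
    fix H' x assume m': "model T H'" and "\<forall>C\<in>?G. H' \<models> C"
    then have H': "H' \<models> formal_space c (K s)" "H' \<models> has_images (K n) (K s) (K q)"
      "H' \<models> (\<^bold>\<forall>x. listing (K s) x (K n))" by simp_all
    have "H' \<models> listing (K s) (K x) (K n)"
      using H'(3) by (rule holds_hAllD) (assumption | rule natural_all)+
    then show "\<exists>e. mem H' e q \<and> H' \<models> selection (K s) (K x) (K e)"
      by (rule selection_exists[OF m' H'(1,2)])
  qed (use fs q n in simp_all)
  then obtain e where e: "H \<models> (\<^bold>\<forall>x. selection (K s) x (K e))" by auto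
  \<comment> \<open>Any \<open>x\<close> would do: that \<open>e\<close> is contained in
    \<open>s\<close> and covers it does not mention \<open>x\<close>.\<close>
  have "H \<models> selection (K s) (K z) (K e)"
    using e by (rule holds_hAllD) (assumption | rule natural_all)+
  then have es: "sub H e s" and se: "H \<models> covs c (K s) (K e)" using holds_selection[OF m] by auto
  let ?G = "{formal_space c (K s), K e \<^bold>\<subseteq> K s, is_omega (K w), is_empty (K z), \<^bold>\<forall>x. selection (K s) x (K e)}"
  \<comment> \<open>The alternative is made uniform for each \<open>y\<close> separately, in the
    extension where \<open>y\<close> lives, so no tags have to be chosen simultaneously for all
    elements of \<open>e\<close>.\<close>
  have "H \<models> covs c (K e) (K z)"
  proof (rule holds_covsI[OF m, where G="?G"])
    fix H' y assume m': "model T H'" and "\<forall>C\<in>?G. H' \<models> C" and y: "mem H' y e"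
    then have H': "H' \<models> formal_space c (K s)" "H' \<models> is_omega (K w)" "H' \<models> is_empty (K z)"
      "H' \<models> (\<^bold>\<forall>x. selection (K s) x (K e))" and "sub H' e s" by simp_all
    then have "mem H' y s" using y holds_hsubD by metis
    then show "H' \<models> cov c (K y) (K z)"
      using selected_covered[OF m' H' y] is_empty_eq_covers[OF m' H'(1)] H'(3) by metis
  qed (use fs es w z e in simp_all)
  then have "H \<models> covs c (K s) (K z)"
    by (rule covs_trans[OF m fs es is_empty_sub[OF m z] se])
  then have "H \<models> covs_empty c (K s)" using holds_covs_empty[OF m] z by auto
  with nt show ?thesis unfolding nontrivial_def by (rule holds_hImpD)
qed

end

text \<open>Consistency with uniformity gives a saturated extension that does not derive falsum, and
  the preceding theorem refutes it.\<close>

theorem no_compact_de_morgan_czf: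
  assumes "CZF_star T" and sp: "nontrivial_de_morgan_space_in_czf T p c"
  shows "\<not> provably_compact_in_czf T p c"
proof
  assume co: "provably_compact_in_czf T p c"
  let ?T = "T \<union> GUP_CZF"
  have T: "\<forall>p\<in>?T. fv p = {}" and cons: "\<not> ?T \<union> {} \<turnstile> Bot" and CZF: "CZF \<subseteq> T"
    using assms(1) by (auto simp: CZF_star_def GUP_CZF_def closures_def)
  have p: "fv p \<subseteq> {0}" and c: "fv c \<subseteq> {0, 1}" using sp by (auto simp: nontrivial_de_morgan_space_in_czf_def)
  interpret czf_theory ?T c by standard (use CZF c in auto)
  obtain H where H: "?T \<union> {} \<subseteq> H" "saturated H" "\<not> H \<turnstile> Bot" using saturation[OF T _ cons] by auto
  have m: "model ?T H" using T H by (auto simp: model_def)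
  have frel_p: "frel f d e (p\<^bold>[[x]\<^bold>]) (p\<^bold>[[x']\<^bold>])" if "vrel f d e x x'" for f d e x x'
    unfolding frel_def happ_def fren_fren
  proof (intro allI fren_cong)
    fix k i
    assume "i \<in> fv p"
    with p have "i = 0" by auto
    then show "((up ^^ k) f \<circ> (\<lambda>i. if i < length [x] then ([x] ! i) (d + k) else d + k + (i - length [x]))) i =
      (if i < length [x'] then ([x'] ! i) (e + k) else e + k + (i - length [x']))"
      using that by (simp add: vrel_def)
  qed
  note frels = frel_all frel_p
  have "H \<models> (\<^bold>\<exists>s. p\<^bold>[[s]\<^bold>] \<^bold>\<and> (\<^bold>\<forall>t. p\<^bold>[[t]\<^bold>] \<^bold>\<longrightarrow> t \<^bold>= s))"
    using sp H(1) unfolding nontrivial_de_morgan_space_in_czf_def defines_set_def holds_def by (blast intro: nd_weaken)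
  moreover have "H \<models> (\<^bold>\<exists>s. p\<^bold>[[s]\<^bold>] \<^bold>\<and> (\<^bold>\<forall>t. p\<^bold>[[t]\<^bold>] \<^bold>\<longrightarrow> t \<^bold>= s)) \<longleftrightarrow>
      (\<exists>s. H \<models> p\<^bold>[[K s]\<^bold>] \<and> H \<models> (\<^bold>\<forall>t. p\<^bold>[[t]\<^bold>] \<^bold>\<longrightarrow> t \<^bold>= K s))"
    by (rule holds_hEx_iff[OF m], (rule naturalI, (assumption | rule frels)+)[1], simp only: holds_hAnd)
  ultimately obtain s where s: "H \<models> p\<^bold>[[K s]\<^bold>]" by auto
  \<comment> \<open>The properties are provable for whatever satisfies \<open>p\<close>, so they
    transfer to the witness \<open>s\<close> supplied by saturation.\<close>
  have holds_of: "H \<models> A (K s)" if A: "T \<turnstile> holds_of p A" and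
    nat: "\<And>f d e x y. vrel f d e x y \<Longrightarrow> frel f d e (A x) (A y)" for A
  proof -
    have "H \<models> (\<^bold>\<forall>s. p\<^bold>[[s]\<^bold>] \<^bold>\<longrightarrow> A s)"
      using A H(1) unfolding holds_of_def holds_def by (blast intro: nd_weaken)
    then have "H \<models> p\<^bold>[[K s]\<^bold>] \<^bold>\<longrightarrow> A (K s)"
      by (rule holds_hAllD) (rule naturalI, (assumption | rule frels nat)+)
    then show ?thesis using s by (rule holds_hImpD)
  qed
  have "H \<models> formal_space c (K s)"
    by (rule holds_of, (use sp in \<open>simp add: nontrivial_de_morgan_space_in_czf_def\<close>)[1])
      (unfold formal_space_def, (assumption | rule frels)+)
  moreover have "H \<models> nontrivial c (K s)"
    by (rule holds_of, (use sp in \<open>simp add: nontrivial_de_morgan_space_in_czf_def\<close>)[1])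
      (unfold nontrivial_def, (assumption | rule frels)+)
  moreover have "H \<models> de_morgan c (K s)"
    by (rule holds_of, (use sp in \<open>simp add: nontrivial_de_morgan_space_in_czf_def\<close>)[1])
      (unfold de_morgan_def, (assumption | rule frels)+)
  moreover have "H \<models> compact_space c (K s)"
    by (rule holds_of, (use co in \<open>simp add: provably_compact_in_czf_def\<close>)[1])
      (unfold compact_space_def, (assumption | rule frels)+)
  ultimately have "H \<models> \<^bold>\<bottom>" by (rule compact_de_morgan_trivial[OF m])
  with H(3) show False by (simp add: holds_def hBot_def)
qed

section \<open>Type theory\<close>

subsection \<open>Substitution and derived rules\<close>

lemma up_pointwise: "up f (up g i) = up (\<lambda>i. f (g i)) i"
  by (cases i) auto

lemma eren_eren: "eren f (eren g e) = eren (\<lambda>i. f (g i)) e"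
  by (induction e arbitrary: f g) (simp_all add: up_pointwise)

lemma eup_up: "eup s (up f i) = eup (\<lambda>i. s (f i)) i"
  by (cases i) auto

lemma esub_eren: "esub s (eren f e) = esub (\<lambda>i. s (f i)) e"
  by (induction e arbitrary: s f) (simp_all add: eup_up)

lemma eren_up_Suc: "eren (up f) (eren Suc e) = eren Suc (eren f e)"
  by (simp add: eren_eren)

lemma eren_up_eup: "eren (up f) (eup s i) = eup (\<lambda>i. eren f (s i)) i"
  by (cases i) (simp_all add: eren_up_Suc)

lemma eren_esub: "eren f (esub s e) = esub (\<lambda>i. eren f (s i)) e"
  by (induction e arbitrary: s f) (simp_all add: eren_up_eup)

lemma esub_eup_Suc: "esub (eup s) (eren Suc e) = eren Suc (esub s e)"
  by (simp add: esub_eren eren_esub)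

lemma esub_eup_eup: "esub (eup s) (eup t i) = eup (\<lambda>i. esub s (t i)) i"
  by (cases i) (simp_all add: esub_eup_Suc)

lemma esub_esub: "esub s (esub t e) = esub (\<lambda>i. esub s (t i)) e"
  by (induction e arbitrary: s t) (simp_all add: esub_eup_eup)

lemma eup_Var: "eup Var i = Var i"
  by (cases i) auto

lemma eup_Var': "eup Var = Var"
  by (rule ext) (rule eup_Var)

lemma esub_Var: "esub Var e = e"
  by (induction e) (simp_all add: eup_Var')

lemma eren_as_esub: "eren f e = esub (\<lambda>i. Var (f i)) e"
  using esub_eren[of Var f e] by (simp add: esub_Var)

lemma esub_single_Suc: "esub (single a) (eren Suc e) = e"
  by (simp add: esub_eren esub_Var)

lemma single_up_Suc: "single (Var 0) (up Suc i) = Var i"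
  by (cases i) auto

lemma esub_single_up_Suc: "esub (single (Var 0)) (eren (up Suc) e) = e"
  by (simp add: esub_eren single_up_Suc esub_Var)

lemma eren_ident: "eren (\<lambda>i. i) e = e"
  by (simp add: eren_as_esub esub_Var)

text \<open>The operations on indices recurse on \<open>Suc\<close>, while expressions are written
  with numerals; these rules let the simplifier evaluate them.\<close>

lemma eup_numeral [simp]: "eup s (numeral k) = eren Suc (s (pred_numeral k))"
  by (simp add: numeral_eq_Suc)

lemma single_numeral [simp]: "single a (numeral k) = Var (pred_numeral k)"
  by (simp add: numeral_eq_Suc)

lemma up_numeral [simp]: "up f (numeral k) = Suc (f (pred_numeral k))"
  by (simp add: numeral_eq_Suc)

text \<open>Collects the arguments of an iterated application into one parallel
  substitution.\<close>

fun scons :: "'c exp \<Rightarrow> (nat \<Rightarrow> 'c exp) \<Rightarrow> nat \<Rightarrow> 'c exp" where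
  "scons a s 0 = a"
| "scons a s (Suc i) = s i"

lemma scons_numeral [simp]: "scons a s (numeral k) = s (pred_numeral k)"
  by (simp add: numeral_eq_Suc)

text \<open>Invariance under all substitutions is what is used below, and replacing every variable
  by a constant produces it.\<close>

definition closed :: "'c exp \<Rightarrow> bool" where
  "closed e \<longleftrightarrow> (\<forall>s. esub s e = e)"

lemma closed_esub: "closed e \<Longrightarrow> esub s e = e"
  by (simp add: closed_def)

lemma closed_eren: "closed e \<Longrightarrow> eren f e = e"
  by (simp add: eren_as_esub closed_def)


declare esub_single_Suc [simp] esub_eup_Suc [simp] eren_up_Suc [simp] esub_single_up_Suc [simp]

abbreviation wk :: "'c exp \<Rightarrow> 'c exp" where
  "wk \<equiv> eren Suc"

abbreviation ePi :: "'x cn exp \<Rightarrow> 'x cn exp \<Rightarrow> 'x cn exp" where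
  "ePi A B \<equiv> App (App (Cst cPi) A) B"
abbreviation eSigma :: "'x cn exp \<Rightarrow> 'x cn exp \<Rightarrow> 'x cn exp" where
  "eSigma A B \<equiv> App (App (Cst cSigma) A) B"
abbreviation ePlus :: "'x cn exp \<Rightarrow> 'x cn exp \<Rightarrow> 'x cn exp" where
  "ePlus A B \<equiv> App (App (Cst cPlus) A) B"
abbreviation eId :: "'x cn exp \<Rightarrow> 'x cn exp \<Rightarrow> 'x cn exp \<Rightarrow> 'x cn exp" where
  "eId A a b \<equiv> App (App (App (Cst cId) A) a) b"
abbreviation eList :: "'x cn exp \<Rightarrow> 'x cn exp" where
  "eList A \<equiv> App (Cst cList) A"
abbreviation eT :: "'x cn exp \<Rightarrow> 'x cn exp" where
  "eT a \<equiv> App (Cst cT) a"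
abbreviation eImp :: "'x cn exp \<Rightarrow> 'x cn exp \<Rightarrow> 'x cn exp" where
  "eImp A B \<equiv> ePi A (Lam (wk B))"
abbreviation eAnd :: "'x cn exp \<Rightarrow> 'x cn exp \<Rightarrow> 'x cn exp" where
  "eAnd A B \<equiv> eSigma A (Lam (wk B))"

lemmas hexp_defs = FunT_def ElT_def SetT_def cst_def ap_def lm_def

locale ctt_theory =
  fixes R :: "'x cn rule set"
  assumes CTT: "CTT \<subseteq> R" and GUP: "GUP_CTT \<subseteq> R"
begin

text \<open>Validity of the context is carried along, since the rules in \<open>R\<close> are
  arbitrary and a derivable judgement need not come with a valid context.\<close>

definition tm :: "'x cn exp list \<Rightarrow> 'x cn exp \<Rightarrow> 'x cn exp \<Rightarrow> bool" where
  "tm G t A \<longleftrightarrow> der R G IsCtx \<and> der R G (Elem t A)"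

definition teq :: "'x cn exp list \<Rightarrow> 'x cn exp \<Rightarrow> 'x cn exp \<Rightarrow> 'x cn exp \<Rightarrow> bool" where
  "teq G a b A \<longleftrightarrow> der R G IsCtx \<and> der R G (EqElem a b A)"

definition ty :: "'x cn exp list \<Rightarrow> 'x cn exp \<Rightarrow> bool" where
  "ty G A \<longleftrightarrow> der R G IsCtx \<and> der R G (IsType A)"

definition tr :: "'x cn exp list \<Rightarrow> 'x cn exp \<Rightarrow> bool" where
  "tr G A \<longleftrightarrow> (\<exists>t. tm G t (El A))"

text \<open>Exactly the premises of the substitution rule: \<open>s\<close> maps the variables of
  \<open>G\<close> to objects in \<open>D\<close> of the substituted types.\<close>

definition sb :: "'x cn exp list \<Rightarrow> (nat \<Rightarrow> 'x cn exp) \<Rightarrow> 'x cn exp list \<Rightarrow> bool" where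
  "sb D s G \<longleftrightarrow> der R D IsCtx \<and> (\<forall>i<length G. der R D (Elem (s i) (esub s (eren (\<lambda>j. j + Suc i) (G ! i)))))"

section \<open>Admissible rules for typing and substitution\<close>

lemma trI: "tm G t (El A) \<Longrightarrow> tr G A"
  by (auto simp: tr_def)

lemma sb_subst: "sb D s G \<Longrightarrow> der R G J \<Longrightarrow> der R D (map_jform (esub s) J)"
  unfolding sb_def by (auto intro: der.subst)

lemma tm_esub: "tm G t A \<Longrightarrow> sb D s G \<Longrightarrow> tm D (esub s t) (esub s A)"
  using sb_subst[of D s G "Elem t A"] by (auto simp: tm_def sb_def)

lemma tr_esub: "tr G A \<Longrightarrow> sb D s G \<Longrightarrow> tr D (esub s A)"
  using tm_esub by (fastforce simp: tr_def)

lemma ty_ctx: "ty G A \<Longrightarrow> der R (A # G) IsCtx"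
  by (auto simp: ty_def intro: der.ctx_cons)

lemma ty_SET: "der R G IsCtx \<Longrightarrow> ty G SET"
  by (auto simp: ty_def intro: der.SET)

lemma ty_El: "tm G A SET \<Longrightarrow> ty G (El A)"
  by (auto simp: tm_def ty_def intro: der.El)

text \<open>Weakening is no rule of the framework; it is obtained as substitution of shifted
  variables.\<close>

lemma sb_Suc:
  assumes "ty G A"
  shows "sb (A # G) (\<lambda>i. Var (Suc i)) G"
  unfolding sb_def
proof (intro conjI allI impI)
  show ctx: "der R (A # G) IsCtx" using ty_ctx[OF assms] .
  fix i assume "i < length G"
  then have "der R (A # G) (Elem (Var (Suc i)) (eren (\<lambda>j. j + Suc (Suc i)) ((A # G) ! Suc i)))"
    by (intro der.var[OF ctx]) simp
  then show "der R (A # G) (Elem (Var (Suc i)) (esub (\<lambda>i. Var (Suc i)) (eren (\<lambda>j. j + Suc i) (G ! i))))"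
    by (simp add: eren_as_esub[symmetric] eren_eren)
qed

lemma tm_weak: "tm G t A \<Longrightarrow> ty G B \<Longrightarrow> tm (B # G) (wk t) (wk A)"
  using tm_esub[OF _ sb_Suc] by (simp add: eren_as_esub)

lemma tr_weak: "tr G A \<Longrightarrow> ty G B \<Longrightarrow> tr (B # G) (wk A)"
  using tr_esub[OF _ sb_Suc] by (simp add: eren_as_esub)

lemma tm_var0: "ty G A \<Longrightarrow> tm (A # G) (Var 0) (wk A)"
  using der.var[OF ty_ctx, of G A 0] ty_ctx by (simp add: tm_def)

lemma tm_app: "tm G f (Fun A B) \<Longrightarrow> tm G a A \<Longrightarrow> C = esub (single a) B \<Longrightarrow> tm G (App f a) C"
  by (auto simp: tm_def intro: der.app)

lemma tm_lam: "tm (A # G) b B \<Longrightarrow> ty G A \<Longrightarrow> tm G (Lam b) (Fun A B)"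
  by (auto simp: tm_def ty_def intro: der.abs)

lemma ty_Fun: "ty G A \<Longrightarrow> ty (A # G) B \<Longrightarrow> ty G (Fun A B)"
  by (auto simp: ty_def intro: der.Fun)

lemma sb_eup:
  assumes s: "sb D s G" and A: "ty G A"
  shows "sb (esub s A # D) (eup s) (A # G)"
proof -
  have "der R D (IsType (esub s A))" using sb_subst[OF s, of "IsType A"] A by (simp add: ty_def)
  then have t: "ty D (esub s A)" using s by (simp add: ty_def sb_def)
  show ?thesis unfolding sb_def
  proof (intro conjI allI impI)
    show "der R (esub s A # D) IsCtx" using ty_ctx[OF t] .
    fix i assume i: "i < length (A # G)"
    show "der R (esub s A # D) (Elem (eup s i) (esub (eup s) (eren (\<lambda>j. j + Suc i) ((A # G) ! i))))"
    proof (cases i)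
      case 0
      have "tm (esub s A # D) (Var 0) (wk (esub s A))" by (rule tm_var0[OF t])
      then show ?thesis using 0 by (simp add: tm_def esub_eup_Suc)
    next
      case (Suc k)
      then have "tm D (s k) (esub s (eren (\<lambda>j. j + Suc k) (G ! k)))"
        using s i by (simp add: sb_def tm_def)
      from tm_weak[OF this t] show ?thesis using Suc
        by (simp add: tm_def eren_esub esub_eren)
    qed
  qed
qed

lemma sb_single:
  assumes a: "tm G a A"
  shows "sb G (single a) (A # G)"
  unfolding sb_def
proof (intro conjI allI impI)
  show ctx: "der R G IsCtx" using a by (simp add: tm_def)
  fix i assume "i < length (A # G)"
  then show "der R G (Elem (single a i) (esub (single a) (eren (\<lambda>j. j + Suc i) ((A # G) ! i))))"
    using a der.var[OF ctx, of "i - 1"]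
    by (cases i) (auto simp: tm_def esub_eren esub_Var eren_as_esub[symmetric] eren_ident)
qed

lemma teq_beta: "tm (A # G) b B \<Longrightarrow> tm G a A \<Longrightarrow> teq G (App (Lam b) a) (esub (single a) b) (esub (single a) B)"
  by (auto simp: tm_def teq_def intro: der.beta)

lemma teq_sym: "teq G a b A \<Longrightarrow> teq G b a A"
  by (auto simp: teq_def intro: der.elem_sym)

lemma teq_trans: "teq G a b A \<Longrightarrow> teq G b c A \<Longrightarrow> teq G a c A"
  by (auto simp: teq_def intro: der.elem_trans)

lemma teq_refl: "tm G a A \<Longrightarrow> teq G a a A"
  by (auto simp: teq_def tm_def intro: der.elem_refl)

lemma teq_app: "teq G f g (Fun A B) \<Longrightarrow> teq G a b A \<Longrightarrow> C = esub (single a) B \<Longrightarrow> teq G (App f a) (App g b) C"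
  by (auto simp: teq_def intro: der.app_eq)

lemma tm_conv: "tm G t (El A) \<Longrightarrow> teq G A B SET \<Longrightarrow> tm G t (El B)"
  by (auto simp: tm_def teq_def intro: der.elem_conv der.El_eq)

lemma tr_conv: "tr G A \<Longrightarrow> teq G A B SET \<Longrightarrow> tr G B"
  by (auto simp: tr_def intro: tm_conv)

lemma tr_conv_iff: "teq G A B SET \<Longrightarrow> tr G A \<longleftrightarrow> tr G B"
  by (blast intro: tr_conv teq_sym)

text \<open>\<open>beta\<close> for a weakened abstraction applied to the new variable, which gives
  back the body. The body has to be typed under one more binder for this, hence the lifted
  substitution.\<close>

lemma teq_beta_up:
  assumes b: "tm (A # G) b B" and A: "ty G A"
  shows "teq (A # G) (App (wk (Lam b)) (Var 0)) b B"
proof -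
  have A': "ty (A # G) (wk A)"
    using sb_subst[OF sb_Suc[OF A], of "IsType A"] A ty_ctx[OF A] by (simp add: ty_def eren_as_esub)
  have "sb (wk A # A # G) (eup (\<lambda>i. Var (Suc i))) (A # G)"
    using sb_eup[OF sb_Suc[OF A] A] by (simp add: eren_as_esub)
  moreover have "eup (\<lambda>i. Var (Suc i)) = (\<lambda>i. Var (up Suc i) :: 'x cn exp)"
  proof
    show "eup (\<lambda>i. Var (Suc i)) i = (Var (up Suc i) :: 'x cn exp)" for i by (cases i) auto
  qed
  ultimately have "tm (wk A # A # G) (eren (up Suc) b) (eren (up Suc) B)"
    using tm_esub[OF b] by (simp add: eren_as_esub)
  from teq_beta[OF this tm_var0[OF A]] show ?thesis by (simp add: esub_single_up_Suc)
qed

subsection \<open>The constants\<close>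

text \<open>The identity substitution is left standing in the type so that the conclusion fits
  \<open>tm_step\<close>.\<close>

lemma tm_empty_context:
  assumes "tm [] t A" and "der R G IsCtx"
  shows "tm G t (esub Var A)"
proof -
  have "sb G Var []" using assms(2) by (simp add: sb_def)
  from tm_esub[OF assms(1) this] show ?thesis by (simp add: esub_Var)
qed

lemma tm_decl:
  assumes "decl k A \<in> R" and "der R G IsCtx"
  shows "tm G (Cst k) (esub Var (A 0))"
proof -
  have "der R [] (Elem (Cst k) (A 0))"
    using der.rule[of "[]" "[]" "Elem (Cst k) (A 0)" R] assms(1) by (simp add: decl_def)
  then show ?thesis by (intro tm_empty_context assms(2)) (simp add: tm_def der.ctx_nil)
qed

text \<open>The type stays a declared type under a delayed substitution, which grows by one entry
  per argument. A constant with many arguments is typed by iterating this and evaluating once at the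
  end.\<close>

lemma tm_step:
  assumes "tm G f (esub s (Fun A B))" and "tm G a (esub s A)"
  shows "tm G (App f a) (esub (scons a s) B)"
proof -
  have "(\<lambda>i. esub (single a) (eup s i)) = scons a s"
  proof
    show "esub (single a) (eup s i) = scons a s i" for i by (cases i) simp_all
  qed
  then show ?thesis using tm_app[of G f "esub s A" "esub (eup s) B" a] assms by (simp add: esub_esub)
qed

lemma tr_step: "tm G f (esub s (Fun A (El B))) \<Longrightarrow> tm G a (esub s A) \<Longrightarrow> tr G (esub (scons a s) B)"
  using tm_step[of G f s A "El B" a] by (auto intro: trI)

lemma decl_R: "x \<in> CTT_decls \<Longrightarrow> x \<in> R"
  using CTT by (auto simp: CTT_def)

lemma tm_ctx: "tm G t A \<Longrightarrow> der R G IsCtx"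
  by (simp add: tm_def)

section \<open>Typing and logical rules of the constants\<close>

lemma tm_cN0: "der R G IsCtx \<Longrightarrow> tm G (Cst cN0) SET"
  using tm_decl[OF decl_R, of cN0 SetT] by (simp add: CTT_decls_def hexp_defs)

lemma tm_cN1: "der R G IsCtx \<Longrightarrow> tm G (Cst cN1) SET"
  using tm_decl[OF decl_R, of cN1 SetT] by (simp add: CTT_decls_def hexp_defs)

lemma tm_cStar: "der R G IsCtx \<Longrightarrow> tm G (Cst cStar) (El (Cst cN1))"
  using tm_decl[OF decl_R, of cStar "ElT N1"] by (simp add: CTT_decls_def hexp_defs)

lemma tm_cPi:
  assumes "tm G A SET" and "tm G B (Fun (El A) SET)"
  shows "tm G (ePi A B) SET"
proof -
  have "decl cPi (FunT SetT (\<lambda>A. (ElT A \<^bold>\<Rightarrow> SetT) \<^bold>\<Rightarrow> SetT)) \<in> R" by (rule decl_R) (simp add: CTT_decls_def)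
  from tm_step[OF tm_step[OF tm_decl[OF this tm_ctx[OF assms(1)], unfolded hexp_defs], of A], of B]
  show ?thesis using assms by (simp add: eval_nat_numeral)
qed

lemma tm_cSigma:
  assumes "tm G A SET" and "tm G B (Fun (El A) SET)"
  shows "tm G (eSigma A B) SET"
proof -
  have "decl cSigma (FunT SetT (\<lambda>A. (ElT A \<^bold>\<Rightarrow> SetT) \<^bold>\<Rightarrow> SetT)) \<in> R" by (rule decl_R) (simp add: CTT_decls_def)
  from tm_step[OF tm_step[OF tm_decl[OF this tm_ctx[OF assms(1)], unfolded hexp_defs], of A], of B]
  show ?thesis using assms by (simp add: eval_nat_numeral)
qed

lemma tm_cPlus:
  assumes "tm G A SET" and "tm G B SET"
  shows "tm G (ePlus A B) SET"
proof -
  have "decl cPlus (SetT \<^bold>\<Rightarrow> SetT \<^bold>\<Rightarrow> SetT) \<in> R" by (rule decl_R) (simp add: CTT_decls_def)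
  from tm_step[OF tm_step[OF tm_decl[OF this tm_ctx[OF assms(1)], unfolded hexp_defs], of A], of B]
  show ?thesis using assms by (simp add: eval_nat_numeral)
qed

lemma tm_cId:
  assumes "tm G A SET" and "tm G a (El A)" and "tm G b (El A)"
  shows "tm G (eId A a b) SET"
proof -
  have "decl cId (FunT SetT (\<lambda>A. ElT A \<^bold>\<Rightarrow> ElT A \<^bold>\<Rightarrow> SetT)) \<in> R" by (rule decl_R) (simp add: CTT_decls_def)
  from tm_step[OF tm_step[OF tm_step[OF tm_decl[OF this tm_ctx[OF assms(1)], unfolded hexp_defs], of A], of a], of b]
  show ?thesis using assms by (simp add: eval_nat_numeral)
qed

lemma tm_cList:
  assumes "tm G A SET"
  shows "tm G (eList A) SET"
proof -
  have "decl cList (SetT \<^bold>\<Rightarrow> SetT) \<in> R" by (rule decl_R) (simp add: CTT_decls_def)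
  from tm_step[OF tm_decl[OF this tm_ctx[OF assms], unfolded hexp_defs], of A]
  show ?thesis using assms by (simp add: eval_nat_numeral)
qed

lemma tm_cU: "der R G IsCtx \<Longrightarrow> tm G (Cst cU) SET"
  using tm_decl[OF decl_R, of cU SetT] by (simp add: CTT_decls_def hexp_defs)

lemma tm_uN0: "der R G IsCtx \<Longrightarrow> tm G (Cst uN0) (El (Cst cU))"
  using tm_decl[OF decl_R, of uN0 "ElT US"] by (simp add: CTT_decls_def hexp_defs)

lemma tm_uN1: "der R G IsCtx \<Longrightarrow> tm G (Cst uN1) (El (Cst cU))"
  using tm_decl[OF decl_R, of uN1 "ElT US"] by (simp add: CTT_decls_def hexp_defs)

lemma tm_cT:
  assumes "tm G a (El (Cst cU))"
  shows "tm G (eT a) SET"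
proof -
  have "decl cT (ElT US \<^bold>\<Rightarrow> SetT) \<in> R" by (rule decl_R) (simp add: CTT_decls_def)
  from tm_step[OF tm_decl[OF this tm_ctx[OF assms], unfolded hexp_defs], of a]
  show ?thesis using assms by (simp add: eval_nat_numeral)
qed

lemma tr_N0E:
  assumes "tr G (Cst cN0)" and A: "tm G A SET"
  shows "tr G A"
proof -
  obtain t where t: "tm G t (El (Cst cN0))" using assms(1) by (auto simp: tr_def)
  have N0: "ty G (El (Cst cN0))" by (rule ty_El[OF tm_cN0[OF tm_ctx[OF A]]])
  have b: "tm (El (Cst cN0) # G) (wk A) SET" using tm_weak[OF A N0] by simp
  have "decl cCase0 (FunT (ElT N0 \<^bold>\<Rightarrow> SetT) (\<lambda>C. FunT (ElT N0) (\<lambda>a. ElT (C \<cdot> a)))) \<in> R"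
    by (rule decl_R) (simp add: CTT_decls_def)
  from tr_step[OF tm_step[OF tm_decl[OF this tm_ctx[OF A], unfolded hexp_defs], of "Lam (wk A)"], of t]
  have "tr G (App (Lam (wk A)) t)" using tm_lam[OF b N0] t by simp
  moreover have "teq G (App (Lam (wk A)) t) A SET" using teq_beta[OF b t] by simp
  ultimately show ?thesis by (rule tr_conv)
qed

lemma tr_N1: "der R G IsCtx \<Longrightarrow> tr G (Cst cN1)"
  by (rule trI) (rule tm_cStar)

lemma tr_IdI:
  assumes "tm G A SET" and "tm G a (El A)"
  shows "tr G (eId A a a)"
proof -
  have "decl cRefl (FunT SetT (\<lambda>A. FunT (ElT A) (\<lambda>a. ElT (IdS A a a)))) \<in> R" by (rule decl_R) (simp add: CTT_decls_def)
  from tr_step[OF tm_step[OF tm_decl[OF this tm_ctx[OF assms(1)], unfolded hexp_defs], of A], of a]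
  show ?thesis using assms by (simp add: eval_nat_numeral)
qed

lemma tr_PiI_family:
  assumes A: "tm G A SET" and B: "tm G B (Fun (El A) SET)" and b: "tr (El A # G) (App (wk B) (Var 0))"
  shows "tr G (ePi A B)"
proof -
  obtain t where t: "tm (El A # G) t (El (App (wk B) (Var 0)))" using b by (auto simp: tr_def)
  have "decl cLambda (FunT SetT (\<lambda>A. FunT (ElT A \<^bold>\<Rightarrow> SetT) (\<lambda>B.
      FunT (ElT A) (\<lambda>x. ElT (B \<cdot> x)) \<^bold>\<Rightarrow> ElT (PiS A B)))) \<in> R" by (rule decl_R) (simp add: CTT_decls_def)
  from tr_step[OF tm_step[OF tm_step[OF tm_decl[OF this tm_ctx[OF A], unfolded hexp_defs], of A], of B], of "Lam t"]
  show ?thesis using A B tm_lam[OF t ty_El[OF A]] by (simp add: eval_nat_numeral)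
qed

lemma tr_PiE_family:
  assumes A: "tm G A SET" and B: "tm G B (Fun (El A) SET)" and f: "tr G (ePi A B)" and a: "tm G a (El A)"
  shows "tr G (App B a)"
proof -
  obtain t where t: "tm G t (El (ePi A B))" using f by (auto simp: tr_def)
  have "decl cApply (FunT SetT (\<lambda>A. FunT (ElT A \<^bold>\<Rightarrow> SetT) (\<lambda>B.
      ElT (PiS A B) \<^bold>\<Rightarrow> FunT (ElT A) (\<lambda>x. ElT (B \<cdot> x))))) \<in> R" by (rule decl_R) (simp add: CTT_decls_def)
  from tr_step[OF tm_step[OF tm_step[OF tm_step[OF tm_decl[OF this tm_ctx[OF A], unfolded hexp_defs], of A], of B], of t], of a]
  show ?thesis using A B t a by (simp add: eval_nat_numeral)
qed

lemma tm_cPair: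
  assumes A: "tm G A SET" and B: "tm G B (Fun (El A) SET)" and a: "tm G a (El A)" and b: "tm G b (El (App B a))"
  shows "tm G (App (App (App (App (Cst cPair) A) B) a) b) (El (eSigma A B))"
proof -
  have "decl cPair (FunT SetT (\<lambda>A. FunT (ElT A \<^bold>\<Rightarrow> SetT) (\<lambda>B.
      FunT (ElT A) (\<lambda>x. ElT (B \<cdot> x) \<^bold>\<Rightarrow> ElT (SigmaS A B))))) \<in> R" by (rule decl_R) (simp add: CTT_decls_def)
  from tm_step[OF tm_step[OF tm_step[OF tm_step[OF tm_decl[OF this tm_ctx[OF A], unfolded hexp_defs], of A], of B], of a], of b]
  show ?thesis using assms by (simp add: eval_nat_numeral)
qed

lemma tm_cSplit:
  assumes A: "tm G A SET" and B: "tm G B (Fun (El A) SET)" and C: "tm G C (Fun (El (eSigma A B)) SET)"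
    and e: "tm G e (Fun (El A) (Fun (El (App (wk B) (Var 0))) (El (App (wk (wk C))
      (App (App (App (App (Cst cPair) (wk (wk A))) (wk (wk B))) (Var 1)) (Var 0))))))"
    and p: "tm G p (El (eSigma A B))"
  shows "tm G (App (App (App (App (App (Cst cSplit) A) B) C) e) p) (El (App C p))"
proof -
  have "decl cSplit (FunT SetT (\<lambda>A. FunT (ElT A \<^bold>\<Rightarrow> SetT) (\<lambda>B. FunT (ElT (SigmaS A B) \<^bold>\<Rightarrow> SetT) (\<lambda>C.
      FunT (ElT A) (\<lambda>x. FunT (ElT (B \<cdot> x)) (\<lambda>y. ElT (C \<cdot> (cst cPair \<cdot> A \<cdot> B \<cdot> x \<cdot> y)))) \<^bold>\<Rightarrow>
      FunT (ElT (SigmaS A B)) (\<lambda>p. ElT (C \<cdot> p)))))) \<in> R" by (rule decl_R) (simp add: CTT_decls_def)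
  from tm_step[OF tm_step[OF tm_step[OF tm_step[OF tm_step[OF tm_decl[OF this tm_ctx[OF A], unfolded hexp_defs], of A], of B], of C], of e], of p]
  show ?thesis using assms by (simp add: eval_nat_numeral)
qed

lemma tm_family: "tm (El A # G) b SET \<Longrightarrow> tm G A SET \<Longrightarrow> tm G (Lam b) (Fun (El A) SET)"
  by (rule tm_lam[OF _ ty_El])

lemma tr_PiI:
  assumes A: "tm G A SET" and b: "tm (El A # G) b SET" and "tr (El A # G) b"
  shows "tr G (ePi A (Lam b))"
  by (rule tr_PiI_family[OF A tm_family[OF b A]])
    (rule tr_conv[OF assms(3) teq_sym[OF teq_beta_up[OF b ty_El[OF A]]]])

lemma tr_PiE:
  assumes A: "tm G A SET" and b: "tm (El A # G) b SET" and f: "tr G (ePi A (Lam b))" and a: "tm G a (El A)"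
  shows "tr G (esub (single a) b)"
proof -
  have "teq G (App (Lam b) a) (esub (single a) b) SET" using teq_beta[OF b a] by simp
  then show ?thesis by (rule tr_conv[OF tr_PiE_family[OF A tm_family[OF b A] f a]])
qed

lemma tm_eImp: "tm G A SET \<Longrightarrow> tm G B SET \<Longrightarrow> tm G (eImp A B) SET"
  by (rule tm_cPi) (use tm_weak[OF _ ty_El, of G B SET A] in \<open>auto intro: tm_family\<close>)

lemma tm_eAnd: "tm G A SET \<Longrightarrow> tm G B SET \<Longrightarrow> tm G (eAnd A B) SET"
  by (rule tm_cSigma) (use tm_weak[OF _ ty_El, of G B SET A] in \<open>auto intro: tm_family\<close>)

lemma tr_ImpI:
  assumes A: "tm G A SET" and B: "tm G B SET" and "tr (El A # G) (wk B)"
  shows "tr G (eImp A B)"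
  using tr_PiI[OF A _ assms(3)] tm_weak[OF B ty_El[OF A]] by simp

lemma tr_ImpE:
  assumes A: "tm G A SET" and B: "tm G B SET" and "tr G (eImp A B)" and "tr G A"
  shows "tr G B"
proof -
  obtain a where "tm G a (El A)" using assms(4) by (auto simp: tr_def)
  from tr_PiE[OF A _ assms(3) this] tm_weak[OF B ty_El[OF A]] show ?thesis by simp
qed

lemma sb_cons:
  assumes s: "sb D s G" and a: "tm D a (esub s A)"
  shows "sb D (scons a s) (A # G)"
  unfolding sb_def
proof (intro conjI allI impI)
  show "der R D IsCtx" using a by (simp add: tm_def)
  fix i assume "i < length (A # G)"
  then show "der R D (Elem (scons a s i) (esub (scons a s) (eren (\<lambda>j. j + Suc i) ((A # G) ! i))))"
    using a s by (cases i) (auto simp: tm_def sb_def esub_eren)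
qed

lemma tm_var: "der R G IsCtx \<Longrightarrow> i < length G \<Longrightarrow> tm G (Var i) (eren (\<lambda>j. j + Suc i) (G ! i))"
  using der.var[of R G i] by (simp add: tm_def)

lemma teq_weak: "teq G a b A \<Longrightarrow> ty G B \<Longrightarrow> teq (B # G) (wk a) (wk b) (wk A)"
  using sb_subst[OF sb_Suc, of G B "EqElem a b A"] ty_ctx by (auto simp: teq_def eren_as_esub)

lemma teq_esub: "teq G a b A \<Longrightarrow> sb D s G \<Longrightarrow> teq D (esub s a) (esub s b) (esub s A)"
  using sb_subst[of D s G "EqElem a b A"] by (auto simp: teq_def sb_def)

text \<open>Equal abstractions have equal bodies: apply both to a new variable and reduce.\<close>

lemma teq_LamD:
  assumes lr: "teq G (Lam l) (Lam r) (Fun A B)" and A: "ty G A"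
    and l: "tm (A # G) l B" and r: "tm (A # G) r B"
  shows "teq (A # G) l r B"
proof -
  have "teq (A # G) (App (wk (Lam l)) (Var 0)) (App (wk (Lam r)) (Var 0)) B"
    using teq_app[OF teq_weak[OF lr A, simplified] teq_refl[OF tm_var0[OF A]] refl] by simp
  then show ?thesis using teq_beta_up[OF l A] teq_beta_up[OF r A] by (blast intro: teq_trans teq_sym)
qed

abbreviation ePair :: "'x cn exp \<Rightarrow> 'x cn exp \<Rightarrow> 'x cn exp \<Rightarrow> 'x cn exp \<Rightarrow> 'x cn exp" where
  "ePair A B a b \<equiv> App (App (App (App (Cst cPair) A) B) a) b"
abbreviation eSplit :: "'x cn exp \<Rightarrow> 'x cn exp \<Rightarrow> 'x cn exp \<Rightarrow> 'x cn exp \<Rightarrow> 'x cn exp \<Rightarrow> 'x cn exp" where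
  "eSplit A B C e p \<equiv> App (App (App (App (App (Cst cSplit) A) B) C) e) p"
abbreviation tySplit :: "'x cn exp \<Rightarrow> 'x cn exp \<Rightarrow> 'x cn exp \<Rightarrow> 'x cn exp" where
  "tySplit A B C \<equiv> Fun (El A) (Fun (El (App (wk B) (Var 0))) (El (App (wk (wk C))
      (ePair (wk (wk A)) (wk (wk B)) (Var 1) (Var 0)))))"

text \<open>The generic pair: in the context of its two components, \<open>Var 1\<close> is the
  first and \<open>Var 0\<close> the second. Methods for \<open>cSplit\<close> are typed
  there.\<close>

lemma pair_context:
  assumes A: "tm G A SET" and B: "tm G B (Fun (El A) SET)"
  defines "G1 \<equiv> El A # G" defines "G2 \<equiv> El (App (wk B) (Var 0)) # G1"
  shows "ty G (El A)" and "ty G1 (El (App (wk B) (Var 0)))"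
    and "tm G2 (wk (wk A)) SET" and "tm G2 (wk (wk B)) (Fun (El (wk (wk A))) SET)"
    and "tm G2 (Var 1) (El (wk (wk A)))" and "tm G2 (Var 0) (El (App (wk (wk B)) (Var 1)))"
    and "tm G2 (ePair (wk (wk A)) (wk (wk B)) (Var 1) (Var 0)) (El (eSigma (wk (wk A)) (wk (wk B))))"
proof -
  show 1: "ty G (El A)" by (rule ty_El[OF A])
  have A1: "tm G1 (wk A) SET" using tm_weak[OF A 1] by (simp add: G1_def)
  have B1: "tm G1 (wk B) (Fun (El (wk A)) SET)" using tm_weak[OF B 1] by (simp add: G1_def)
  have v: "tm G1 (Var 0) (El (wk A))" using tm_var0[OF 1] by (simp add: G1_def)
  have "tm G1 (App (wk B) (Var 0)) SET" using tm_app[OF B1 v] by simp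
  then show 2: "ty G1 (El (App (wk B) (Var 0)))" by (rule ty_El)
  show A2: "tm G2 (wk (wk A)) SET" using tm_weak[OF A1 2] by (simp add: G2_def)
  show B2: "tm G2 (wk (wk B)) (Fun (El (wk (wk A))) SET)"
    using tm_weak[OF B1 2] by (simp add: G2_def)
  show v1: "tm G2 (Var 1) (El (wk (wk A)))" using tm_weak[OF v 2] by (simp add: G2_def)
  show v0: "tm G2 (Var 0) (El (App (wk (wk B)) (Var 1)))" using tm_var0[OF 2] by (simp add: G2_def)
  show "tm G2 (ePair (wk (wk A)) (wk (wk B)) (Var 1) (Var 0)) (El (eSigma (wk (wk A)) (wk (wk B))))"
    by (rule tm_cPair[OF A2 B2 v1 v0])
qed

lemma ty_split:
  assumes A: "tm G A SET" and B: "tm G B (Fun (El A) SET)" and C: "tm G C (Fun (El (eSigma A B)) SET)"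
  shows "ty G (tySplit A B C)"
proof -
  note c = pair_context[OF A B]
  have C2: "tm (El (App (wk B) (Var 0)) # El A # G) (wk (wk C))
      (Fun (El (eSigma (wk (wk A)) (wk (wk B)))) SET)"
    using tm_weak[OF tm_weak[OF C c(1)] c(2)] by simp
  have "tm (El (App (wk B) (Var 0)) # El A # G) (App (wk (wk C))
      (ePair (wk (wk A)) (wk (wk B)) (Var 1) (Var 0))) SET"
    using tm_app[OF C2 c(7)] by simp
  then show ?thesis by (intro ty_Fun[OF c(1)] ty_Fun[OF c(2)] ty_El)
qed

text \<open>The computation rule is an equation between closed abstractions. It is opened in the context of
  generic arguments rather than applied to given ones, as each \<open>beta\<close> step asks for the type of the body.\<close>

lemma teq_split_generic:
  defines "G1 \<equiv> [SET :: 'x cn exp]"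
  defines "G2 \<equiv> Fun (El (Var 0)) SET # G1"
  defines "G3 \<equiv> Fun (El (eSigma (Var 1) (Var 0))) SET # G2"
  defines "G4 \<equiv> tySplit (Var 2) (Var 1) (Var 0) # G3"
  defines "G5 \<equiv> El (Var 3) # G4"
  defines "G6 \<equiv> El (App (Var 3) (Var 0)) # G5"
  shows "teq G6 (eSplit (Var 5) (Var 4) (Var 3) (Var 2) (ePair (Var 5) (Var 4) (Var 1) (Var 0)))
    (App (App (Var 2) (Var 1)) (Var 0)) (El (App (Var 3) (ePair (Var 5) (Var 4) (Var 1) (Var 0))))"
    (is "teq G6 ?l ?r ?C")
proof -
  have t1: "ty [] (SET :: 'x cn exp)" by (rule ty_SET[OF der.ctx_nil])
  have c1: "der R G1 IsCtx" using ty_ctx[OF t1] by (simp add: G1_def)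
  have t2: "ty G1 (Fun (El (Var 0)) SET)"
  proof -
    have A: "tm G1 (Var 0) SET" using tm_var[OF c1, of 0] by (simp add: G1_def)
    show ?thesis by (rule ty_Fun[OF ty_El[OF A] ty_SET[OF ty_ctx[OF ty_El[OF A]]]])
  qed
  have c2: "der R G2 IsCtx" using ty_ctx[OF t2] by (simp add: G2_def)
  have t3: "ty G2 (Fun (El (eSigma (Var 1) (Var 0))) SET)"
  proof -
    have A: "tm G2 (Var 1) SET" using tm_var[OF c2, of 1] by (simp add: G2_def G1_def)
    have B: "tm G2 (Var 0) (Fun (El (Var 1)) SET)" using tm_var[OF c2, of 0] by (simp add: G2_def G1_def)
    note S = tm_cSigma[OF A B]
    show ?thesis by (rule ty_Fun[OF ty_El[OF S] ty_SET[OF ty_ctx[OF ty_El[OF S]]]])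
  qed
  have c3: "der R G3 IsCtx" using ty_ctx[OF t3] by (simp add: G3_def)
  have t4: "ty G3 (tySplit (Var 2) (Var 1) (Var 0))"
  proof (rule ty_split)
    show "tm G3 (Var 2) SET" using tm_var[OF c3, of 2] by (simp add: G3_def G2_def G1_def)
    show "tm G3 (Var 1) (Fun (El (Var 2)) SET)"
      using tm_var[OF c3, of 1] by (simp add: G3_def G2_def G1_def numeral_2_eq_2)
    show "tm G3 (Var 0) (Fun (El (eSigma (Var 2) (Var 1))) SET)"
      using tm_var[OF c3, of 0] by (simp add: G3_def G2_def G1_def numeral_2_eq_2)
  qed
  have c4: "der R G4 IsCtx" using ty_ctx[OF t4] by (simp add: G4_def)
  note defs = G6_def G5_def G4_def G3_def G2_def G1_def eval_nat_numeral
  have t5: "ty G4 (El (Var 3))" by (rule ty_El) (use tm_var[OF c4, of 3] in \<open>simp add: defs\<close>)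
  have c5: "der R G5 IsCtx" using ty_ctx[OF t5] by (simp add: G5_def)
  have t6: "ty G5 (El (App (Var 3) (Var 0)))"
  proof (rule ty_El)
    have "tm G5 (Var 3) (Fun (El (Var 4)) SET)" using tm_var[OF c5, of 3] by (simp add: defs)
    moreover have "tm G5 (Var 0) (El (Var 4))" using tm_var[OF c5, of 0] by (simp add: defs)
    ultimately show "tm G5 (App (Var 3) (Var 0)) SET" by (rule tm_app) simp
  qed
  have c6: "der R G6 IsCtx" using ty_ctx[OF t6] by (simp add: G6_def)
  have A: "tm G6 (Var 5) SET" using tm_var[OF c6, of 5] by (simp add: defs)
  have B: "tm G6 (Var 4) (Fun (El (Var 5)) SET)" using tm_var[OF c6, of 4] by (simp add: defs)
  have C: "tm G6 (Var 3) (Fun (El (eSigma (Var 5) (Var 4))) SET)" using tm_var[OF c6, of 3] by (simp add: defs)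
  have e: "tm G6 (Var 2) (tySplit (Var 5) (Var 4) (Var 3))" using tm_var[OF c6, of 2] by (simp add: defs)
  have a: "tm G6 (Var 1) (El (Var 5))" using tm_var[OF c6, of 1] by (simp add: defs)
  have b: "tm G6 (Var 0) (El (App (Var 4) (Var 1)))" using tm_var[OF c6, of 0] by (simp add: defs)
  have l: "tm G6 ?l ?C" by (rule tm_cSplit[OF A B C e tm_cPair[OF A B a b]])
  have "tm G6 (App (Var 2) (Var 1)) (Fun (El (App (Var 4) (Var 1)))
      (El (App (Var 4) (ePair (Var 6) (Var 5) (Var 2) (Var 0)))))"
    using tm_app[OF e a refl] by (simp add: eval_nat_numeral)
  from tm_app[OF this b] have r: "tm G6 ?r ?C" by (simp add: eval_nat_numeral)
  have "law (FunT SetT (\<lambda>A. FunT (ElT A \<^bold>\<Rightarrow> SetT) (\<lambda>B. FunT (ElT (SigmaS A B) \<^bold>\<Rightarrow> SetT) (\<lambda>C.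
        FunT (ElT A) (\<lambda>x. FunT (ElT (B \<cdot> x)) (\<lambda>y. ElT (C \<cdot> (cst cPair \<cdot> A \<cdot> B \<cdot> x \<cdot> y)))) \<^bold>\<Rightarrow>
        FunT (ElT A) (\<lambda>a. FunT (ElT (B \<cdot> a)) (\<lambda>b. ElT (C \<cdot> (cst cPair \<cdot> A \<cdot> B \<cdot> a \<cdot> b))))))))
      (\<^bold>\<lambda>A. \<^bold>\<lambda>B. \<^bold>\<lambda>C. \<^bold>\<lambda>e. \<^bold>\<lambda>a. \<^bold>\<lambda>b. cst cSplit \<cdot> A \<cdot> B \<cdot> C \<cdot> e \<cdot> (cst cPair \<cdot> A \<cdot> B \<cdot> a \<cdot> b))
      (\<^bold>\<lambda>A. \<^bold>\<lambda>B. \<^bold>\<lambda>C. \<^bold>\<lambda>e. \<^bold>\<lambda>a. \<^bold>\<lambda>b. e \<cdot> a \<cdot> b) \<in> R"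
    using CTT unfolding CTT_def CTT_laws_def by blast
  from der.rule[OF this[unfolded law_def]]
  have "teq [] (Lam (Lam (Lam (Lam (Lam (Lam ?l)))))) (Lam (Lam (Lam (Lam (Lam (Lam ?r))))))
    (Fun SET (Fun (Fun (El (Var 0)) SET) (Fun (Fun (El (eSigma (Var 1) (Var 0))) SET)
      (Fun (tySplit (Var 2) (Var 1) (Var 0)) (Fun (El (Var 3)) (Fun (El (App (Var 3) (Var 0))) ?C))))))"
    by (simp add: teq_def der.ctx_nil hexp_defs eval_nat_numeral)
  note eq0 = this
  note l5 = tm_lam[OF l[unfolded G6_def] t6] and r5 = tm_lam[OF r[unfolded G6_def] t6]
  note l4 = tm_lam[OF l5[unfolded G5_def] t5] and r4 = tm_lam[OF r5[unfolded G5_def] t5]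
  note l3 = tm_lam[OF l4[unfolded G4_def] t4] and r3 = tm_lam[OF r4[unfolded G4_def] t4]
  note l2 = tm_lam[OF l3[unfolded G3_def] t3] and r2 = tm_lam[OF r3[unfolded G3_def] t3]
  note l1 = tm_lam[OF l2[unfolded G2_def] t2] and r1 = tm_lam[OF r2[unfolded G2_def] t2]
  note eq1 = teq_LamD[OF eq0 t1 l1[unfolded G1_def] r1[unfolded G1_def], folded G1_def]
  note eq2 = teq_LamD[OF eq1 t2 l2[unfolded G2_def] r2[unfolded G2_def], folded G2_def]
  note eq3 = teq_LamD[OF eq2 t3 l3[unfolded G3_def] r3[unfolded G3_def], folded G3_def]
  note eq4 = teq_LamD[OF eq3 t4 l4[unfolded G4_def] r4[unfolded G4_def], folded G4_def]
  note eq5 = teq_LamD[OF eq4 t5 l5[unfolded G5_def] r5[unfolded G5_def], folded G5_def]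
  show ?thesis by (rule teq_LamD[OF eq5 t6 l[unfolded G6_def] r[unfolded G6_def], folded G6_def])
qed

text \<open>The generic equation under the substitution of six given arguments, which is checked to
  respect the context one entry at a time.\<close>

lemma teq_split:
  assumes A: "tm G A SET" and B: "tm G B (Fun (El A) SET)" and C: "tm G C (Fun (El (eSigma A B)) SET)"
    and e: "tm G e (tySplit A B C)" and a: "tm G a (El A)" and b: "tm G b (El (App B a))"
  shows "teq G (eSplit A B C e (ePair A B a b)) (App (App e a) b) (El (App C (ePair A B a b)))"
proof -
  have "sb G Var []" using tm_ctx[OF A] by (simp add: sb_def)
  from sb_cons[OF this, of A SET] A have "sb G (scons A Var) [SET]" by simp
  from sb_cons[OF this, of B "Fun (El (Var 0)) SET"] B
  have "sb G (scons B (scons A Var)) [Fun (El (Var 0)) SET, SET]" by simp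
  from sb_cons[OF this, of C "Fun (El (eSigma (Var 1) (Var 0))) SET"] C
  have "sb G (scons C (scons B (scons A Var))) [Fun (El (eSigma (Var 1) (Var 0))) SET, Fun (El (Var 0)) SET, SET]"
    by simp
  from sb_cons[OF this, of e "tySplit (Var 2) (Var 1) (Var 0)"] e
  have "sb G (scons e (scons C (scons B (scons A Var)))) [tySplit (Var 2) (Var 1) (Var 0),
      Fun (El (eSigma (Var 1) (Var 0))) SET, Fun (El (Var 0)) SET, SET]"
    by (simp add: eval_nat_numeral)
  from sb_cons[OF this, of a "El (Var 3)"] a
  have "sb G (scons a (scons e (scons C (scons B (scons A Var))))) [El (Var 3), tySplit (Var 2) (Var 1) (Var 0),
      Fun (El (eSigma (Var 1) (Var 0))) SET, Fun (El (Var 0)) SET, SET]"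
    by (simp add: eval_nat_numeral)
  from sb_cons[OF this, of b "El (App (Var 3) (Var 0))"] b
  have "sb G (scons b (scons a (scons e (scons C (scons B (scons A Var)))))) [El (App (Var 3) (Var 0)),
      El (Var 3), tySplit (Var 2) (Var 1) (Var 0), Fun (El (eSigma (Var 1) (Var 0))) SET, Fun (El (Var 0)) SET, SET]"
    by (simp add: eval_nat_numeral)
  from teq_esub[OF teq_split_generic this] show ?thesis by (simp add: eval_nat_numeral)
qed

text \<open>The first projection: \<open>cSplit\<close> into the constant family \<open>A\<close>,
  with the method returning the first component.\<close>

abbreviation eFst :: "'x cn exp \<Rightarrow> 'x cn exp \<Rightarrow> 'x cn exp \<Rightarrow> 'x cn exp" where
  "eFst A B p \<equiv> eSplit A B (Lam (wk A)) (Lam (Lam (Var 1))) p"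

lemma const_family:
  assumes A: "tm G A SET" and D: "tm G D SET"
  shows "tm G (Lam (wk D)) (Fun (El A) SET)"
    and "tm G p (El A) \<Longrightarrow> teq G (App (Lam (wk D)) p) D SET"
proof -
  have D1: "tm (El A # G) (wk D) SET" using tm_weak[OF D ty_El[OF A]] by simp
  show "tm G (Lam (wk D)) (Fun (El A) SET)" by (rule tm_family[OF D1 A])
  show "teq G (App (Lam (wk D)) p) D SET" if "tm G p (El A)" using teq_beta[OF D1 that] by simp
qed

lemma fst_method:
  assumes A: "tm G A SET" and B: "tm G B (Fun (El A) SET)"
  shows "tm G (Lam (Lam (Var 1))) (tySplit A B (Lam (wk A)))"
proof -
  note c = pair_context[OF A B]
  have "teq (El (App (wk B) (Var 0)) # El A # G) (App (Lam (wk (wk (wk A))))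
      (ePair (wk (wk A)) (wk (wk B)) (Var 1) (Var 0))) (wk (wk A)) SET"
    by (rule const_family(2)[OF tm_cSigma[OF c(3,4)] c(3,7)])
  from tm_conv[OF c(5) teq_sym[OF this]] show ?thesis
    by (intro tm_lam[OF _ c(1)] tm_lam[OF _ c(2)]) simp
qed

lemma tm_eFst:
  assumes A: "tm G A SET" and B: "tm G B (Fun (El A) SET)" and p: "tm G p (El (eSigma A B))"
  shows "tm G (eFst A B p) (El A)"
  by (rule tm_conv[OF tm_cSplit[OF A B const_family(1)[OF tm_cSigma[OF A B] A] fst_method[OF A B] p]
      const_family(2)[OF tm_cSigma[OF A B] A p]])

lemma teq_conv: "teq G a b (El A) \<Longrightarrow> teq G A B SET \<Longrightarrow> teq G a b (El B)"
  by (auto simp: teq_def intro: der.eq_conv der.El_eq)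

lemma teq_eFst:
  assumes A: "tm G A SET" and B: "tm G B (Fun (El A) SET)" and a: "tm G a (El A)" and b: "tm G b (El (App B a))"
  shows "teq G (eFst A B (ePair A B a b)) a (El A)"
proof -
  note c = pair_context[OF A B]
  have "teq G (eFst A B (ePair A B a b)) (App (App (Lam (Lam (Var 1))) a) b) (El A)"
    by (rule teq_conv[OF teq_split[OF A B const_family(1)[OF tm_cSigma[OF A B] A] fst_method[OF A B] a b]
        const_family(2)[OF tm_cSigma[OF A B] A tm_cPair[OF A B a b]]])
  moreover have "teq G (App (App (Lam (Lam (Var 1))) a) b) a (El A)"
  proof -
    have "tm (El A # G) (Lam (Var 1)) (Fun (El (App (wk B) (Var 0))) (El (wk (wk A))))"
      by (rule tm_lam[OF c(5,2)])
    from teq_beta[OF this a]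
    have 1: "teq G (App (Lam (Lam (Var 1))) a) (Lam (wk a)) (Fun (El (App B a)) (El (wk A)))" by simp
    have Ba: "tm G (App B a) SET" using tm_app[OF B a] by simp
    have a1: "tm (El (App B a) # G) (wk a) (El (wk A))" using tm_weak[OF a ty_El[OF Ba]] by simp
    from teq_app[OF 1 teq_refl[OF b] refl]
    have 2: "teq G (App (App (Lam (Lam (Var 1))) a) b) (App (Lam (wk a)) b) (El A)" by simp
    from teq_beta[OF a1 b] have 3: "teq G (App (Lam (wk a)) b) a (El A)" by simp
    from 2 3 show ?thesis by (rule teq_trans)
  qed
  ultimately show ?thesis by (rule teq_trans)
qed

text \<open>Strong elimination, with an actual witness term in the same context: the first
  projection of the given pair. The proof of \<open>B\<close> at it comes from splitting into the
  family of all \<open>B (fst z)\<close>, which at a generic pair reduces to \<open>B\<close> of the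
  first component by the law for \<open>cSplit\<close>.\<close>

lemma tr_SigmaE_family:
  assumes A: "tm G A SET" and B: "tm G B (Fun (El A) SET)" and "tr G (eSigma A B)"
  shows "\<exists>a. tm G a (El A) \<and> tr G (App B a)"
proof -
  obtain p where p: "tm G p (El (eSigma A B))" using assms(3) by (auto simp: tr_def)
  note c = pair_context[OF A B]
  let ?G2 = "El (App (wk B) (Var 0)) # El A # G"
  let ?A2 = "wk (wk A)" and ?B2 = "wk (wk B)"
  let ?C = "Lam (App (wk B) (eFst (wk A) (wk B) (Var 0)))"
  \<comment> \<open>Stated for any context and family, as it is used both in \<open>G\<close> and at
    the generic pair.\<close>
  have C_body: "tm (El (eSigma A B) # G) (App (wk B) (eFst (wk A) (wk B) (Var 0))) SET"
    if A: "tm G A SET" and B: "tm G B (Fun (El A) SET)" for G A B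
  proof -
    have S: "ty G (El (eSigma A B))" by (rule ty_El[OF tm_cSigma[OF A B]])
    have A1: "tm (El (eSigma A B) # G) (wk A) SET" using tm_weak[OF A S] by simp
    have B1: "tm (El (eSigma A B) # G) (wk B) (Fun (El (wk A)) SET)" using tm_weak[OF B S] by simp
    have v: "tm (El (eSigma A B) # G) (Var 0) (El (eSigma (wk A) (wk B)))" using tm_var0[OF S] by simp
    show ?thesis using tm_app[OF B1 tm_eFst[OF A1 B1 v]] by simp
  qed
  note S = tm_cSigma[OF A B]
  have C: "tm G ?C (Fun (El (eSigma A B)) SET)" by (rule tm_family[OF C_body[OF A B] S])
  have "teq ?G2 (App (Lam (App (wk ?B2) (eFst (wk ?A2) (wk ?B2) (Var 0)))) (ePair ?A2 ?B2 (Var 1) (Var 0)))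
      (App ?B2 (eFst ?A2 ?B2 (ePair ?A2 ?B2 (Var 1) (Var 0)))) SET"
    using teq_beta[OF C_body[OF c(3,4)] c(7)] by simp
  moreover have "teq ?G2 (App ?B2 (eFst ?A2 ?B2 (ePair ?A2 ?B2 (Var 1) (Var 0)))) (App ?B2 (Var 1)) SET"
    using teq_app[OF teq_refl[OF c(4)] teq_eFst[OF c(3,4,5,6)]] by simp
  ultimately have "teq ?G2 (App (Lam (App (wk ?B2) (eFst (wk ?A2) (wk ?B2) (Var 0)))) (ePair ?A2 ?B2 (Var 1) (Var 0)))
      (App ?B2 (Var 1)) SET" by (rule teq_trans)
  from tm_conv[OF c(6) teq_sym[OF this]]
  have e: "tm G (Lam (Lam (Var 0))) (tySplit A B ?C)"
    by (intro tm_lam[OF _ c(1)] tm_lam[OF _ c(2)]) simp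
  from tm_cSplit[OF A B C e p] have "tr G (App ?C p)" by (rule trI)
  moreover have "teq G (App ?C p) (App B (eFst A B p)) SET" using teq_beta[OF C_body[OF A B] p] by simp
  ultimately have "tr G (App B (eFst A B p))" by (rule tr_conv)
  then show ?thesis using tm_eFst[OF A B p] by blast
qed

lemma tr_SigmaE:
  assumes A: "tm G A SET" and b: "tm (El A # G) b SET" and "tr G (eSigma A (Lam b))"
  shows "\<exists>a. tm G a (El A) \<and> tr G (esub (single a) b)"
proof -
  obtain a where a: "tm G a (El A)" "tr G (App (Lam b) a)"
    using tr_SigmaE_family[OF A tm_family[OF b A] assms(3)] by blast
  have "teq G (App (Lam b) a) (esub (single a) b) SET" using teq_beta[OF b a(1)] by simp
  from tr_conv[OF a(2) this] a(1) show ?thesis by blast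
qed

lemma tr_SigmaI:
  assumes A: "tm G A SET" and b: "tm (El A # G) b SET" and a: "tm G a (El A)" and "tr G (esub (single a) b)"
  shows "tr G (eSigma A (Lam b))"
proof -
  have "teq G (App (Lam b) a) (esub (single a) b) SET" using teq_beta[OF b a(1)] by simp
  from tr_conv[OF assms(4) teq_sym[OF this]] obtain t where "tm G t (El (App (Lam b) a))" by (auto simp: tr_def)
  from tm_cPair[OF A tm_family[OF b A] a this] show ?thesis by (rule trI)
qed

lemma tr_AndI:
  assumes A: "tm G A SET" and B: "tm G B SET" and "tr G A" and "tr G B"
  shows "tr G (eAnd A B)"
proof -
  obtain a where "tm G a (El A)" using assms(3) by (auto simp: tr_def)
  from tr_SigmaI[OF A _ this] tm_weak[OF B ty_El[OF A]] assms(4) show ?thesis by simp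
qed

lemma tr_AndE:
  assumes A: "tm G A SET" and B: "tm G B SET" and "tr G (eAnd A B)"
  shows "tr G A" and "tr G B"
  using tr_SigmaE[OF A _ assms(3)] tm_weak[OF B ty_El[OF A]] by (auto intro: trI)

section \<open>Disjoint sums\<close>

lemma tm_cInl:
  assumes A: "tm G A SET" and B: "tm G B SET" and a: "tm G a (El A)"
  shows "tm G (App (App (App (Cst cInl) A) B) a) (El (ePlus A B))"
proof -
  have "decl cInl (FunT SetT (\<lambda>A. FunT SetT (\<lambda>B. ElT A \<^bold>\<Rightarrow> ElT (PlusS A B)))) \<in> R"
    by (rule decl_R) (simp add: CTT_decls_def)
  from tm_step[OF tm_step[OF tm_step[OF tm_decl[OF this tm_ctx[OF A], unfolded hexp_defs], of A], of B], of a]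
  show ?thesis using assms by (simp add: eval_nat_numeral)
qed

lemma tm_cInr:
  assumes A: "tm G A SET" and B: "tm G B SET" and b: "tm G b (El B)"
  shows "tm G (App (App (App (Cst cInr) A) B) b) (El (ePlus A B))"
proof -
  have "decl cInr (FunT SetT (\<lambda>A. FunT SetT (\<lambda>B. ElT B \<^bold>\<Rightarrow> ElT (PlusS A B)))) \<in> R"
    by (rule decl_R) (simp add: CTT_decls_def)
  from tm_step[OF tm_step[OF tm_step[OF tm_decl[OF this tm_ctx[OF A], unfolded hexp_defs], of A], of B], of b]
  show ?thesis using assms by (simp add: eval_nat_numeral)
qed

lemma tr_PlusI1: "tm G A SET \<Longrightarrow> tm G B SET \<Longrightarrow> tr G A \<Longrightarrow> tr G (ePlus A B)"
  unfolding tr_def by (blast intro: tm_cInl)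

lemma tr_PlusI2: "tm G A SET \<Longrightarrow> tm G B SET \<Longrightarrow> tr G B \<Longrightarrow> tr G (ePlus A B)"
  unfolding tr_def by (blast intro: tm_cInr)

lemma tr_PlusE:
  assumes A: "tm G A SET" and B: "tm G B SET" and D: "tm G D SET" and "tr G (ePlus A B)"
    and a: "tr (El A # G) (wk D)" and b: "tr (El B # G) (wk D)"
  shows "tr G D"
proof -
  obtain p where p: "tm G p (El (ePlus A B))" using assms(4) by (auto simp: tr_def)
  let ?C = "Lam (wk D)"
  note S = tm_cPlus[OF A B]
  have C: "tm G ?C (Fun (El (ePlus A B)) SET)" by (rule const_family(1)[OF S D])
  have branch: "\<exists>f. tm G f (Fun (El E) (El (App (wk ?C) i)))"
    if E: "tm G E SET" and t: "tr (El E # G) (wk D)" and i: "tm (El E # G) i (El (ePlus (wk A) (wk B)))" for E i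
  proof -
    obtain t where t: "tm (El E # G) t (El (wk D))" using t by (auto simp: tr_def)
    have w: "tm (El E # G) (wk A) SET" "tm (El E # G) (wk B) SET" "tm (El E # G) (wk D) SET"
      using tm_weak[OF _ ty_El[OF E]] A B D by force+
    from tm_conv[OF t teq_sym[OF const_family(2)[OF tm_cPlus[OF w(1,2)] w(3) i]]]
    show ?thesis using tm_lam[OF _ ty_El[OF E]] by auto
  qed
  have w: "tm (El E # G) (wk A) SET" "tm (El E # G) (wk B) SET" "tm (El E # G) (Var 0) (El (wk E))" if "tm G E SET" for E
    using tm_weak[OF _ ty_El[OF that]] A B tm_var0[OF ty_El[OF that]] by force+
  from branch[OF A a tm_cInl[OF w[OF A]]] obtain f where f: "tm G f (Fun (El A) (El (App (wk ?C) (App (App (App (Cst cInl) (wk A)) (wk B)) (Var 0)))))" ..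
  from branch[OF B b tm_cInr[OF w[OF B]]] obtain g where g: "tm G g (Fun (El B) (El (App (wk ?C) (App (App (App (Cst cInr) (wk A)) (wk B)) (Var 0)))))" ..
  have "decl cWhen (FunT SetT (\<lambda>A. FunT SetT (\<lambda>B. FunT (ElT (PlusS A B) \<^bold>\<Rightarrow> SetT) (\<lambda>C.
      FunT (ElT A) (\<lambda>x. ElT (C \<cdot> (cst cInl \<cdot> A \<cdot> B \<cdot> x))) \<^bold>\<Rightarrow>
      FunT (ElT B) (\<lambda>y. ElT (C \<cdot> (cst cInr \<cdot> A \<cdot> B \<cdot> y))) \<^bold>\<Rightarrow>
      FunT (ElT (PlusS A B)) (\<lambda>p. ElT (C \<cdot> p)))))) \<in> R" by (rule decl_R) (simp add: CTT_decls_def)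
  from tr_step[OF tm_step[OF tm_step[OF tm_step[OF tm_step[OF tm_step[OF tm_decl[OF this tm_ctx[OF A], unfolded hexp_defs], of A], of B], of "?C"], of f], of g], of p]
  have "tr G (App ?C p)" using A B C f g p by (simp add: eval_nat_numeral)
  then show ?thesis by (rule tr_conv[OF _ const_family(2)[OF S D p]])
qed

text \<open>Uniformity shows in the contexts: \<open>i\<close> is typed in \<open>G\<close>, and
  only its proof lives in \<open>SET # G\<close>, where the proposition is
  \<open>Var 0\<close>.\<close>

lemma uniformity_family:
  assumes I: "tm G I SET" and P: "tm G P (Fun SET (Fun (El (wk I)) SET))"
    and F: "tm G F (Fun SET (El (wk I)))"
    and r: "tm G r (Fun SET (El (App (App (wk P) (Var 0)) (App (wk F) (Var 0)))))"
  shows "\<exists>i. tm G i (El I) \<and> tr (SET # G) (App (App (wk P) (Var 0)) (wk i))"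
proof -
  let ?i = "App (App (App (App (Cst cGup) I) P) F) r"
  have "decl cGup (gup_hyps (\<lambda>I R F r. ElT I)) \<in> R" using GUP by (auto simp: GUP_CTT_def)
  from tm_step[OF tm_step[OF tm_step[OF tm_step[OF tm_decl[OF this tm_ctx[OF I], unfolded gup_hyps_def hexp_defs], of I], of P], of F], of r]
  have i: "tm G ?i (El I)" using I P F r by (simp add: eval_nat_numeral)
  have "decl cGupPrf (gup_hyps (\<lambda>I R F r. FunT SetT (\<lambda>P. ElT (R \<cdot> P \<cdot> (cst cGup \<cdot> I \<cdot> R \<cdot> F \<cdot> r))))) \<in> R"
    using GUP by (auto simp: GUP_CTT_def)
  from tm_step[OF tm_step[OF tm_step[OF tm_step[OF tm_decl[OF this tm_ctx[OF I], unfolded gup_hyps_def hexp_defs], of I], of P], of F], of r]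
  have p: "tm G (App (App (App (App (Cst cGupPrf) I) P) F) r) (Fun SET (El (App (App (wk P) (Var 0)) (wk ?i))))"
    using I P F r by (simp add: eval_nat_numeral)
  note S = ty_SET[OF tm_ctx[OF I]]
  have "tm (SET # G) (wk (App (App (App (App (Cst cGupPrf) I) P) F) r))
      (Fun SET (El (App (App (wk (wk P)) (Var 0)) (wk (wk ?i)))))" using tm_weak[OF p S]
    by simp
  from tm_app[OF this tm_var0[OF S, simplified]]
  have "tr (SET # G) (App (App (wk P) (Var 0)) (wk ?i))" by (auto intro!: trI)
  then show ?thesis using i by blast
qed

text \<open>The principle asks for a function \<open>F\<close> from propositions to
  \<open>I\<close>. An existential true for a generic proposition has a witness term
  \<open>f\<close> over that proposition, and abstracting it gives \<open>F\<close>; this is the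
  type-theoretic choice that strong elimination permits.\<close>

lemma uniformity:
  assumes I: "tm G I SET" and Q: "tm (El (wk I) # SET # G) Q SET"
    and ex: "tr (SET # G) (eSigma (wk I) (Lam Q))"
  shows "\<exists>i. tm G i (El I) \<and> tr (SET # G) (esub (single (wk i)) Q)"
proof -
  note S = ty_SET[OF tm_ctx[OF I]]
  have I1: "tm (SET # G) (wk I) SET" using tm_weak[OF I S] by simp
  note LQ = tm_family[OF Q I1]
  define P where "P = Lam (Lam Q)"
  have P: "tm G P (Fun SET (Fun (El (wk I)) SET))" unfolding P_def by (rule tm_lam[OF LQ S])
  have PV: "teq (SET # G) (App (wk P) (Var 0)) (Lam Q) (Fun (El (wk I)) SET)"
    unfolding P_def by (rule teq_beta_up[OF LQ S])
  \<comment> \<open>Uniformity speaks of the relation applied to arguments; two reductions identify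
    this with the instance of \<open>Q\<close>.\<close>
  have PVa: "teq (SET # G) (App (App (wk P) (Var 0)) b) (esub (single a) Q) SET"
    if ab: "teq (SET # G) b a (El (wk I))" and a: "tm (SET # G) a (El (wk I))" for a b
  proof -
    have "teq (SET # G) (App (App (wk P) (Var 0)) b) (App (Lam Q) a) SET"
      using teq_app[OF PV ab refl] by simp
    moreover have "teq (SET # G) (App (Lam Q) a) (esub (single a) Q) SET" using teq_beta[OF Q a] by simp
    ultimately show ?thesis by (rule teq_trans)
  qed
  obtain f t where f: "tm (SET # G) f (El (wk I))" and t: "tm (SET # G) t (El (esub (single f) Q))"
    using tr_SigmaE[OF I1 Q ex] by (auto simp: tr_def)
  have F: "tm G (Lam f) (Fun SET (El (wk I)))" by (rule tm_lam[OF f S])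
  have r: "tm G (Lam t) (Fun SET (El (App (App (wk P) (Var 0)) (App (wk (Lam f)) (Var 0)))))"
    by (rule tm_lam[OF tm_conv[OF t teq_sym[OF PVa[OF teq_beta_up[OF f S] f]]] S])
  obtain i where i: "tm G i (El I)" and i': "tr (SET # G) (App (App (wk P) (Var 0)) (wk i))"
    using uniformity_family[OF I P F r] by blast
  have "tm (SET # G) (wk i) (El (wk I))" using tm_weak[OF i S] by simp
  from tr_conv[OF i' PVa[OF teq_refl[OF this] this]] i show ?thesis by blast
qed

lemma tm_closed_context: "tm [] t A \<Longrightarrow> der R G IsCtx \<Longrightarrow> tm G t A"
  using tm_empty_context[of t A G] by (simp add: esub_Var)

lemma teq_law:
  assumes "law A l r \<in> R" and "der R G IsCtx"
  shows "teq G (l 0) (r 0) (A 0)"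
proof -
  have "teq [] (l 0) (r 0) (A 0)"
    using der.rule[of "[]" "[]" "EqElem (l 0) (r 0) (A 0)" R] assms(1) by (simp add: law_def teq_def der.ctx_nil)
  moreover have "sb G Var []" using assms(2) by (simp add: sb_def)
  ultimately have "teq G (esub Var (l 0)) (esub Var (r 0)) (esub Var (A 0))" by (rule teq_esub)
  then show ?thesis by (simp add: esub_Var)
qed

lemma teq_uN0: "der R G IsCtx \<Longrightarrow> teq G (eT (Cst uN0)) (Cst cN0) SET"
  using teq_law[of SetT "TS (cst uN0)" N0 G] CTT by (auto simp: CTT_def CTT_laws_def hexp_defs)

lemma teq_uN1: "der R G IsCtx \<Longrightarrow> teq G (eT (Cst uN1)) (Cst cN1) SET"
  using teq_law[of SetT "TS (cst uN1)" N1 G] CTT by (auto simp: CTT_def CTT_laws_def hexp_defs)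

lemma tr_hyp: "tm G A SET \<Longrightarrow> tr (El A # G) (wk A)"
  by (rule trI) (use tm_var0[OF ty_El] in auto)

section \<open>Lists\<close>

lemma tm_nil:
  assumes "tm G A SET"
  shows "tm G (App (Cst cNil) A) (El (eList A))"
proof -
  have "decl cNil (FunT SetT (\<lambda>A. ElT (ListS A))) \<in> R" by (rule decl_R) (simp add: CTT_decls_def)
  from tm_step[OF tm_decl[OF this tm_ctx[OF assms], unfolded hexp_defs], of A]
  show ?thesis using assms by (simp add: eval_nat_numeral)
qed

abbreviation eCons :: "'x cn exp \<Rightarrow> 'x cn exp \<Rightarrow> 'x cn exp \<Rightarrow> 'x cn exp" where
  "eCons A a l \<equiv> App (App (App (Cst cCons) A) a) l"

lemma tm_cCons:
  assumes A: "tm G A SET" and a: "tm G a (El A)" and l: "tm G l (El (eList A))"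
  shows "tm G (eCons A a l) (El (eList A))"
proof -
  have "decl cCons (FunT SetT (\<lambda>A. ElT A \<^bold>\<Rightarrow> ElT (ListS A) \<^bold>\<Rightarrow> ElT (ListS A))) \<in> R"
    by (rule decl_R) (simp add: CTT_decls_def)
  from tm_step[OF tm_step[OF tm_step[OF tm_decl[OF this tm_ctx[OF A], unfolded hexp_defs], of A], of a], of l]
  show ?thesis using assms by (simp add: eval_nat_numeral)
qed

abbreviation eAppend :: "'x cn exp \<Rightarrow> 'x cn exp \<Rightarrow> 'x cn exp \<Rightarrow> 'x cn exp" where
  "eAppend A k l \<equiv> App (App (App (App (App (Cst cListrec) A) (Lam (eList (wk A)))) l)
     (Lam (Lam (Lam (eCons (wk (wk (wk A))) (Var 2) (Var 0)))))) k"

text \<open>Both the base case and the step of the recursion have the constant family applied to a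
  list as their type, so every typing is converted there and back by one reduction.\<close>

lemma tm_eAppend:
  assumes A: "tm G A SET" and k: "tm G k (El (eList A))" and l: "tm G l (El (eList A))"
  shows "tm G (eAppend A k l) (El (eList A))"
proof -
  note L = tm_cList[OF A]
  let ?C = "Lam (wk (eList A))"
  have C: "tm G ?C (Fun (El (eList A)) SET)" by (rule const_family(1)[OF L L])
  have fold: "teq G' (App (Lam (wk (eList B))) p) (eList B) SET" if "tm G' B SET" "tm G' p (El (eList B))" for G' B p
    by (rule const_family(2)[OF tm_cList tm_cList]) (use that in auto)
  have l': "tm G l (El (App ?C (App (Cst cNil) A)))" by (rule tm_conv[OF l teq_sym[OF fold[OF A tm_nil[OF A]]]])
  let ?G1 = "El A # G"
  let ?G2 = "El (eList (wk A)) # ?G1"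
  let ?G3 = "El (App (wk (wk ?C)) (Var 0)) # ?G2"
  have t1: "ty G (El A)" by (rule ty_El[OF A])
  have A1: "tm ?G1 (wk A) SET" using tm_weak[OF A t1] by simp
  have t2: "ty ?G1 (El (eList (wk A)))" by (rule ty_El[OF tm_cList[OF A1]])
  have A2: "tm ?G2 (wk (wk A)) SET" using tm_weak[OF A1 t2] by simp
  have v2: "tm ?G2 (Var 0) (El (eList (wk (wk A))))" using tm_var0[OF t2] by simp
  have C2: "tm ?G2 (wk (wk ?C)) (Fun (El (eList (wk (wk A)))) SET)"
    using tm_weak[OF tm_weak[OF C t1] t2] by simp
  have C2': "tm ?G2 (App (wk (wk ?C)) (Var 0)) SET" using tm_app[OF C2 v2] by simp
  note t3 = ty_El[OF C2']
  have A3: "tm ?G3 (wk (wk (wk A))) SET" using tm_weak[OF A2 t3] by simp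
  have x: "tm ?G3 (Var 2) (El (wk (wk (wk A))))"
    using tm_weak[OF tm_weak[OF tm_var0[OF t1] t2] t3] by (simp add: eval_nat_numeral)
  have y: "tm ?G3 (Var 1) (El (eList (wk (wk (wk A)))))"
    using tm_weak[OF v2 t3] by simp
  have v3: "tm ?G3 (Var 0) (El (App (Lam (wk (eList (wk (wk (wk A)))))) (Var 1)))"
    using tm_var0[OF t3] by simp
  have z: "tm ?G3 (Var 0) (El (eList (wk (wk (wk A)))))"
    by (rule tm_conv[OF v3 fold[OF A3 y]])
  note xz = tm_cCons[OF A3 x z] and xy = tm_cCons[OF A3 x y]
  have e3: "tm ?G3 (eCons (wk (wk (wk A))) (Var 2) (Var 0))
      (El (App (wk (wk (wk ?C))) (eCons (wk (wk (wk A))) (Var 2) (Var 1))))"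
    using tm_conv[OF xz teq_sym[OF fold[OF A3 xy]]] by simp
  note e = tm_lam[OF tm_lam[OF tm_lam[OF e3 t3] t2] t1]
  have "decl cListrec (FunT SetT (\<lambda>A. FunT (ElT (ListS A) \<^bold>\<Rightarrow> SetT) (\<lambda>C.
      ElT (C \<cdot> (cst cNil \<cdot> A)) \<^bold>\<Rightarrow>
      FunT (ElT A) (\<lambda>x. FunT (ElT (ListS A)) (\<lambda>y. ElT (C \<cdot> y) \<^bold>\<Rightarrow> ElT (C \<cdot> (cst cCons \<cdot> A \<cdot> x \<cdot> y)))) \<^bold>\<Rightarrow>
      FunT (ElT (ListS A)) (\<lambda>l. ElT (C \<cdot> l))))) \<in> R" by (rule decl_R) (simp add: CTT_decls_def)
  from tm_step[OF tm_step[OF tm_step[OF tm_step[OF tm_step[OF tm_decl[OF this tm_ctx[OF A], unfolded hexp_defs], of A], of "?C"], of l], of "Lam (Lam (Lam (eCons (wk (wk (wk A))) (Var 2) (Var 0))))"], of k]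
  have "tm G (eAppend A k l) (El (App ?C k))" using A C l' e k by (simp add: eval_nat_numeral)
  from tm_conv[OF this fold[OF A k]] show ?thesis .
qed

end

subsection \<open>Covers in type theory\<close>

text \<open>Closedness makes \<open>S\<close> and \<open>c\<close> the same expressions in every
  context, so that weakening and substitution pass over them.\<close>

locale ctt_cover = ctt_theory R for R :: "'x cn rule set" +
  fixes S c :: "'x cn exp"
  assumes closed_S: "closed S" and closed_c: "closed c"
    and S: "tm [] S SET" and c: "tm [] c (Fun (El S) (Fun (Fun (El S) SET) SET))"
begin

lemma closed_simps [simp]: "esub s S = S" "eren f S = S" "esub s c = c" "eren f c = c"
  using closed_S closed_c by (simp_all add: closed_esub closed_eren)

abbreviation "Sub \<equiv> Fun (El S) SET"
abbreviation "eCov a U \<equiv> App (App c a) U"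

text \<open>These definitions write the notions on formal spaces, for the fixed \<open>S\<close> and
  \<open>c\<close>, as raw expressions without named variables; \<open>prop_simps\<close> links the
  two forms.\<close>

definition "Covs U V = ePi S (Lam (eImp (App (wk U) (Var 0)) (eCov (Var 0) (wk V))))"
definition "CovAll U = ePi S (Lam (eCov (Var 0) (wk U)))"
definition "Empty = (Lam (Cst cN0) :: 'x cn exp)"
definition "Sing a = Lam (eId S (Var 0) (wk a))"
definition "Cup U V = (Lam (ePlus (App (wk U) (Var 0)) (App (wk V) (Var 0))) :: 'x cn exp)"
text \<open>Half of a meet: \<open>x\<close> is covered by the singleton of some element of
  \<open>U\<close>.\<close>

definition "Overlap x U = eSigma S (Lam (eAnd (App (wk U) (Var 0)) (eCov (wk x) (Sing (Var 0)))))"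
definition "Down U V = Lam (eAnd (Overlap (Var 0) (wk U)) (Overlap (Var 0) (wk V)))"
definition "Compl U = Lam (Covs (Down (Sing (Var 0)) (wk U)) Empty)"
definition "Listed l = Lam (eSigma (eList S) (Lam (eSigma (eList S) (Lam
  (eId (eList S) (wk (wk (wk l))) (eAppend S (Var 1) (eCons S (Var 2) (Var 0))))))))"
definition "Subcover U l = eAnd (ePi S (Lam (eImp (App (wk (Listed l)) (Var 0)) (App (wk U) (Var 0)))))
  (CovAll (Listed l))"
text \<open>The subset \<open>{a \<in> S : P}\<close>, through which uniformity over propositions
  acts on subsets.\<close>

definition "Const P = (Lam (wk P) :: 'x cn exp)"
definition "DM P = Cup (Compl (Compl (Const P))) (Compl (Const P))"

lemma esub_cover [simp]:
  "esub s (Covs U V) = Covs (esub s U) (esub s V)"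
  "esub s (CovAll U) = CovAll (esub s U)"
  "esub s Empty = Empty"
  "esub s (Sing a) = Sing (esub s a)"
  "esub s (Cup U V) = Cup (esub s U) (esub s V)"
  "esub s (Listed l) = Listed (esub s l)"
  "esub s (Const P) = Const (esub s P)"
  by (simp_all add: Covs_def CovAll_def Empty_def Sing_def Cup_def Listed_def Const_def eval_nat_numeral)

lemma eren_cover [simp]:
  "eren f (Covs U V) = Covs (eren f U) (eren f V)"
  "eren f (CovAll U) = CovAll (eren f U)"
  "eren f Empty = Empty"
  "eren f (Sing a) = Sing (eren f a)"
  "eren f (Cup U V) = Cup (eren f U) (eren f V)"
  "eren f (Listed l) = Listed (eren f l)"
  "eren f (Const P) = Const (eren f P)"
  by (simp_all add: Covs_def CovAll_def Empty_def Sing_def Cup_def Listed_def Const_def eval_nat_numeral)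

lemma subst_Overlap [simp]:
  "esub s (Overlap x U) = Overlap (esub s x) (esub s U)" "eren f (Overlap x U) = Overlap (eren f x) (eren f U)"
  by (simp_all add: Overlap_def)

lemma subst_Down [simp]:
  "esub s (Down U V) = Down (esub s U) (esub s V)" "eren f (Down U V) = Down (eren f U) (eren f V)"
  by (simp_all add: Down_def)

lemma subst_Compl [simp]: "esub s (Compl U) = Compl (esub s U)" "eren f (Compl U) = Compl (eren f U)"
  by (simp_all add: Compl_def)

lemma subst_DM [simp]: "esub s (DM P) = DM (esub s P)" "eren f (DM P) = DM (eren f P)"
  by (simp_all add: DM_def)

lemma subst_Subcover [simp]:
  "esub s (Subcover U l) = Subcover (esub s U) (esub s l)" "eren f (Subcover U l) = Subcover (eren f U) (eren f l)"
  by (simp_all add: Subcover_def)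

section \<open>Typing of subsets and covers\<close>

lemma tm_S: "der R G IsCtx \<Longrightarrow> tm G S SET"
  by (rule tm_closed_context[OF S])

lemma tm_S': "tm G t A \<Longrightarrow> tm G S SET"
  by (rule tm_S[OF tm_ctx])

lemma ty_S: "der R G IsCtx \<Longrightarrow> ty G (El S)"
  by (rule ty_El[OF tm_S])

lemma tm_wS: "tm G U Sub \<Longrightarrow> tm (El S # G) (wk U) Sub"
  using tm_weak[OF _ ty_S, of G U Sub] tm_ctx by force

lemma tm_v0: "der R G IsCtx \<Longrightarrow> tm (El S # G) (Var 0) (El S)"
  using tm_var0[OF ty_S] by simp

lemma tm_v0': "tm G t A \<Longrightarrow> tm (El S # G) (Var 0) (El S)"
  by (rule tm_v0[OF tm_ctx])

lemma tm_mem: "tm G U Sub \<Longrightarrow> tm G a (El S) \<Longrightarrow> tm G (App U a) SET"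
  by (rule tm_app) auto

lemma tm_cov: "tm G a (El S) \<Longrightarrow> tm G U Sub \<Longrightarrow> tm G (eCov a U) SET"
  by (rule tm_app[OF tm_app[OF tm_closed_context[OF c tm_ctx]]]) auto

lemma tm_Covs_body: "tm G U Sub \<Longrightarrow> tm G V Sub \<Longrightarrow>
    tm (El S # G) (eImp (App (wk U) (Var 0)) (eCov (Var 0) (wk V))) SET"
  by (intro tm_eImp tm_mem tm_cov tm_wS tm_v0') assumption+

lemma tm_Covs: "tm G U Sub \<Longrightarrow> tm G V Sub \<Longrightarrow> tm G (Covs U V) SET"
  unfolding Covs_def by (rule tm_cPi[OF tm_S' tm_family[OF tm_Covs_body tm_S']])

lemma tm_CovAll_body: "tm G U Sub \<Longrightarrow> tm (El S # G) (eCov (Var 0) (wk U)) SET"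
  by (intro tm_cov tm_wS tm_v0') assumption+

lemma tm_CovAll: "tm G U Sub \<Longrightarrow> tm G (CovAll U) SET"
  unfolding CovAll_def by (rule tm_cPi[OF tm_S' tm_family[OF tm_CovAll_body tm_S']])

lemma tm_Const: "der R G IsCtx \<Longrightarrow> tm G P SET \<Longrightarrow> tm G (Const P) Sub"
  unfolding Const_def by (rule const_family(1)[OF tm_S])

lemma tr_Const: "tm G P SET \<Longrightarrow> tm G a (El S) \<Longrightarrow> tr G (App (Const P) a) \<longleftrightarrow> tr G P"
  unfolding Const_def by (rule tr_conv_iff[OF const_family(2)[OF tm_S']])

text \<open>The empty subset is the instance at falsity, so it falls under the uniform
  family.\<close>

lemma Empty_Const: "Empty = Const (Cst cN0)"
  by (simp add: Empty_def Const_def)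

lemma tm_Empty: "der R G IsCtx \<Longrightarrow> tm G Empty Sub"
  unfolding Empty_Const by (rule tm_Const[OF _ tm_cN0])

lemma tm_Sing_body: "tm G a (El S) \<Longrightarrow> tm (El S # G) (eId S (Var 0) (wk a)) SET"
  using tm_cId[OF tm_S' tm_v0'] tm_weak[of G a "El S" "El S"] ty_S tm_ctx tm_v0' by force

lemma tm_Sing: "tm G a (El S) \<Longrightarrow> tm G (Sing a) Sub"
  unfolding Sing_def by (rule tm_family[OF tm_Sing_body tm_S'])

lemma tr_Sing: "tm G a (El S) \<Longrightarrow> tr G (App (Sing a) a)"
  unfolding Sing_def
  using tr_conv[OF tr_IdI[OF tm_S'] teq_sym[OF teq_beta[OF tm_Sing_body, simplified]]] by simp

lemma tm_Cup_body: "tm G U Sub \<Longrightarrow> tm G V Sub \<Longrightarrow>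
    tm (El S # G) (ePlus (App (wk U) (Var 0)) (App (wk V) (Var 0))) SET"
  by (intro tm_cPlus tm_mem tm_wS tm_v0') assumption+

lemma tm_Cup: "tm G U Sub \<Longrightarrow> tm G V Sub \<Longrightarrow> tm G (Cup U V) Sub"
  unfolding Cup_def by (rule tm_family[OF tm_Cup_body tm_S'])

lemma tr_Cup: "tm G U Sub \<Longrightarrow> tm G V Sub \<Longrightarrow> tm G a (El S) \<Longrightarrow>
    tr G (App (Cup U V) a) \<longleftrightarrow> tr G (ePlus (App U a) (App V a))"
  unfolding Cup_def using tr_conv_iff[OF teq_beta[OF tm_Cup_body, simplified]] by simp

lemma tm_wEl: "tm G x (El S) \<Longrightarrow> ty G A \<Longrightarrow> tm (A # G) (wk x) (El S)"
  using tm_weak[of G x "El S" A] by simp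

lemma tm_Overlap_body: "tm G x (El S) \<Longrightarrow> tm G U Sub \<Longrightarrow>
    tm (El S # G) (eAnd (App (wk U) (Var 0)) (eCov (wk x) (Sing (Var 0)))) SET"
  by (intro tm_eAnd tm_mem tm_cov tm_wS tm_v0' tm_wEl tm_Sing ty_S tm_ctx) assumption+

lemma tm_Overlap: "tm G x (El S) \<Longrightarrow> tm G U Sub \<Longrightarrow> tm G (Overlap x U) SET"
  unfolding Overlap_def by (rule tm_cSigma[OF tm_S' tm_family[OF tm_Overlap_body tm_S']])

lemma tm_Down_body: "tm G U Sub \<Longrightarrow> tm G V Sub \<Longrightarrow>
    tm (El S # G) (eAnd (Overlap (Var 0) (wk U)) (Overlap (Var 0) (wk V))) SET"
  by (intro tm_eAnd tm_Overlap tm_wS tm_v0') assumption+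

lemma tm_Down: "tm G U Sub \<Longrightarrow> tm G V Sub \<Longrightarrow> tm G (Down U V) Sub"
  unfolding Down_def by (rule tm_family[OF tm_Down_body tm_S'])

lemma tr_Down: "tm G U Sub \<Longrightarrow> tm G V Sub \<Longrightarrow> tm G a (El S) \<Longrightarrow>
    tr G (App (Down U V) a) \<longleftrightarrow> tr G (eAnd (Overlap a U) (Overlap a V))"
  unfolding Down_def using tr_conv_iff[OF teq_beta[OF tm_Down_body, simplified]] by simp

lemma tm_Compl_body: "tm G U Sub \<Longrightarrow> tm (El S # G) (Covs (Down (Sing (Var 0)) (wk U)) Empty) SET"
  by (intro tm_Covs tm_Down tm_Sing tm_wS tm_v0' tm_Empty) (assumption | rule tm_ctx tm_v0')+

lemma tm_Compl: "tm G U Sub \<Longrightarrow> tm G (Compl U) Sub"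
  unfolding Compl_def by (rule tm_family[OF tm_Compl_body tm_S'])

lemma tr_Compl: "tm G U Sub \<Longrightarrow> tm G a (El S) \<Longrightarrow>
    tr G (App (Compl U) a) \<longleftrightarrow> tr G (Covs (Down (Sing a) U) Empty)"
  unfolding Compl_def using tr_conv_iff[OF teq_beta[OF tm_Compl_body, simplified]] by simp

lemma tm_DM: "tm G P SET \<Longrightarrow> tm G (DM P) Sub"
  unfolding DM_def by (intro tm_Cup tm_Compl tm_Const tm_ctx) assumption+

lemma tm_Listed:
  assumes l: "tm G l (El (eList S))"
  shows "tm G (Listed l) Sub"
proof -
  have LS: "tm G' (eList S) SET" if "der R G' IsCtx" for G' by (rule tm_cList[OF tm_S[OF that]])
  have w: "tm (A # G') (wk t) (El (eList S))" if "tm G' t (El (eList S))" "ty G' A" for A G' t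
    using tm_weak[OF that] by simp
  note ctx = tm_ctx[OF l]
  note t1 = ty_S[OF ctx]
  note t2 = ty_El[OF LS[OF ty_ctx[OF t1]]]
  note t3 = ty_El[OF LS[OF ty_ctx[OF t2]]]
  let ?G3 = "El (eList S) # El (eList S) # El S # G"
  have j: "tm ?G3 (Var 1) (El (eList S))" using w[OF tm_var0[OF t2, simplified] t3] by simp
  have k: "tm ?G3 (Var 0) (El (eList S))" using tm_var0[OF t3] by simp
  have x: "tm ?G3 (Var 2) (El S)"
    using tm_wEl[OF tm_wEl[OF tm_v0[OF ctx] t2] t3] by (simp add: eval_nat_numeral)
  note S3 = tm_S[OF ty_ctx[OF t3]]
  have "tm ?G3 (eId (eList S) (wk (wk (wk l))) (eAppend S (Var 1) (eCons S (Var 2) (Var 0)))) SET"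
    by (rule tm_cId[OF LS[OF tm_ctx[OF x]] w[OF w[OF w[OF l t1] t2] t3] tm_eAppend[OF S3 j tm_cCons[OF S3 x k]]])
  from tm_cSigma[OF LS[OF ty_ctx[OF t2]] tm_family[OF this LS[OF ty_ctx[OF t2]]]]
  have "tm (El (eList S) # El S # G) (eSigma (eList S) (Lam (eId (eList S) (wk (wk (wk l)))
      (eAppend S (Var 1) (eCons S (Var 2) (Var 0)))))) SET" by simp
  from tm_cSigma[OF LS[OF ty_ctx[OF t1]] tm_family[OF this LS[OF ty_ctx[OF t1]]]]
  show ?thesis unfolding Listed_def by (intro tm_family[OF _ tm_S[OF ctx]])
qed

lemma tm_Subcover_body: "tm G U Sub \<Longrightarrow> tm G L Sub \<Longrightarrow>
    tm (El S # G) (eImp (App (wk L) (Var 0)) (App (wk U) (Var 0))) SET"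
  by (intro tm_eImp tm_mem tm_wS tm_v0') assumption+

lemma tm_Subcover_sub: "tm G U Sub \<Longrightarrow> tm G L Sub \<Longrightarrow>
    tm G (ePi S (Lam (eImp (App (wk L) (Var 0)) (App (wk U) (Var 0))))) SET"
  by (rule tm_cPi[OF tm_S' tm_family[OF tm_Subcover_body tm_S']])

lemma tm_Subcover: "tm G U Sub \<Longrightarrow> tm G l (El (eList S)) \<Longrightarrow> tm G (Subcover U l) SET"
  unfolding Subcover_def by (intro tm_eAnd tm_Subcover_sub tm_CovAll tm_Listed)

section \<open>Introduction and elimination for covers\<close>

lemma tr_CovsE:
  assumes U: "tm G U Sub" and V: "tm G V Sub" and "tr G (Covs U V)" and a: "tm G a (El S)" and "tr G (App U a)"
  shows "tr G (eCov a V)"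
proof -
  have "tr G (eImp (App U a) (eCov a V))"
    using tr_PiE[OF tm_S'[OF U] tm_Covs_body[OF U V] assms(3)[unfolded Covs_def] a] by simp
  from tr_ImpE[OF tm_mem[OF U a] tm_cov[OF a V] this assms(5)] show ?thesis .
qed

text \<open>In the extended context \<open>Var 1\<close> is the element and \<open>Var 0\<close> the
  proof that it belongs to \<open>U\<close>.\<close>

lemma tr_CovsI:
  assumes U: "tm G U Sub" and V: "tm G V Sub"
    and "tr (El (App (wk U) (Var 0)) # El S # G) (eCov (Var 1) (wk (wk V)))"
  shows "tr G (Covs U V)"
  unfolding Covs_def
proof (rule tr_PiI[OF tm_S'[OF U] tm_Covs_body[OF U V]])
  show "tr (El S # G) (eImp (App (wk U) (Var 0)) (eCov (Var 0) (wk V)))"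
    by (rule tr_ImpI[OF tm_mem[OF tm_wS[OF U] tm_v0'[OF U]] tm_cov[OF tm_v0'[OF U] tm_wS[OF V]]])
      (use assms(3) in simp)
qed

lemma tr_CovAllE: "tm G U Sub \<Longrightarrow> tr G (CovAll U) \<Longrightarrow> tm G a (El S) \<Longrightarrow> tr G (eCov a U)"
  using tr_PiE[OF tm_S' tm_CovAll_body] by (fastforce simp: CovAll_def)

lemma tr_CovAllI: "tm G U Sub \<Longrightarrow> tr (El S # G) (eCov (Var 0) (wk U)) \<Longrightarrow> tr G (CovAll U)"
  unfolding CovAll_def by (rule tr_PiI[OF tm_S' tm_CovAll_body])

lemma tr_OverlapI:
  assumes x: "tm G x (El S)" and U: "tm G U Sub" and a: "tm G a (El S)"
    and "tr G (App U a)" and "tr G (eCov x (Sing a))"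
  shows "tr G (Overlap x U)"
  unfolding Overlap_def
  by (rule tr_SigmaI[OF tm_S'[OF x] tm_Overlap_body[OF x U] a])
    (use tr_AndI[OF tm_mem[OF U a] tm_cov[OF x tm_Sing[OF a]] assms(4,5)] in simp)

lemma tr_OverlapE:
  assumes x: "tm G x (El S)" and U: "tm G U Sub" and "tr G (Overlap x U)"
  shows "\<exists>a. tm G a (El S) \<and> tr G (App U a)"
proof -
  obtain a where a: "tm G a (El S)" and "tr G (eAnd (App U a) (eCov x (Sing a)))"
    using tr_SigmaE[OF tm_S'[OF x] tm_Overlap_body[OF x U] assms(3)[unfolded Overlap_def]] by auto
  then show ?thesis using tr_AndE(1)[OF tm_mem[OF U a] tm_cov[OF x tm_Sing[OF a]]] by blast
qed

text \<open>An element of the meet with the empty subset would lie below an element of the empty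
  subset, and falsity proves any cover.\<close>

lemma tr_Compl_Empty:
  assumes a: "tm G a (El S)"
  shows "tr G (App (Compl (Const (Cst cN0))) a)"
proof -
  let ?U = "Const (Cst cN0) :: 'x cn exp"
  note ctx = tm_ctx[OF a]
  have E: "tm G' ?U Sub" if "der R G' IsCtx" for G' using tm_Empty[OF that] by (simp add: Empty_Const)
  note Sa = tm_Sing[OF a]
  note D = tm_Down[OF Sa E[OF ctx]]
  have "tr G (Covs (Down (Sing a) ?U) Empty)"
  proof (rule tr_CovsI[OF D tm_Empty[OF ctx]])
    let ?D = "App (Down (Sing (wk a)) ?U) (Var 0)"
    let ?G = "El ?D # El S # G"
    note a1 = tm_wEl[OF a ty_S[OF ctx]]
    have D1: "tm (El S # G) ?D SET"
      by (rule tm_mem[OF tm_Down[OF tm_Sing[OF a1] E[OF tm_ctx[OF a1]]] tm_v0[OF ctx]])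
    note a2 = tm_wEl[OF a1 ty_El[OF D1]]
    have v: "tm ?G (Var 1) (El S)" using tm_wEl[OF tm_v0[OF ctx] ty_El[OF D1]] by simp
    note c2 = tm_ctx[OF v]
    have "tr ?G (App (Down (Sing (wk (wk a))) ?U) (Var 1))" using tr_hyp[OF D1] by simp
    then have "tr ?G (eAnd (Overlap (Var 1) (Sing (wk (wk a)))) (Overlap (Var 1) ?U))"
      using tr_Down[OF tm_Sing[OF a2] E[OF c2] v] by simp
    then have "tr ?G (Overlap (Var 1) ?U)"
      by (rule tr_AndE(2)[OF tm_Overlap[OF v tm_Sing[OF a2]] tm_Overlap[OF v E[OF c2]]])
    then obtain b where "tm ?G b (El S)" "tr ?G (App ?U b)" using tr_OverlapE[OF v E[OF c2]] by blast
    then have "tr ?G (Cst cN0)" using tr_Const[OF tm_cN0[OF c2]] by blast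
    from tr_N0E[OF this tm_cov[OF v tm_Empty[OF c2]]]
    show "tr (El (App (wk (Down (Sing a) ?U)) (Var 0)) # El S # G) (eCov (Var 1) (wk (wk Empty)))"
      by simp
  qed
  then show ?thesis using tr_Compl[OF E[OF ctx] a] by blast
qed

end

lemmas hprop_defs = hexp_defs pAll_def pEx_def pImp_def pAnd_def pOr_def pNot_def tEmpty_def tSing_def tUn_def tCovs_def
  tCovAll_def tDown_def tPseudocompl_def tAppend_def tListed_def

text \<open>For closed expressions the embedding under binders is constant, hence the functions
  ignoring their argument.\<close>

lemma (in ctt_cover) prop_simps:
  "(tCovRefl (\<lambda>_. S) (\<lambda>_. c) 0) = Fun (El S) (Fun Sub (Fun (El (App (Var 0) (Var 1))) (El (eCov (Var 2) (Var 1)))))"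
  "tCovTrans (\<lambda>_. S) (\<lambda>_. c) 0 = Fun (El S) (Fun Sub (Fun Sub (Fun (El (eCov (Var 2) (Var 1)))
      (Fun (El (Covs (Var 2) (Var 1))) (El (eCov (Var 4) (Var 2)))))))"
  "tNontrivial (\<lambda>_. S) (\<lambda>_. c) 0 = El (eImp (CovAll Empty) (Cst cN0))"
  "tDeMorgan (\<lambda>_. S) (\<lambda>_. c) 0 = Fun Sub (El (CovAll (Cup (Compl (Compl (Var 0))) (Compl (Var 0)))))"
  "tCompact (\<lambda>_. S) (\<lambda>_. c) 0 = Fun Sub (Fun (El (CovAll (Var 0))) (El (eSigma (eList S) (Lam (Subcover (Var 2) (Var 0))))))"
  by (simp_all add: tCovRefl_def tCovTrans_def tNontrivial_def tDeMorgan_def tCompact_def hprop_defs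
      Covs_def CovAll_def Empty_def Sing_def Cup_def Overlap_def Down_def Compl_def Listed_def Subcover_def eval_nat_numeral)

text \<open>Passing from \<open>S\<close> and \<open>c\<close> to closed expressions: substituting a
  constant for all free variables commutes with forming each of the properties.\<close>

lemma esub_props:
  fixes S c :: "'x cn exp"
  defines "s \<equiv> (\<lambda>_. Cst cN0) :: nat \<Rightarrow> 'x cn exp"
  shows "esub s (tCovRefl (emb S) (emb c) 0) = tCovRefl (\<lambda>_. esub s S) (\<lambda>_. esub s c) 0"
    and "esub s (tCovTrans (emb S) (emb c) 0) = tCovTrans (\<lambda>_. esub s S) (\<lambda>_. esub s c) 0"
    and "esub s (tNontrivial (emb S) (emb c) 0) = tNontrivial (\<lambda>_. esub s S) (\<lambda>_. esub s c) 0"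
    and "esub s (tDeMorgan (emb S) (emb c) 0) = tDeMorgan (\<lambda>_. esub s S) (\<lambda>_. esub s c) 0"
    and "esub s (tCompact (emb S) (emb c) 0) = tCompact (\<lambda>_. esub s S) (\<lambda>_. esub s c) 0"
  by (simp_all add: s_def tCovRefl_def tCovTrans_def tNontrivial_def tDeMorgan_def tCompact_def hprop_defs
      emb_def esub_eren eval_nat_numeral)

locale ctt_compact_de_morgan = ctt_cover R S c for R :: "'x cn rule set" and S c +
  assumes cov_refl: "\<exists>t. tm [] t (Fun (El S) (Fun Sub (Fun (El (App (Var 0) (Var 1))) (El (eCov (Var 2) (Var 1))))))"
    and cov_trans: "\<exists>t. tm [] t (Fun (El S) (Fun Sub (Fun Sub (Fun (El (eCov (Var 2) (Var 1)))
      (Fun (El (Covs (Var 2) (Var 1))) (El (eCov (Var 4) (Var 2))))))))"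
    and nontrivial: "\<exists>t. tm [] t (El (eImp (CovAll Empty) (Cst cN0)))"
    and de_morgan: "\<exists>t. tm [] t (Fun Sub (El (CovAll (Cup (Compl (Compl (Var 0))) (Compl (Var 0))))))"
    and compact: "\<exists>t. tm [] t (Fun Sub (Fun (El (CovAll (Var 0))) (El (eSigma (eList S) (Lam (Subcover (Var 2) (Var 0)))))))"
begin

section \<open>The properties of the space as rules of inference\<close>

lemma tr_refl:
  assumes a: "tm G a (El S)" and U: "tm G U Sub" and p: "tr G (App U a)"
  shows "tr G (eCov a U)"
proof -
  obtain q where q: "tm G q (El (App U a))" using p by (auto simp: tr_def)
  obtain t where t: "tm [] t (Fun (El S) (Fun Sub (Fun (El (App (Var 0) (Var 1))) (El (eCov (Var 2) (Var 1))))))"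
    using cov_refl by blast
  from tr_step[OF tm_step[OF tm_step[OF tm_empty_context[OF t tm_ctx[OF a]], of a], of U], of q]
  show ?thesis using a U q by (simp add: eval_nat_numeral)
qed

lemma tr_trans:
  assumes a: "tm G a (El S)" and U: "tm G U Sub" and V: "tm G V Sub"
    and p: "tr G (eCov a U)" and q: "tr G (Covs U V)"
  shows "tr G (eCov a V)"
proof -
  obtain p q where p: "tm G p (El (eCov a U))" and q: "tm G q (El (Covs U V))" using p q by (auto simp: tr_def)
  obtain t where t: "tm [] t (Fun (El S) (Fun Sub (Fun Sub (Fun (El (eCov (Var 2) (Var 1)))
      (Fun (El (Covs (Var 2) (Var 1))) (El (eCov (Var 4) (Var 2))))))))"
    using cov_trans by blast
  from tr_step[OF tm_step[OF tm_step[OF tm_step[OF tm_step[OF tm_empty_context[OF t tm_ctx[OF a]], of a], of U], of V], of p], of q]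
  show ?thesis using a U V p q by (simp add: eval_nat_numeral)
qed

lemma tr_DM:
  assumes P: "tm G P SET"
  shows "tr G (CovAll (DM P))"
proof -
  obtain t where t: "tm G t (Fun Sub (El (CovAll (Cup (Compl (Compl (Var 0))) (Compl (Var 0))))))"
    using de_morgan tm_closed_context[OF _ tm_ctx[OF P]] by blast
  from tm_app[OF this tm_Const[OF tm_ctx[OF P] P]] show ?thesis by (auto intro: trI simp: DM_def)
qed

lemma tr_compact:
  assumes U: "tm G U Sub" and "tr G (CovAll U)"
  shows "tr G (eSigma (eList S) (Lam (Subcover (wk U) (Var 0))))"
proof -
  obtain p where p: "tm G p (El (CovAll U))" using assms(2) by (auto simp: tr_def)
  obtain t where t: "tm [] t (Fun Sub (Fun (El (CovAll (Var 0))) (El (eSigma (eList S) (Lam (Subcover (Var 2) (Var 0)))))))"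
    using compact by blast
  from tr_step[OF tm_step[OF tm_empty_context[OF t tm_ctx[OF U]], of U], of p]
  show ?thesis using U p by (simp add: eval_nat_numeral)
qed

lemma tr_covered:
  assumes a: "tm G a (El S)" and U: "tm G U Sub" and "tr G (App U a)" and "tr G (App (Compl U) a)"
  shows "tr G (eCov a Empty)"
proof -
  note Sa = tm_Sing[OF a]
  have aa: "tr G (eCov a (Sing a))" by (rule tr_refl[OF a Sa tr_Sing[OF a]])
  have "tr G (eAnd (Overlap a (Sing a)) (Overlap a U))"
    by (rule tr_AndI[OF tm_Overlap[OF a Sa] tm_Overlap[OF a U]
        tr_OverlapI[OF a Sa a tr_Sing[OF a] aa] tr_OverlapI[OF a U a assms(3) aa]])
  then have "tr G (App (Down (Sing a) U) a)" using tr_Down[OF Sa U a] by blast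
  moreover have "tr G (Covs (Down (Sing a) U) Empty)" using assms(4) tr_Compl[OF U a] by blast
  ultimately show ?thesis using tr_CovsE[OF tm_Down[OF Sa U] tm_Empty[OF tm_ctx[OF a]] _ a] by blast
qed

text \<open>The principle is applied in the empty context, with the lists over \<open>S\<close> as
  the set of values. A term typed there stays well typed under any renaming, and allowing all of
  them handles every later weakening of \<open>l\<close> at once.\<close>

lemma uniform_subcover:
  "\<exists>l. (\<forall>f G. der R G IsCtx \<longrightarrow> tm G (eren f l) (El (eList S))) \<and>
    (\<forall>f G P. tm G P SET \<longrightarrow> tr G (Subcover (DM P) (eren f l)))"
proof -
  have t: "ty [] SET" by (rule ty_SET[OF der.ctx_nil])
  have v: "tm [SET] (Var 0) SET" using tm_var0[OF t] by simp
  have L: "tm G (eList S) SET" if "der R G IsCtx" for G by (rule tm_cList[OF tm_S[OF that]])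
  note t1 = ty_El[OF L[OF tm_ctx[OF v]]]
  have v1: "tm [El (eList S), SET] (Var 1) SET" using tm_weak[OF v t1] by simp
  have v0: "tm [El (eList S), SET] (Var 0) (El (eList S))" using tm_var0[OF t1] by simp
  have Q: "tm [El (eList S), SET] (Subcover (DM (Var 1)) (Var 0)) SET" by (rule tm_Subcover[OF tm_DM[OF v1] v0])
  have "tr [SET] (eSigma (eList S) (Lam (Subcover (DM (Var 1)) (Var 0))))"
    using tr_compact[OF tm_DM[OF v] tr_DM[OF v]] by simp
  with uniformity[of "[]" "eList S" "Subcover (DM (Var 1)) (Var 0)", OF L[OF der.ctx_nil]] Q
  obtain l where l: "tm [] l (El (eList S))" "tr [SET] (Subcover (DM (Var 0)) (wk l))" by auto
  have sb: "sb G (\<lambda>i. Var (f i)) []" if "der R G IsCtx" for G and f :: "nat \<Rightarrow> nat" using that by (simp add: sb_def)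
  have "tm G (eren f l) (El (eList S))" if "der R G IsCtx" for f G
    using tm_esub[OF l(1) sb[OF that]] by (simp add: eren_as_esub[of f l])
  moreover have "tr G (Subcover (DM P) (eren f l))" if P: "tm G P SET" for f G P
  proof -
    \<comment> \<open>One substitution both puts \<open>P\<close> for the generic proposition and
      renames \<open>l\<close>.\<close>
    have "sb G (scons P (\<lambda>i. Var (f i))) [SET]" by (rule sb_cons[OF sb[OF tm_ctx[OF P]]]) (simp add: P)
    from tr_esub[OF l(2) this] show ?thesis by (simp add: esub_eren eren_as_esub[of f l])
  qed
  ultimately show ?thesis by blast
qed

lemma tr_SubcoverE:
  assumes l: "tm G l (El (eList S))" and P: "tm G P SET" and x: "tm G x (El S)"
    and "tr G (Subcover (DM P) l)" and "tr G (App (Listed l) x)"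
  shows "tr G (ePlus (App (Compl (Compl (Const P))) x) (App (Compl (Const P)) x))"
proof -
  note U = tm_DM[OF P] and L = tm_Listed[OF l]
  have "tr G (ePi S (Lam (eImp (App (wk (Listed l)) (Var 0)) (App (wk (DM P)) (Var 0)))))"
    by (rule tr_AndE(1)[OF tm_Subcover_sub[OF U L] tm_CovAll[OF L] assms(4)[unfolded Subcover_def]])
  from tr_PiE[OF tm_S'[OF x] tm_Subcover_body[OF U L] this x]
  have "tr G (eImp (App (Listed l) x) (App (DM P) x))" by simp
  from tr_ImpE[OF tm_mem[OF L x] tm_mem[OF U x] this assms(5)]
  show ?thesis unfolding DM_def
    using tr_Cup[OF tm_Compl[OF tm_Compl] tm_Compl x] tm_Const[OF tm_ctx[OF P] P] by blast
qed

text \<open>The codes \<open>uN1\<close> and \<open>uN0\<close> in the universe are the tags, since the decodings of one tag cannot be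
  both true and false.\<close>

definition "Tagged t P x = ePlus (eAnd (eT t) (App (Compl (Compl (Const P))) x))
  (eAnd (eImp (eT t) (Cst cN0)) (App (Compl (Const P)) x))"

lemma subst_Tagged [simp]:
  "esub s (Tagged t P x) = Tagged (esub s t) (esub s P) (esub s x)"
  "eren f (Tagged t P x) = Tagged (eren f t) (eren f P) (eren f x)"
  by (simp_all add: Tagged_def)

lemma Tagged_parts:
  assumes t: "tm G t (El (Cst cU))" and P: "tm G P SET" and x: "tm G x (El S)"
  shows "tm G (eT t) SET" "tm G (App (Compl (Compl (Const P))) x) SET"
    "tm G (eImp (eT t) (Cst cN0)) SET" "tm G (App (Compl (Const P)) x) SET"
    "tm G (eAnd (eT t) (App (Compl (Compl (Const P))) x)) SET"
    "tm G (eAnd (eImp (eT t) (Cst cN0)) (App (Compl (Const P)) x)) SET"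
proof -
  note ctx = tm_ctx[OF x]
  show 1: "tm G (eT t) SET" by (rule tm_cT[OF t])
  show 2: "tm G (eImp (eT t) (Cst cN0)) SET" by (rule tm_eImp[OF 1 tm_cN0[OF ctx]])
  show 3: "tm G (App (Compl (Compl (Const P))) x) SET" "tm G (App (Compl (Const P)) x) SET"
    by (intro tm_mem tm_Compl tm_Const ctx P x)+
  show "tm G (eAnd (eT t) (App (Compl (Compl (Const P))) x)) SET" by (rule tm_eAnd[OF 1 3(1)])
  show "tm G (eAnd (eImp (eT t) (Cst cN0)) (App (Compl (Const P)) x)) SET" by (rule tm_eAnd[OF 2 3(2)])
qed

lemma tm_Tagged: "tm G t (El (Cst cU)) \<Longrightarrow> tm G P SET \<Longrightarrow> tm G x (El S) \<Longrightarrow> tm G (Tagged t P x) SET"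
  unfolding Tagged_def by (intro tm_cPlus Tagged_parts)

lemma tr_Tagged1:
  assumes P: "tm G P SET" and x: "tm G x (El S)" and "tr G (App (Compl (Compl (Const P))) x)"
  shows "tr G (Tagged (Cst uN1) P x)"
proof -
  note ctx = tm_ctx[OF x]
  note p = Tagged_parts[OF tm_uN1[OF ctx] P x]
  have "tr G (eT (Cst uN1))" by (rule tr_conv[OF tr_N1[OF ctx] teq_sym[OF teq_uN1[OF ctx]]])
  then show ?thesis unfolding Tagged_def by (intro tr_PlusI1[OF p(5,6)] tr_AndI[OF p(1,2)] assms)
qed

lemma tr_Tagged0:
  assumes P: "tm G P SET" and x: "tm G x (El S)" and "tr G (App (Compl (Const P)) x)"
  shows "tr G (Tagged (Cst uN0) P x)"
proof -
  note ctx = tm_ctx[OF x]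
  note p = Tagged_parts[OF tm_uN0[OF ctx] P x]
  have "tr G (eImp (eT (Cst uN0)) (Cst cN0))"
  proof (rule tr_ImpI[OF p(1) tm_cN0[OF ctx]])
    note c1 = ty_ctx[OF ty_El[OF p(1)]]
    show "tr (El (eT (Cst uN0)) # G) (wk (Cst cN0))"
      using tr_conv[OF tr_hyp[OF p(1), simplified] teq_uN0[OF c1]] by simp
  qed
  then show ?thesis unfolding Tagged_def by (intro tr_PlusI2[OF p(5,6)] tr_AndI[OF p(3,4)] assms)
qed

lemma tm_Tagged_body:
  assumes P: "tm G P SET" and x: "tm G x (El S)"
  shows "tm (El (Cst cU) # G) (Tagged (Var 0) (wk P) (wk x)) SET"
proof -
  have t: "ty G (El (Cst cU))" by (rule ty_El[OF tm_cU[OF tm_ctx[OF x]]])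
  show ?thesis
    by (rule tm_Tagged) (use tm_var0[OF t] tm_weak[OF P t] tm_weak[OF x t] in simp_all)
qed

text \<open>Each alternative supplies its own code as witness, \<open>uN1\<close> or
  \<open>uN0\<close>.\<close>

lemma tr_tag_exists:
  assumes P: "tm G P SET" and x: "tm G x (El S)"
    and "tr G (ePlus (App (Compl (Compl (Const P))) x) (App (Compl (Const P)) x))"
  shows "tr G (eSigma (Cst cU) (Lam (Tagged (Var 0) (wk P) (wk x))))"
proof -
  have I: "tr G' (eSigma (Cst cU) (Lam (Tagged (Var 0) (wk P') (wk x'))))"
    if P: "tm G' P' SET" and x: "tm G' x' (El S)" and u: "tm G' u (El (Cst cU))" and t: "tr G' (Tagged u P' x')" for G' P' x' u
    by (rule tr_SigmaI[OF tm_cU[OF tm_ctx[OF x]] tm_Tagged_body[OF P x] u]) (simp add: t)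
  note p = Tagged_parts[OF tm_uN0[OF tm_ctx[OF x]] P x]
  show ?thesis
  proof (rule tr_PlusE[OF p(2,4) _ assms(3)])
    show "tm G (eSigma (Cst cU) (Lam (Tagged (Var 0) (wk P) (wk x)))) SET"
      by (rule tm_cSigma[OF tm_cU[OF tm_ctx[OF x]] tm_family[OF tm_Tagged_body[OF P x] tm_cU[OF tm_ctx[OF x]]]])
    have w: "tm (El A # G) (wk P) SET" "tm (El A # G) (wk x) (El S)" if "tm G A SET" for A
      using tm_weak[OF P ty_El[OF that]] tm_weak[OF x ty_El[OF that]] by simp_all
    note w2 = w[OF p(2)] and w4 = w[OF p(4)]
    show "tr (El (App (Compl (Compl (Const P))) x) # G) (wk (eSigma (Cst cU) (Lam (Tagged (Var 0) (wk P) (wk x)))))"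
      using I[OF w2 tm_uN1[OF tm_ctx[OF w2(1)]] tr_Tagged1[OF w2]] tr_hyp[OF p(2)] by simp
    show "tr (El (App (Compl (Const P)) x) # G) (wk (eSigma (Cst cU) (Lam (Tagged (Var 0) (wk P) (wk x)))))"
      using I[OF w4 tm_uN0[OF tm_ctx[OF w4(1)]] tr_Tagged0[OF w4]] tr_hyp[OF p(4)] by simp
  qed
qed

text \<open>The same tag \<open>t\<close> serves the true and the false proposition. If
  \<open>t\<close> decodes to something refuted, \<open>x\<close> is in the pseudocomplement of the
  whole space; if \<open>t\<close> decodes to something true, \<open>x\<close> is in the double
  pseudocomplement of the empty subset.\<close>

lemma tr_Tagged_covered:
  assumes t: "tm G t (El (Cst cU))" and x: "tm G x (El S)"
    and t1: "tr G (Tagged t (Cst cN1) x)" and t0: "tr G (Tagged t (Cst cN0) x)"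
  shows "tr G (eCov x Empty)"
proof -
  have cov: "tm G' (eCov y Empty) SET" if "tm G' y (El S)" for G' y
    by (rule tm_cov[OF that tm_Empty[OF tm_ctx[OF that]]])
  note ctx = tm_ctx[OF x]
  note p1 = Tagged_parts[OF t tm_cN1[OF ctx] x]
  show ?thesis
  proof (rule tr_PlusE[OF p1(5,6) cov[OF x] t1[unfolded Tagged_def]])
    let ?G = "El (eAnd (eT t) (App (Compl (Compl (Const (Cst cN1)))) x)) # G"
    let ?t = "wk t" and ?x = "wk x"
    have t': "tm ?G ?t (El (Cst cU))" and x': "tm ?G ?x (El S)"
      using tm_weak[OF t ty_El[OF p1(5)]] tm_weak[OF x ty_El[OF p1(5)]] by simp_all
    note ctx' = tm_ctx[OF x']
    note q1 = Tagged_parts[OF t' tm_cN1[OF ctx'] x'] and q0 = Tagged_parts[OF t' tm_cN0[OF ctx'] x']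
    have T: "tr ?G (eT ?t)" by (rule tr_AndE(1)[OF q1(1,2)]) (use tr_hyp[OF p1(5)] in simp)
    \<comment> \<open>The decoding of \<open>t\<close> is true in this branch, so the tag for the
      false proposition has to choose its first alternative as well or contradict it.\<close>
    have "tr ?G (Tagged ?t (Cst cN0) ?x)" using tr_weak[OF t0 ty_El[OF p1(5)]] by simp
    then have "tr ?G (eCov ?x Empty)" unfolding Tagged_def
    proof (rule tr_PlusE[OF q0(5,6) cov[OF x']])
      let ?H = "El (eAnd (eT ?t) (App (Compl (Compl (Const (Cst cN0)))) ?x)) # ?G"
      have t'': "tm ?H (wk ?t) (El (Cst cU))" and x'': "tm ?H (wk ?x) (El S)"
        using tm_weak[OF t' ty_El[OF q0(5)]] tm_weak[OF x' ty_El[OF q0(5)]] by simp_all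
      note ctx'' = tm_ctx[OF x'']
      note r = Tagged_parts[OF t'' tm_cN0[OF ctx''] x'']
      have "tr ?H (App (Compl (Compl (Const (Cst cN0)))) (wk ?x))"
        by (rule tr_AndE(2)[OF r(1,2)]) (use tr_hyp[OF q0(5)] in simp)
      then show "tr ?H (wk (eCov ?x Empty))"
        using tr_covered[OF x'' tm_Compl[OF tm_Const[OF ctx'' tm_cN0[OF ctx'']]] tr_Compl_Empty[OF x'']] by simp
    next
      let ?H = "El (eAnd (eImp (eT ?t) (Cst cN0)) (App (Compl (Const (Cst cN0))) ?x)) # ?G"
      have t'': "tm ?H (wk ?t) (El (Cst cU))" and x'': "tm ?H (wk ?x) (El S)"
        using tm_weak[OF t' ty_El[OF q0(6)]] tm_weak[OF x' ty_El[OF q0(6)]] by simp_all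
      note ctx'' = tm_ctx[OF x'']
      note r = Tagged_parts[OF t'' tm_cN0[OF ctx''] x'']
      have "tr ?H (eImp (eT (wk ?t)) (Cst cN0))"
        by (rule tr_AndE(1)[OF r(3,4)]) (use tr_hyp[OF q0(6)] in simp)
      moreover have "tr ?H (eT (wk ?t))" using tr_weak[OF T ty_El[OF q0(6)]] by simp
      ultimately have "tr ?H (Cst cN0)" by (rule tr_ImpE[OF r(1) tm_cN0[OF ctx'']])
      then show "tr ?H (wk (eCov ?x Empty))" using tr_N0E[OF _ cov[OF x'']] by simp
    qed
    then show "tr ?G (wk (eCov x Empty))" by simp
  next
    let ?G = "El (eAnd (eImp (eT t) (Cst cN0)) (App (Compl (Const (Cst cN1))) x)) # G"
    let ?t = "wk t" and ?x = "wk x"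
    have t': "tm ?G ?t (El (Cst cU))" and x': "tm ?G ?x (El S)"
      using tm_weak[OF t ty_El[OF p1(6)]] tm_weak[OF x ty_El[OF p1(6)]] by simp_all
    note ctx' = tm_ctx[OF x']
    note q1 = Tagged_parts[OF t' tm_cN1[OF ctx'] x']
    have "tr ?G (App (Compl (Const (Cst cN1))) ?x)"
      by (rule tr_AndE(2)[OF q1(3,4)]) (use tr_hyp[OF p1(6)] in simp)
    moreover have "tr ?G (App (Const (Cst cN1)) ?x)"
      using tr_Const[OF tm_cN1[OF ctx'] x'] tr_N1[OF ctx'] by blast
    ultimately show "tr ?G (wk (eCov x Empty))"
      using tr_covered[OF x' tm_Const[OF ctx' tm_cN1[OF ctx']]] by simp
  qed
qed

text \<open>Uniformity over the universe fixes the tag; afterwards the generic proposition is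
  instantiated by truth and by falsity.\<close>

lemma tr_uniform_covered:
  assumes x: "tm G x (El S)"
    and "tr (SET # G) (ePlus (App (Compl (Compl (Const (Var 0)))) (wk x)) (App (Compl (Const (Var 0))) (wk x)))"
  shows "tr G (eCov x Empty)"
proof -
  note ctx = tm_ctx[OF x]
  note t = ty_SET[OF ctx]
  have P: "tm (SET # G) (Var 0) SET" using tm_var0[OF t] by simp
  have x1: "tm (SET # G) (wk x) (El S)" using tm_weak[OF x t] by simp
  have "tm (El (Cst cU) # SET # G) (Tagged (Var 0) (Var 1) (wk (wk x))) SET"
    using tm_Tagged_body[OF P x1] by simp
  moreover have "tr (SET # G) (eSigma (Cst cU) (Lam (Tagged (Var 0) (Var 1) (wk (wk x)))))"
    using tr_tag_exists[OF P x1 assms(2)] by simp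
  ultimately obtain i where i: "tm G i (El (Cst cU))" and i': "tr (SET # G) (Tagged (wk i) (Var 0) (wk x))"
    using uniformity[OF tm_cU[OF ctx], of "Tagged (Var 0) (Var 1) (wk (wk x))"] by auto
  have "tr G (Tagged i P x)" if "tm G P SET" for P
    using tr_esub[OF i' sb_single[OF that]] by simp
  then show ?thesis using tr_Tagged_covered[OF i x] tm_cN0[OF ctx] tm_cN1[OF ctx] by blast
qed

text \<open>One list covers \<open>S\<close> whatever the proposition, and each of its listed
  elements is covered by the empty subset, so transitivity trivialises the space.\<close>

theorem inconsistent: "tr [] (Cst cN0)"
proof -
  obtain l where l: "\<And>f G. der R G IsCtx \<Longrightarrow> tm G (eren f l) (El (eList S))"
    and sub: "\<And>f G P. tm G P SET \<Longrightarrow> tr G (Subcover (DM P) (eren f l))" using uniform_subcover by blast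
  have nil: "der R [] IsCtx" by (rule der.ctx_nil)
  let ?l = "eren (\<lambda>i. i) l"
  note L = tm_Listed[OF l[OF nil]]
  have covs: "tr [] (Covs (Listed ?l) Empty)"
  proof (rule tr_CovsI[OF L tm_Empty[OF nil]])
    let ?G1 = "[El S]"
    let ?A = "App (Listed (wk l)) (Var 0)"
    let ?G2 = "[El ?A, El S]"
    \<comment> \<open>Three binders have been crossed: the element, the proof that it is listed, and
      the generic proposition.\<close>
    let ?l3 = "eren (\<lambda>i. Suc (Suc (Suc i))) l"
    have v: "tm ?G1 (Var 0) (El S)" by (rule tm_v0[OF nil])
    have A: "tm ?G1 ?A SET" by (rule tm_mem[OF tm_Listed[OF l[OF tm_ctx[OF v]]] v])
    have x: "tm ?G2 (Var 1) (El S)" using tm_wEl[OF v ty_El[OF A]] by simp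
    note t = ty_SET[OF tm_ctx[OF x]]
    have P: "tm (SET # ?G2) (Var 0) SET" using tm_var0[OF t] by simp
    have x3: "tm (SET # ?G2) (Var 2) (El S)" using tm_wEl[OF x t] by (simp add: eval_nat_numeral)
    have "tr (SET # ?G2) (App (Listed ?l3) (Var 2))"
      using tr_weak[OF tr_hyp[OF A] t] by (simp add: eren_eren eval_nat_numeral)
    from tr_SubcoverE[OF l[OF tm_ctx[OF x3]] P x3 sub[OF P] this]
    have "tr (SET # ?G2) (ePlus (App (Compl (Compl (Const (Var 0)))) (wk (Var 1))) (App (Compl (Const (Var 0))) (wk (Var 1))))"
      by (simp add: eval_nat_numeral)
    from tr_uniform_covered[OF x this]
    show "tr [El (App (wk (Listed ?l)) (Var 0)), El S] (eCov (Var 1) (wk (wk Empty)))"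
      by (simp add: eren_eren)
  qed
  have v: "tm [El S] (Var 0) (El S)" by (rule tm_v0[OF nil])
  \<comment> \<open>Any proposition would do, since the cover of \<open>S\<close> by the list does
    not mention it.\<close>
  note P = tm_cN0[OF nil]
  have all: "tr [] (CovAll (Listed ?l))"
    by (rule tr_AndE(2)[OF tm_Subcover_sub[OF tm_DM[OF P] L] tm_CovAll[OF L]])
      (use sub[OF P] in \<open>simp only: Subcover_def\<close>)
  have "tr [] (CovAll Empty)"
  proof (rule tr_CovAllI[OF tm_Empty[OF nil]])
    note c1 = tm_ctx[OF v]
    have "tr [El S] (CovAll (wk (Listed ?l)))" "tr [El S] (Covs (wk (Listed ?l)) Empty)"
      using tr_weak[OF all ty_S[OF nil]] tr_weak[OF covs ty_S[OF nil]] by simp_all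
    then have "tr [El S] (eCov (Var 0) Empty)"
      using tr_trans[OF v tm_wS[OF L] tm_Empty[OF c1]] tr_CovAllE[OF tm_wS[OF L] _ v] by blast
    then show "tr [El S] (eCov (Var 0) (wk Empty))" by simp
  qed
  moreover have "tr [] (eImp (CovAll Empty) (Cst cN0))" using nontrivial by (auto simp: tr_def)
  ultimately show ?thesis using tr_ImpE[OF tm_CovAll[OF tm_Empty[OF nil]] tm_cN0[OF nil]] by blast
qed

end

lemma der_mono: "der R G J \<Longrightarrow> R \<subseteq> R' \<Longrightarrow> der R' G J"
proof (induction rule: der.induct)
  case (rule Ps G J)
  then show ?case by (blast intro: der.rule)
next
  case (subst G J D s)
  then show ?case by (intro der.subst[of R' G J D s]) simp_all
qed (metis der.ctx_nil der.ctx_cons der.var der.type_refl der.type_sym der.type_trans der.elem_refl der.elem_sym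
    der.elem_trans der.elem_conv der.eq_conv der.type_cong der.elem_cong der.SET der.El der.El_eq der.Fun der.Fun_eq
    der.abs der.app der.app_eq der.xi der.beta der.eta)+

theorem no_compact_de_morgan_ctt:
  fixes R :: "'x cn rule set"
  assumes R: "CTT_star R" and sp: "nontrivial_de_morgan_space_in_ctt R S c"
  shows "\<not> provably_compact_in_ctt R S c"
proof
  assume co: "provably_compact_in_ctt R S c"
  \<comment> \<open>Rules of \<open>R\<close> may mention variables outside their context, so that \<open>S\<close> and \<open>c\<close> need not be closed.\<close>
  define s :: "nat \<Rightarrow> 'x cn exp" where "s = (\<lambda>_. Cst cN0)"
  interpret T: ctt_theory "R \<union> GUP_CTT"
    by standard (use R in \<open>auto simp: CTT_star_def\<close>)
  \<comment> \<open>The empty context has no variables to check, so every substitution from it is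
    admissible.\<close>
  have close: "T.tm [] (esub s t) (esub s A)" if "der R [] (Elem t A)" for t A
  proof (rule T.tm_esub)
    show "T.tm [] t A" using der_mono[OF that, of "R \<union> GUP_CTT"] by (simp add: T.tm_def der.ctx_nil)
    show "T.sb [] s []" by (simp add: T.sb_def der.ctx_nil)
  qed
  have closed: "closed (esub s e)" for e by (simp add: closed_def esub_esub s_def)
  have S: "T.tm [] (esub s S) SET" using close[of S SET] sp by (simp add: nontrivial_de_morgan_space_in_ctt_def)
  have c: "T.tm [] (esub s c) (Fun (El (esub s S)) (Fun (Fun (El (esub s S)) SET) SET))"
    using close[of c "(ElT (emb S) \<^bold>\<Rightarrow> SubT (emb S) \<^bold>\<Rightarrow> SetT) 0"] sp
    by (simp add: nontrivial_de_morgan_space_in_ctt_def hexp_defs emb_def esub_eren s_def)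
  interpret C: ctt_cover "R \<union> GUP_CTT" "esub s S" "esub s c"
    by standard (fact closed closed S c)+
  have inh: "\<exists>t. T.tm [] t (esub s (A 0))" if "inhabited R A" for A
    using that close by (auto simp: inhabited_def)
  note tr = esub_props[of S c, folded s_def, unfolded C.prop_simps]
  interpret ctt_compact_de_morgan "R \<union> GUP_CTT" "esub s S" "esub s c"
    by standard (use sp co inh[of "tCovRefl (emb S) (emb c)"] inh[of "tCovTrans (emb S) (emb c)"]
        inh[of "tNontrivial (emb S) (emb c)"] inh[of "tDeMorgan (emb S) (emb c)"] inh[of "tCompact (emb S) (emb c)"]
      in \<open>simp_all only: tr nontrivial_de_morgan_space_in_ctt_def provably_compact_in_ctt_def simp_thms\<close>)
  show False using inconsistent R by (auto simp: T.tr_def T.tm_def CTT_star_def inhabited_def cst_def ElT_def)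
qed

theorem theorem4p10:
  shows "(\<forall>T. CZF_star T \<longrightarrow>
           \<not> (\<exists>p c. nontrivial_de_morgan_space_in_czf T p c \<and> provably_compact_in_czf T p c)) \<and>
         (\<forall>R :: 'x cn rule set. CTT_star R \<longrightarrow>
           \<not> (\<exists>S c. nontrivial_de_morgan_space_in_ctt R S c \<and> provably_compact_in_ctt R S c))"
  using no_compact_de_morgan_czf no_compact_de_morgan_ctt by blast

end
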